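(* Let $n\ge 4$, $R\ge 1$ and $\ell$ be integers with $\ell>\max\{n+1,\frac n2+4\}$. Let $\mathbf{x}_0\in\mathbb{R}^n$ and let $f_1,\dots,f_R\in\mathcal{C}^{\ell}(\mathbb{R}^n)$ be real-valued functions such that for every $\mathbf{t}=(t_1,\dots,t_R)\in\mathbb{R}^R\setminus\{\mathbf 0\}$ $$\operatorname{rank} H_{t_1f_1+\cdots+t_Rf_R}(\mathbf{x}_0)\ge n-1 .$$ Suppose that $\varepsilon_0>0$ is sufficiently small (in terms of $n,R,\mathbf{x}_0,f_1,\dots,f_R$) and let $\mathscr{M}=\{(\mathbf{x},f_1(\mathbf{x}),\dots,f_R(\mathbf{x})):\mathbf{x}\in\overline{B_{\varepsilon_0}(\mathbf{x}_0)}\}\subset\mathbb{R}^{n+R}$. Then there are constants $c>0$ and $C>0$ (independent of $Q$) such that for all integers $Q\ge2$ $$N(\mathscr{M};Q,0)\le C\,Q^{\,n-\frac{(R-1)n+1-3R}{n+2R-1}}(\log Q)^c .$$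
   Context: $|\cdot|$ is the $L^\infty$-norm, $B_\varepsilon(\mathbf{x}_0)=\{\mathbf{x}\in\mathbb{R}^n:|\mathbf{x}-\mathbf{x}_0|<\varepsilon\}$, and $H_f(\mathbf{x})$ is the Hessian matrix of $f$ at $\mathbf{x}$. With $M=n+R$, $$N(\mathscr{M};Q,0)=\#\left\{(\mathbf{a},q)\in\mathbb{Z}^M\times\mathbb{N}:\ 1\le q\le Q,\ \frac{\mathbf{a}}{q}\in\mathscr{M}\right\}.$$ *)

theory Defs
  imports "HOL-Analysis.Analysis"
begin

definition partial :: "'n::finite \<Rightarrow> (real ^ 'n \<Rightarrow> real) \<Rightarrow> real ^ 'n \<Rightarrow> real" where
  "partial i f x = frechet_derivative f (at x) (axis i 1)"

text \<open>
  The class \<open>C\<^sup>k\<close> on the whole space. Partial derivatives are taken from the Frechet derivative,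
  whose existence is required at every stage, so the unspecified values of
  \<^const>\<open>frechet_derivative\<close> at points of non-differentiability never enter. Continuity of
  the partial derivatives of order below \<open>k\<close> is implied by their differentiability.
\<close>

fun C_class :: "nat \<Rightarrow> (real ^ 'n::finite \<Rightarrow> real) \<Rightarrow> bool" where
  "C_class 0 f \<longleftrightarrow> continuous_on UNIV f"
| "C_class (Suc k) f \<longleftrightarrow> f differentiable_on UNIV \<and> (\<forall>i. C_class k (partial i f))"

definition hessian :: "(real ^ 'n::finite \<Rightarrow> real) \<Rightarrow> real ^ 'n \<Rightarrow> real ^ 'n ^ 'n" where
  "hessian f x = (\<chi> i j. partial i (partial j f) x)"

definition sup_ball :: "real ^ 'n::finite \<Rightarrow> real \<Rightarrow> (real ^ 'n) set" where
  "sup_ball x0 \<epsilon> = {x. infnorm (x - x0) < \<epsilon>}"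

text \<open>
  The space \<open>\<real>\<^sup>n\<^sup>+\<^sup>R\<close> is indexed by the disjoint sum of the index types of \<open>\<real>\<^sup>n\<close> and \<open>\<real>\<^sup>R\<close>.
\<close>

definition graph_over ::
  "(real ^ 'n::finite) set \<Rightarrow> ('r::finite \<Rightarrow> real ^ 'n \<Rightarrow> real) \<Rightarrow> (real ^ ('n + 'r)) set" where
  "graph_over S f = {(\<chi> k. case k of Inl i \<Rightarrow> x $ i | Inr j \<Rightarrow> f j x) | x. x \<in> S}"

text \<open>
  For bounded \<open>\<M>\<close>, in particular for a graph over a compact set, the set counted here is finite,
  so \<^const>\<open>card\<close> is its true cardinality.
\<close>

definition rational_count :: "(real ^ 'm::finite) set \<Rightarrow> nat \<Rightarrow> nat" where
  "rational_count \<M> Q =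
     card {(a :: int ^ 'm, q :: nat). 1 \<le> q \<and> q \<le> Q \<and> (\<chi> k. real_of_int (a $ k) / real q) \<in> \<M>}"

end

theory Submission
  imports Defs
begin

text \<open>
  Fix the denominator \<open>q\<close>. Expanding the square \<open>|\<Sum>\<^sub>j e(j y)|\<^sup>2\<close> over the box \<open>0 \<le> j\<^sub>r < J\<close> at
  \<open>y = q f(a/q)\<close> reduces the count to the exponential sums
  \<open>S\<^sub>t = \<Sum>\<^sub>a e(q F\<^sub>t(a/q))\<close> with \<open>F\<^sub>t = \<Sum>\<^sub>j t\<^sub>j f\<^sub>j\<close> and \<open>0 < |t| \<le> J\<close>. Cut the range of \<open>a\<close> into boxes of
  side \<open>N \<approx> sqrt (q/J)\<close>. On such a box the phase differs from a linear one by a function whose mixed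
  differences of order \<open>k\<close> are \<open>O(N powr (-k))\<close>, so summation by parts in all coordinates bounds the box sum
  by a product of bounds for geometric sums whose frequencies are the difference quotients of \<open>F\<^sub>t\<close> at
  the corner of the box. The Hessian of \<open>F\<^sub>t\<close> at \<open>x\<^sub>0\<close> is symmetric of corank at most one, hence has a
  nonsingular principal minor omitting at most one index; therefore these frequencies are well
  separated as the corner varies, and counting them in cells of side \<open>1/N\<close> gives
  \<open>S\<^sub>t = O(q (q J) powr ((n - 1)/2) (log q) ^ n)\<close>. The choice \<open>J \<approx> q powr ((n - 1)/(n + 2 R - 1))\<close> balances this
  against the diagonal contribution \<open>q ^ n / J ^ R\<close>.
\<close>

subsection \<open>Mixed differences and summation by parts on boxes\<close>

text \<open>Second differences of the phase in \<open>a\<close> have size \<open>J / q\<close>; the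
  side \<open>N\<close> is the largest scale on which they add up to O(1), so on a box only the
  linear part can oscillate. Two obstacles shape the rest. First, the index that must be omitted
  depends on \<open>t\<close>, while every constant has to be uniform in \<open>t\<close>;
  compactness of the unit sphere of coefficients provides this. The omitted coordinate is summed
  trivially and costs a full factor \<open>q\<close>, against \<open>sqrt (q * J)\<close> up to a
  logarithm for each of the others. Second, \<open>N\<close> is tuned to \<open>J\<close>, although
  \<open>norm t\<close> may be much smaller. For such \<open>t\<close> the frequencies are less
  separated, but they also fill a shorter range. Only the product of the number of corners per cell
  and the number of periods enters, and it is O(J) for every \<open>t\<close>. For one denominator
  the outcome is the exponent \<open>n - R * \<theta>\<close> with
  \<open>\<theta> = (n - 1) / (n + 2 * R - 1)\<close>; summing over \<open>q\<close> adds 1.\<close>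

definition incr :: "'n \<Rightarrow> ('n \<Rightarrow> nat) \<Rightarrow> 'n \<Rightarrow> nat" where
  "incr i h = h(i := Suc (h i))"

lemma incr_upd_same [simp]: "incr i (h(i := k)) = h(i := Suc k)"
  by (simp add: incr_def)

lemma incr_upd: "i \<noteq> j \<Longrightarrow> incr i (h(j := k)) = (incr i h)(j := k)"
  by (auto simp: incr_def)

lemma incr_commute: "incr i (incr j h) = incr j (incr i h)"
  by (auto simp: incr_def)

lemma incr_le: "incr i h j \<le> Suc (h j)"
  by (simp add: incr_def)

text \<open>The directions form a list because one may repeat: controlling the phase takes second
  differences along a single axis too.\<close>

fun mixed_diff :: "'n list \<Rightarrow> (('n \<Rightarrow> nat) \<Rightarrow> 'a) \<Rightarrow> ('n \<Rightarrow> nat) \<Rightarrow> 'a::ab_group_add" where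
  "mixed_diff [] u = u"
| "mixed_diff (i # L) u = mixed_diff L (\<lambda>h. u (incr i h) - u h)"

lemma mixed_diff_add: "mixed_diff L (\<lambda>h. u h + v h) h = mixed_diff L u h + mixed_diff L v h"
proof (induction L arbitrary: u v)
  case (Cons i L)
  show ?case using Cons[of "\<lambda>h. u (incr i h) - u h" "\<lambda>h. v (incr i h) - v h"]
    by (simp add: algebra_simps)
qed auto

lemma mixed_diff_diff: "mixed_diff L (\<lambda>h. u h - v h) h = mixed_diff L u h - mixed_diff L v h"
proof (induction L arbitrary: u v)
  case (Cons i L)
  show ?case using Cons[of "\<lambda>h. u (incr i h) - u h" "\<lambda>h. v (incr i h) - v h"]
    by (simp add: algebra_simps)
qed auto

lemma mixed_diff_linear:
  assumes "linear T"
  shows "mixed_diff L (\<lambda>h. T (u h)) h = T (mixed_diff L u h)"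
  by (induction L arbitrary: u) (simp_all add: linear_diff[OF assms, symmetric])

lemma mixed_diff_const: "L \<noteq> [] \<Longrightarrow> mixed_diff L (\<lambda>h. c) h = 0"
proof (induction L arbitrary: c)
  case (Cons i L)
  then show ?case by (cases "L = []") auto
qed auto

lemma mixed_diff_shift:
  "mixed_diff L (\<lambda>h. u (incr i h)) h = mixed_diff L u (incr i h)"
proof (induction L arbitrary: u)
  case (Cons j L)
  show ?case using Cons[of "\<lambda>h. u (incr j h) - u h"] by (simp add: incr_commute[of i j])
qed auto

lemma sums_mixed_diff:
  fixes w :: "('n \<Rightarrow> nat) \<Rightarrow> 'b::real_normed_vector"
  assumes "\<And>h. (\<lambda>r. v r h) sums w h"
  shows "(\<lambda>r. mixed_diff L (v r) h) sums mixed_diff L w h"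
  using assms
proof (induction L arbitrary: v w)
  case (Cons i L)
  show ?case using Cons.IH[of "\<lambda>r h. v r (incr i h) - v r h", OF sums_diff[OF Cons.prems Cons.prems]]
    by simp
qed auto

text \<open>Models a smooth function of \<open>h / N\<close>: each difference gains a factor
  \<open>1 / N\<close>. Evaluating \<open>mixed_diff L u h\<close> raises a coordinate by at most
  \<open>length L\<close>, so the condition with \<open>M\<close> keeps all points involved inside
  the cube of side \<open>M\<close> at the origin, where alone the phase will be controlled.\<close>

definition slow_var ::
  "nat \<Rightarrow> nat \<Rightarrow> nat \<Rightarrow> real \<Rightarrow> (('n \<Rightarrow> nat) \<Rightarrow> 'a::real_normed_vector) \<Rightarrow> bool" where
  "slow_var N k M K u \<longleftrightarrow> (\<forall>L h. length L \<le> k \<longrightarrow> (\<forall>i. h i + length L \<le> M) \<longrightarrow>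
      norm (mixed_diff L u h) \<le> K / real N ^ length L)"

lemma slow_varD:
  "slow_var N k M K u \<Longrightarrow> length L \<le> k \<Longrightarrow> (\<And>i. h i + length L \<le> M) \<Longrightarrow>
     norm (mixed_diff L u h) \<le> K / real N ^ length L"
  unfolding slow_var_def by blast

lemma slow_var_mono:
  assumes "slow_var N k M K u" "k' \<le> k" "M' \<le> M"
  shows "slow_var N k' M' K u"
  unfolding slow_var_def
proof (intro allI impI)
  fix L :: "'a list" and h :: "'a \<Rightarrow> nat"
  assume "length L \<le> k'" "\<forall>i. h i + length L \<le> M'"
  then show "norm (mixed_diff L u h) \<le> K / real N ^ length L"
    using assms by (intro slow_varD[OF assms(1)]) (auto intro: le_trans)
qed

text \<open>One difference uses up one order and one unit of room in the cube, and improves the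
  constant by \<open>1 / N\<close>. The product rule and the summation by parts both rest on this
  trade.\<close>

lemma slow_var_step:
  assumes "slow_var N (Suc k) (Suc M) K u"
  shows "slow_var N k M (K / real N) (\<lambda>h. u (incr i h) - u h)"
  unfolding slow_var_def
proof (intro allI impI)
  fix L :: "'a list" and h :: "'a \<Rightarrow> nat"
  assume "length L \<le> k" "\<forall>i. h i + length L \<le> M"
  then show "norm (mixed_diff L (\<lambda>h. u (incr i h) - u h) h) \<le> K / real N / real N ^ length L"
    using slow_varD[OF assms, of "i # L" h] by simp
qed

lemma slow_var_shift:
  assumes "slow_var N k (Suc M) K u"
  shows "slow_var N k M K (\<lambda>h. u (incr i h))"
  unfolding slow_var_def
proof (intro allI impI)
  fix L :: "'a list" and h :: "'a \<Rightarrow> nat"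
  assume "length L \<le> k" and *: "\<forall>i. h i + length L \<le> M"
  have "(incr i h) j + length L \<le> Suc M" for j
    using *[rule_format, of j] incr_le[of i h j] by linarith
  then show "norm (mixed_diff L (\<lambda>h. u (incr i h)) h) \<le> K / real N ^ length L"
    unfolding mixed_diff_shift by (intro slow_varD[OF assms \<open>length L \<le> k\<close>]) auto
qed

lemma mixed_diff_mult_le:
  fixes u v :: "('n \<Rightarrow> nat) \<Rightarrow> 'a::real_normed_algebra"
  assumes "slow_var N (length L) M A u" "slow_var N (length L) M B v"
    and "\<And>i. h i + length L \<le> M" "0 \<le> A" "0 \<le> B"
  shows "norm (mixed_diff L (\<lambda>h. u h * v h) h) \<le> 2 ^ length L * (A * B) / real N ^ length L"
  using assms
proof (induction L arbitrary: u v M A B)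
  case Nil
  have "norm (u h) \<le> A" "norm (v h) \<le> B"
    using slow_varD[OF Nil(1), of "[]" h] slow_varD[OF Nil(2), of "[]" h] Nil(3) by auto
  then show ?case
    by simp (meson Nil.prems(4) mult_mono norm_ge_zero norm_mult_ineq order_trans)
next
  case (Cons i L)
  obtain M' where M: "M = Suc M'"
    using Cons.prems(3)[of i] by (cases M) auto
  have h: "h j + length L \<le> M'" for j
    using Cons.prems(3)[of j] M by auto
  have u: "slow_var N (Suc (length L)) (Suc M') A u" "slow_var N (Suc (length L)) (Suc M') B v"
    using Cons.prems(1,2) M by auto
  \<comment> \<open>Discrete Leibniz rule; its two terms per difference account for the power of
    2.\<close>
  have "(\<lambda>h. u (incr i h) * v (incr i h) - u h * v h)
      = (\<lambda>h. (u (incr i h) - u h) * v (incr i h) + u h * (v (incr i h) - v h))"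
    by (simp add: algebra_simps)
  then have "mixed_diff (i # L) (\<lambda>h. u h * v h) h
     = mixed_diff L (\<lambda>h. (u (incr i h) - u h) * v (incr i h)) h + mixed_diff L (\<lambda>h. u h * (v (incr i h) - v h)) h"
    by (simp add: mixed_diff_add)
  also have "norm \<dots> \<le> 2 ^ length L * (A / real N * B) / real N ^ length L
      + 2 ^ length L * (A * (B / real N)) / real N ^ length L"
  proof (rule order_trans[OF norm_triangle_ineq add_mono])
    show "norm (mixed_diff L (\<lambda>h. (u (incr i h) - u h) * v (incr i h)) h)
        \<le> 2 ^ length L * (A / real N * B) / real N ^ length L"
      by (rule Cons.IH[where M=M'])
         (use u h Cons.prems slow_var_step[OF u(1)] slow_var_mono[OF slow_var_shift[OF u(2)], of "length L" M']
           in auto)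
    show "norm (mixed_diff L (\<lambda>h. u h * (v (incr i h) - v h)) h)
        \<le> 2 ^ length L * (A * (B / real N)) / real N ^ length L"
      by (rule Cons.IH[where M=M'])
         (use u h Cons.prems slow_var_step[OF u(2)] slow_var_mono[OF u(1), of "length L" M']
           in auto)
  qed
  also have "\<dots> = 2 ^ length (i # L) * (A * B) / real N ^ length (i # L)"
    by (simp add: field_simps)
  finally show ?case .
qed

lemma slow_var_mult:
  fixes u v :: "('n \<Rightarrow> nat) \<Rightarrow> 'a::real_normed_algebra"
  assumes "slow_var N k M A u" "slow_var N k M B v" "0 \<le> A" "0 \<le> B"
  shows "slow_var N k M (2 ^ k * A * B) (\<lambda>h. u h * v h)"
  unfolding slow_var_def
proof (intro allI impI)
  fix L :: "'n list" and h :: "'n \<Rightarrow> nat"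
  assume L: "length L \<le> k" "\<forall>i. h i + length L \<le> M"
  have "norm (mixed_diff L (\<lambda>h. u h * v h) h) \<le> 2 ^ length L * (A * B) / real N ^ length L"
    by (rule mixed_diff_mult_le[where M=M])
       (use assms L in \<open>auto elim: slow_var_mono\<close>)
  also have "\<dots> \<le> 2 ^ k * A * B / real N ^ length L"
    using assms L by (simp add: divide_right_mono mult_right_mono mult.assoc power_increasing)
  finally show "norm (mixed_diff L (\<lambda>h. u h * v h) h) \<le> 2 ^ k * A * B / real N ^ length L" .
qed

text \<open>Each multiplication costs another \<open>2 ^ k\<close>, so the constant is geometric in
  \<open>r\<close> and the exponential series of these bounds converges.\<close>

lemma slow_var_power:
  fixes u :: "('n \<Rightarrow> nat) \<Rightarrow> 'a::real_normed_algebra_1"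
  assumes "slow_var N k M A u" "0 \<le> A"
  shows "slow_var N k M ((2 ^ k * A) ^ r) (\<lambda>h. u h ^ r)"
proof (induction r)
  case 0
  have "norm (mixed_diff L (\<lambda>h. 1::'a) h) \<le> 1 / real N ^ length L" for L :: "'n list" and h
    by (cases "L = []") (auto simp: mixed_diff_const)
  then show ?case by (simp add: slow_var_def)
next
  case (Suc r)
  show ?case using slow_var_mult[OF assms(1) Suc assms(2)] assms(2) by (simp add: mult_ac)
qed

text \<open>Going through the power series of \<open>exp\<close> avoids the chain rule for mixed differences.\<close>

lemma slow_var_exp:
  fixes u :: "('n \<Rightarrow> nat) \<Rightarrow> 'a::{real_normed_algebra_1,banach}"
  assumes "slow_var N k M A u" "0 \<le> A"
  shows "slow_var N k M (exp (2 ^ k * A)) (\<lambda>h. exp (u h))"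
  unfolding slow_var_def
proof (intro allI impI)
  fix L :: "'n list" and h :: "'n \<Rightarrow> nat"
  assume L: "length L \<le> k" "\<forall>i. h i + length L \<le> M"
  have lin: "linear (\<lambda>x::'a. x /\<^sub>R fact r)" for r
    by (rule linearI) (auto simp: algebra_simps)
  have "(\<lambda>r. mixed_diff L (\<lambda>h. u h ^ r /\<^sub>R fact r) h) sums mixed_diff L (\<lambda>h. exp (u h)) h"
    by (rule sums_mixed_diff) (rule exp_converges)
  then have s: "(\<lambda>r. mixed_diff L (\<lambda>h. u h ^ r) h /\<^sub>R fact r) sums mixed_diff L (\<lambda>h. exp (u h)) h"
    by (simp add: mixed_diff_linear[OF lin])
  have t: "(\<lambda>r. ((2 ^ k * A) ^ r /\<^sub>R fact r) / real N ^ length L) sums (exp (2 ^ k * A) / real N ^ length L)"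
    by (intro sums_divide exp_converges)
  have le: "norm (mixed_diff L (\<lambda>h. u h ^ r) h /\<^sub>R fact r) \<le> ((2 ^ k * A) ^ r /\<^sub>R fact r) / real N ^ length L" for r
    using slow_varD[OF slow_var_power[OF assms], of L h r] L by (simp add: field_simps)
  show "norm (mixed_diff L (\<lambda>h. exp (u h)) h) \<le> exp (2 ^ k * A) / real N ^ length L"
    using norm_suminf_le[OF le sums_summable[OF t]] sums_unique[OF s] sums_unique[OF t] by simp
qed

text \<open>Nested summation over the coordinates in the list; the last argument supplies the remaining ones.\<close>

fun box_sum :: "nat \<Rightarrow> ('n \<Rightarrow> complex) \<Rightarrow> 'n list \<Rightarrow> (('n \<Rightarrow> nat) \<Rightarrow> complex) \<Rightarrow> ('n \<Rightarrow> nat) \<Rightarrow> complex" where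
  "box_sum N z [] u h = u h"
| "box_sum N z (i # I) u h = (\<Sum>k<N. z i ^ k * box_sum N z I u (h(i := k)))"

text \<open>The weights do not involve coordinate \<open>i\<close> when \<open>i\<close> is not
  summed over, so differencing passes through the sum. This makes an inner sum slowly varying in the
  outer variable.\<close>

lemma box_sum_diff:
  assumes "i \<notin> set I"
  shows "box_sum N z I u (incr i h) - box_sum N z I u h
       = box_sum N z I (\<lambda>h. u (incr i h) - u h) h"
  using assms
proof (induction I arbitrary: h)
  case (Cons j I)
  then have ij: "i \<noteq> j" "i \<notin> set I" by auto
  have "box_sum N z I u ((incr i h)(j := k)) - box_sum N z I u (h(j := k))
     = box_sum N z I (\<lambda>h. u (incr i h) - u h) (h(j := k))" for k
    by (metis Cons.IH ij incr_upd)
  then show ?case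
    using ij by (simp add: sum_subtractf[symmetric] right_diff_distrib[symmetric])
qed auto

text \<open>Abel summation: the partial sums of the powers are at most \<open>g\<close>, the
  coefficients have size \<open>A\<close> and total variation at most \<open>N * B\<close>.\<close>

lemma abel_bound:
  fixes z :: complex and U :: "nat \<Rightarrow> complex"
  assumes "\<And>m. m \<le> N \<Longrightarrow> norm (\<Sum>k<m. z ^ k) \<le> g"
    and "\<And>k. k < N \<Longrightarrow> norm (U k) \<le> A"
    and "\<And>k. Suc k < N \<Longrightarrow> norm (U (Suc k) - U k) \<le> B" "0 \<le> B" "0 \<le> A"
  shows "norm (\<Sum>k<N. z ^ k * U k) \<le> g * (A + real N * B)"
proof -
  have g: "0 \<le> g" using assms(1)[of 0] by simp
  define Z where "Z m = (\<Sum>k<m. z ^ k)" for m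
  have id: "(\<Sum>k<Suc m. z ^ k * U k) = Z (Suc m) * U m - (\<Sum>k<m. Z (Suc k) * (U (Suc k) - U k))" for m
    by (induction m) (auto simp: Z_def algebra_simps)
  show ?thesis
  proof (cases N)
    case 0
    then show ?thesis using g assms by simp
  next
    case (Suc m)
    have "norm (\<Sum>k<N. z ^ k * U k) \<le> norm (Z (Suc m) * U m) + norm (\<Sum>k<m. Z (Suc k) * (U (Suc k) - U k))"
      unfolding Suc id by (rule norm_triangle_ineq4)
    also have "\<dots> \<le> g * A + (\<Sum>k<m. g * B)"
    proof (intro add_mono order_trans[OF norm_sum] sum_mono)
      show "norm (Z (Suc m) * U m) \<le> g * A"
        unfolding norm_mult Z_def by (intro mult_mono assms(1,2) norm_ge_zero g) (simp_all add: Suc)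
      show "norm (Z (Suc j) * (U (Suc j) - U j)) \<le> g * B" if "j \<in> {..<m}" for j
        using that unfolding norm_mult Z_def
        by (intro mult_mono assms(1,3) norm_ge_zero g) (simp_all add: Suc)
    qed
    also have "\<dots> \<le> g * (A + real N * B)"
      using g assms(4) Suc by (simp add: algebra_simps)
    finally show ?thesis .
  qed
qed

text \<open>Each coordinate costs a factor 2: the inner sum is bounded, and its differences, fewer
  than \<open>N\<close>, are smaller by \<open>1 / N\<close>, so \<open>abel_bound\<close> meets the
  same quantity twice. Indices stop at \<open>N - 1\<close>, and \<open>length I\<close> differences
  on top of that must stay within \<open>M\<close>; hence the \<open>Suc M\<close>.\<close>

lemma norm_box_sum_le:
  assumes "distinct I" "slow_var N k M K u" "length I \<le> k" "N + length I \<le> Suc M" "N \<ge> 1" "0 \<le> K"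
    and "\<And>i. h i + length I \<le> M"
    and g: "\<And>i m. m \<le> N \<Longrightarrow> norm (\<Sum>k<m. z i ^ k) \<le> g i"
  shows "norm (box_sum N z I u h) \<le> 2 ^ length I * K * (\<Prod>i\<in>set I. g i)"
  using assms(1-7)
proof (induction I arbitrary: u k M K h)
  case Nil
  then show ?case using slow_varD[of N k M K u "[]" h] by simp
next
  case (Cons i I)
  let ?P = "2 ^ length I * K * (\<Prod>i\<in>set I. g i)"
  have g0: "0 \<le> g j" for j using g[of 0 j] by simp
  obtain M' where M: "M = Suc M'" using Cons.prems(4,5) by (cases M) auto
  obtain k' where k: "k = Suc k'" using Cons.prems(3) by (cases k) auto
  have i: "i \<notin> set I" and P0: "0 \<le> ?P"
    using Cons.prems g0 by (auto intro!: mult_nonneg_nonneg prod_nonneg)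
  have h: "h j + length I \<le> M'" for j using Cons.prems(7)[of j] M by auto
  have "norm (\<Sum>k<N. z i ^ k * box_sum N z I u (h(i := k))) \<le> g i * (?P + real N * (?P / real N))"
  proof (rule abel_bound[OF g])
    fix j assume j: "j < N"
    show "norm (box_sum N z I u (h(i := j))) \<le> ?P"
    proof (rule Cons.IH[of k M])
      fix i' show "(h(i := j)) i' + length I \<le> M"
        using h[of i'] j Cons.prems(4) M by auto
    qed (use Cons.prems in auto)
  next
    fix j assume j: "Suc j < N"
    have "box_sum N z I u (h(i := Suc j)) - box_sum N z I u (h(i := j))
        = box_sum N z I (\<lambda>h. u (incr i h) - u h) (h(i := j))"
      using box_sum_diff[OF i, of N z u "h(i := j)"] by simp
    moreover have "norm (box_sum N z I (\<lambda>h. u (incr i h) - u h) (h(i := j)))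
        \<le> 2 ^ length I * (K / real N) * (\<Prod>i\<in>set I. g i)"
    proof (rule Cons.IH[of k' M'])
      show "slow_var N k' M' (K / real N) (\<lambda>h. u (incr i h) - u h)"
        using Cons.prems M k by (intro slow_var_step) auto
      fix i' show "(h(i := j)) i' + length I \<le> M'"
        using h[of i'] j Cons.prems(4) M by auto
    qed (use Cons.prems M k in auto)
    ultimately show "norm (box_sum N z I u (h(i := Suc j)) - box_sum N z I u (h(i := j))) \<le> ?P / real N"
      by simp
  qed (use P0 in auto)
  also have "\<dots> = 2 ^ length (i # I) * K * (\<Prod>i\<in>set (i # I). g i)"
    using Cons.prems(5) i by simp
  finally show ?case by simp
qed

lemma box_sum_eq_sum:
  assumes "distinct I"
  shows "box_sum N z I u h =
    (\<Sum>c\<in>PiE (set I) (\<lambda>_. {..<N}). (\<Prod>i\<in>set I. z i ^ c i) * u (\<lambda>i. if i \<in> set I then c i else h i))"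
  using assms
proof (induction I arbitrary: h)
  case Nil
  then show ?case by simp
next
  case (Cons i I)
  then have i: "i \<notin> set I" by auto
  let ?S = "PiE (set I) (\<lambda>_. {..<N})"
  let ?f = "\<lambda>(k, c). (c :: _ \<Rightarrow> nat)(i := k)"
  have inj: "inj_on ?f ({..<N} \<times> ?S)"
    using inj_combinator[OF i, of "\<lambda>_. {..<N}"] by simp
  have "box_sum N z (i # I) u h = (\<Sum>k<N. \<Sum>c\<in>?S. z i ^ k *
      ((\<Prod>j\<in>set I. z j ^ c j) * u (\<lambda>j. if j \<in> set I then c j else (h(i := k)) j)))"
    using Cons by (simp add: sum_distrib_left)
  also have "\<dots> = (\<Sum>(k, c)\<in>{..<N} \<times> ?S. z i ^ k *
      ((\<Prod>j\<in>set I. z j ^ c j) * u (\<lambda>j. if j \<in> set I then c j else (h(i := k)) j)))"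
    by (rule sum.cartesian_product)
  also have "\<dots> = (\<Sum>c\<in>?f ` ({..<N} \<times> ?S). (\<Prod>j\<in>set (i # I). z j ^ c j) *
      u (\<lambda>j. if j \<in> set (i # I) then c j else h j))"
    unfolding sum.reindex[OF inj]
  proof (rule sum.cong[OF refl])
    fix p assume "p \<in> {..<N} \<times> ?S"
    obtain k c where p: "p = (k, c)" by (cases p)
    have 1: "(\<Prod>j\<in>set I. z j ^ (if j = i then k else c j)) = (\<Prod>j\<in>set I. z j ^ c j)"
      using i by (intro prod.cong) auto
    have 2: "(\<lambda>j. if j \<in> set (i # I) then (c(i := k)) j else h j)
           = (\<lambda>j. if j \<in> set I then c j else (h(i := k)) j)"
      using i by auto
    show "(case p of (k, c) \<Rightarrow> z i ^ k *
        ((\<Prod>j\<in>set I. z j ^ c j) * u (\<lambda>j. if j \<in> set I then c j else (h(i := k)) j))) =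
      ((\<lambda>c. (\<Prod>j\<in>set (i # I). z j ^ c j) * u (\<lambda>j. if j \<in> set (i # I) then c j else h j)) \<circ> ?f) p"
      unfolding p o_def prod.case 2 using i 1 by (simp add: mult_ac)
  qed
  also have "?f ` ({..<N} \<times> ?S) = PiE (set (i # I)) (\<lambda>_. {..<N})"
    by (simp add: PiE_insert_eq)
  finally show ?case .
qed

subsection \<open>Geometric sums with separated frequencies\<close>

text \<open>By concavity the sine lies above its chord from \<open>0\<close> to
  \<open>pi / 2\<close>. The weaker product \<open>x * (1 - x)\<close> is convenient because its
  reciprocal is \<open>1 / x + 1 / (1 - x)\<close>, the shape of the two terms of
  \<open>cell_wt\<close>.\<close>

lemma sin_pi_ge:
  assumes "0 \<le> x" "x \<le> 1"
  shows "x * (1 - x) \<le> sin (pi * x)"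
proof -
  have half: "2 * x \<le> sin (pi * x)" if "0 \<le> x" "x \<le> 1 / 2" for x :: real
  proof -
    have "convex_on {0..pi} (\<lambda>x. - sin x)"
      by (rule f''_ge0_imp_convex[where f' = "\<lambda>x. - cos x" and f'' = sin])
         (auto intro!: derivative_eq_intros sin_ge_zero)
    from convex_onD[OF this, of "2 * x" 0 "pi / 2"] that
    show ?thesis by (simp add: mult.commute)
  qed
  show ?thesis
  proof (cases "x \<le> 1 / 2")
    case True
    have "x * (1 - x) \<le> x * 2" using assms by (intro mult_left_mono) auto
    then show ?thesis using half[of x] True assms by simp
  next
    case False
    have "x * (1 - x) \<le> 2 * (1 - x)" using assms by (intro mult_right_mono) auto
    moreover have "sin (pi * (1 - x)) = sin (pi * x)" by (simp add: right_diff_distrib sin_diff)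
    ultimately show ?thesis using half[of "1 - x"] False assms by simp
  qed
qed

text \<open>
  Up to a constant this is \<open>min N (1 / dist(a, \<int>))\<close> for \<open>c = \<lfloor>N a\<rfloor>\<close>, but it depends only on the
  residue of the cell index.
\<close>

definition cell_wt :: "nat \<Rightarrow> int \<Rightarrow> real" where
  "cell_wt N c = real N * (1 / max 1 (real_of_int (c mod int N)) + 1 / max 1 (real N - 1 - real_of_int (c mod int N)))"

lemma cell_wt_nonneg: "0 \<le> cell_wt N c"
  by (auto simp: cell_wt_def intro!: mult_nonneg_nonneg add_nonneg_nonneg)

text \<open>Uniform in \<open>m\<close>, since summation by parts needs all partial sums up to
  \<open>N\<close>.\<close>

lemma norm_geometric_cis:
  assumes "m \<le> N" "N \<ge> 1"
  shows "norm (\<Sum>k<m. cis (2 * pi * a) ^ k) \<le> cell_wt N \<lfloor>real N * a\<rfloor>"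
proof -
  define x where "x = frac a"
  define r where "r = real_of_int (\<lfloor>real N * a\<rfloor> mod int N)"
  \<comment> \<open>The integer part of \<open>a\<close> moves the cell index by a multiple of
    \<open>N\<close>, so modulo \<open>N\<close> only the fractional part \<open>x\<close> is
    seen.\<close>
  have fl: "\<lfloor>real N * a\<rfloor> = int N * \<lfloor>a\<rfloor> + \<lfloor>real N * x\<rfloor>"
  proof -
    have "real N * a = real_of_int (int N * \<lfloor>a\<rfloor>) + real N * x"
      by (simp add: x_def frac_def algebra_simps)
    then show ?thesis by (metis add.commute floor_add_int)
  qed
  have x: "0 \<le> x" "x < 1" by (auto simp: x_def frac_lt_1)
  have "real N * x < real N" "0 \<le> real N * x" using assms x by auto
  then have "\<lfloor>real N * x\<rfloor> < int N" "0 \<le> \<lfloor>real N * x\<rfloor>" by (simp_all add: floor_less_iff)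
  then have r: "r = real_of_int \<lfloor>real N * x\<rfloor>" by (simp add: r_def fl)
  have r1: "r \<le> real N * x" "real N * x < r + 1" unfolding r by linarith+
  have r2: "0 \<le> r" "r \<le> real N - 1"
    using \<open>\<lfloor>real N * x\<rfloor> < int N\<close> \<open>0 \<le> \<lfloor>real N * x\<rfloor>\<close> unfolding r by linarith+
  have wt: "cell_wt N \<lfloor>real N * a\<rfloor> = real N * (1 / max 1 r + 1 / max 1 (real N - 1 - r))"
    by (simp add: cell_wt_def r_def)
  have triv: "norm (\<Sum>k<m. cis (2 * pi * a) ^ k) \<le> real N"
  proof -
    have "norm (\<Sum>k<m. cis (2 * pi * a) ^ k) \<le> (\<Sum>k<m. 1)"
      by (rule order_trans[OF norm_sum]) (simp add: norm_power)
    then show ?thesis using assms by simp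
  qed
  show ?thesis
  \<comment> \<open>The cells \<open>r = 0\<close> and \<open>r = N - 1\<close> touch an integer.
    There the weight is at least \<open>N\<close>, and the trivial bound suffices.\<close>
  proof (cases "r < 1 \<or> real N - 1 - r < 1")
    case True
    then have "1 \<le> 1 / max 1 r + 1 / max 1 (real N - 1 - r)"
      by (elim disjE) (simp_all add: max_def)
    then have "real N * 1 \<le> cell_wt N \<lfloor>real N * a\<rfloor>"
      unfolding wt by (intro mult_left_mono) auto
    with triv show ?thesis by simp
  next
    case False
    have N: "real N > 0" using assms by simp
    have x0: "0 < x" "x < 1" using False r1 x N by (cases "x = 0"; simp)+
    have xr: "r / real N \<le> x" "(real N - 1 - r) / real N \<le> 1 - x"
      using r1 N by (auto simp: field_simps)
    define z where "z = cis (2 * pi * a)"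
    have zx: "z = cis (2 * pi * x)"
    proof -
      have "2 * pi * a = 2 * pi * x + 2 * pi * real_of_int \<lfloor>a\<rfloor>"
        by (simp add: x_def frac_def algebra_simps)
      then show ?thesis unfolding z_def by (simp add: cis_mult[symmetric] cis_multiple_2pi)
    qed
    have nz: "norm (1 - z) = 2 * sin (pi * x)"
    proof -
      have "norm (1 - z) ^ 2 = (1 - cos (2 * (pi * x))) ^ 2 + sin (2 * (pi * x)) ^ 2"
        unfolding zx cmod_power2 by (simp add: mult.assoc)
      also have "\<dots> = 2 - 2 * cos (2 * (pi * x))"
        using sin_cos_squared_add[of "2 * (pi * x)"] by (simp add: power2_eq_square algebra_simps)
      also have "\<dots> = (2 * sin (pi * x)) ^ 2"
        by (simp add: cos_double_sin power2_eq_square)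
      finally have "(norm (1 - z))\<^sup>2 = (2 * sin (pi * x))\<^sup>2" .
      moreover have "0 \<le> sin (pi * x)"
        using x0 by (intro sin_ge_zero) auto
      ultimately show ?thesis
        by (intro power2_eq_imp_eq[OF _ norm_ge_zero]) auto
    qed
    have pos: "x * (1 - x) > 0" using x0 by simp
    have s: "sin (pi * x) \<ge> x * (1 - x)" using sin_pi_ge x by simp
    have "z \<noteq> 1" using nz pos s by auto
    then have "(\<Sum>k<m. z ^ k) = (1 - z ^ m) / (1 - z)" by (simp add: sum_gp_strict)
    then have "norm (\<Sum>k<m. z ^ k) = norm (1 - z ^ m) / (2 * sin (pi * x))"
      by (simp add: norm_divide nz)
    also have "\<dots> \<le> 2 / (2 * sin (pi * x))"
    proof (rule divide_right_mono)
      have "norm (1 - z ^ m) \<le> norm (1 :: complex) + norm (z ^ m)" by (rule norm_triangle_ineq4)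
      then show "norm (1 - z ^ m) \<le> 2" by (simp add: norm_power z_def)
    qed (use s pos in auto)
    also have "\<dots> \<le> 1 / (x * (1 - x))"
      using s pos by (simp add: frac_le)
    also have "\<dots> = 1 / x + 1 / (1 - x)" using x0 by (simp add: field_simps)
    also have "\<dots> \<le> 1 / (r / real N) + 1 / ((real N - 1 - r) / real N)"
      using xr False N x0 by (intro add_mono divide_left_mono mult_pos_pos divide_pos_pos) auto
    also have "\<dots> = cell_wt N \<lfloor>real N * a\<rfloor>"
      using False unfolding wt by (simp add: max_def distrib_left)
    finally show ?thesis by (simp add: z_def)
  qed
qed

lemma sum_inverse_max_le:
  assumes "N \<ge> 1"
  shows "(\<Sum>r<N. 1 / max 1 (real r)) \<le> 2 + ln (real N)"
proof -
  have *: "(\<Sum>r<Suc m. 1 / max 1 (real r)) = 1 + harm m" for m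
    by (induction m) (simp_all add: harm_Suc harm_expand(1) inverse_eq_divide)
  obtain m where m: "N = Suc m" using assms by (cases N) auto
  have "harm m \<le> 1 + ln (real N)"
  proof (cases "m = 0")
    case False
    \<comment> \<open>The sequence \<open>harm n - ln n\<close> is decreasing and has the value 1 at
      \<open>n = 1\<close>.\<close>
    then have "harm m - ln (real m) \<le> harm 1 - ln (real 1)"
      by (intro euler_mascheroni_sequence_decreasing) auto
    moreover have "ln (real m) \<le> ln (real N)" using False m by simp
    ultimately show ?thesis by (simp add: harm_def)
  qed (simp add: m harm_def)
  then show ?thesis using * m by simp
qed

text \<open>Any \<open>N\<close> consecutive cells form a complete residue system modulo
  \<open>N\<close>. The reflection of \<open>r\<close> to \<open>N - 1 - r\<close> exchanges the two
  halves of the weight, and each half is a harmonic sum.\<close>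

lemma sum_cell_wt_period:
  assumes "N \<ge> 1"
  shows "(\<Sum>c\<in>{v..<v + int N}. cell_wt N c) \<le> 2 * real N * (2 + ln (real N))"
proof -
  have bij: "bij_betw (\<lambda>c. nat (c mod int N)) {v..<v + int N} {..<N}"
  proof (rule bij_betw_imageI)
    show inj: "inj_on (\<lambda>c. nat (c mod int N)) {v..<v + int N}"
    proof (rule inj_onI)
      fix x y assume xy: "x \<in> {v..<v + int N}" "y \<in> {v..<v + int N}" "nat (x mod int N) = nat (y mod int N)"
      then have "x mod int N = y mod int N" using assms by (simp add: nat_eq_iff)
      then have "int N dvd x - y" by (simp add: mod_eq_dvd_iff)
      moreover have "\<bar>x - y\<bar> < int N" using xy by auto
      ultimately show "x = y" using dvd_imp_le_int[of "x - y" "int N"] by auto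
    qed
    have "(\<lambda>c. nat (c mod int N)) ` {v..<v + int N} \<subseteq> {..<N}"
      using assms by (auto simp: nat_less_iff)
    then show "(\<lambda>c. nat (c mod int N)) ` {v..<v + int N} = {..<N}"
      by (rule card_subset_eq[OF finite_lessThan]) (simp add: card_image[OF inj])
  qed
  have "(\<Sum>c\<in>{v..<v + int N}. cell_wt N c) = (\<Sum>c\<in>{v..<v + int N}.
      (\<lambda>r. real N * (1 / max 1 (real r) + 1 / max 1 (real N - 1 - real r))) (nat (c mod int N)))"
    using assms by (intro sum.cong) (auto simp: cell_wt_def)
  also have "\<dots> = (\<Sum>r<N. real N * (1 / max 1 (real r) + 1 / max 1 (real N - 1 - real r)))"
    by (rule sum.reindex_bij_betw[OF bij])
  also have "\<dots> = real N * ((\<Sum>r<N. 1 / max 1 (real r)) + (\<Sum>r<N. 1 / max 1 (real N - 1 - real r)))"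
    by (simp add: sum_distrib_left[symmetric] sum.distrib)
  also have "(\<Sum>r<N. 1 / max 1 (real N - 1 - real r)) = (\<Sum>r<N. 1 / max 1 (real r))"
    by (rule sum.reindex_bij_witness[of _ "\<lambda>r. N - 1 - r" "\<lambda>r. N - 1 - r"]) (auto simp: of_nat_diff)
  also have "real N * ((\<Sum>r<N. 1 / max 1 (real r)) + (\<Sum>r<N. 1 / max 1 (real r)))
      \<le> real N * ((2 + ln (real N)) + (2 + ln (real N)))"
    using sum_inverse_max_le[OF assms] by (intro mult_left_mono add_mono) auto
  finally show ?thesis by (simp add: algebra_simps)
qed

lemma sum_cell_wt_le:
  assumes "N \<ge> 1"
  shows "(\<Sum>c\<in>{v..<v + int (N * p)}. cell_wt N c) \<le> real p * (2 * real N * (2 + ln (real N)))"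
proof (induction p)
  case (Suc p)
  have "{v..<v + int (N * Suc p)} = {v..<v + int (N * p)} \<union> {v + int (N * p)..<v + int (N * p) + int N}"
    using ivl_disj_un_two(3)[of v "v + int (N * p)" "v + int (N * p) + int N"] by (simp add: algebra_simps)
  then have "(\<Sum>c\<in>{v..<v + int (N * Suc p)}. cell_wt N c)
      = (\<Sum>c\<in>{v..<v + int (N * p)}. cell_wt N c) + (\<Sum>c\<in>{v + int (N * p)..<v + int (N * p) + int N}. cell_wt N c)"
    by (simp add: sum.union_disjoint ivl_disj_int)
  also have "\<dots> \<le> real (Suc p) * (2 * real N * (2 + ln (real N)))"
    using Suc sum_cell_wt_period[OF assms, of "v + int (N * p)"] by (simp add: algebra_simps)
  finally show ?case .
qed simp

text \<open>Grouping by cells: a cell holds at most \<open>D ^ card I\<close> points, and since the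
  cells range over a product set, the sum of product weights factors into one-dimensional sums.
  Agreement outside \<open>I\<close> lets the coordinates in \<open>I\<close> determine the
  point.\<close>

lemma sum_separated_le:
  fixes a :: "'i \<Rightarrow> ('i \<Rightarrow> nat) \<Rightarrow> real" and I :: "'i set"
  assumes I: "finite I" and T: "finite T" and N: "N \<ge> 1"
    and agree: "\<And>k k' i. k \<in> T \<Longrightarrow> k' \<in> T \<Longrightarrow> i \<notin> I \<Longrightarrow> k i = k' i"
    and sep: "\<And>k k' i. k \<in> T \<Longrightarrow> k' \<in> T \<Longrightarrow> (\<And>i. i \<in> I \<Longrightarrow> \<bar>a i k - a i k'\<bar> < 1 / real N) \<Longrightarrow>
      i \<in> I \<Longrightarrow> \<bar>int (k i) - int (k' i)\<bar> < int D"
    and range: "\<And>k i. k \<in> T \<Longrightarrow> i \<in> I \<Longrightarrow> \<lfloor>real N * a i k\<rfloor> \<in> {v i..<v i + int (N * p)}"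
  shows "(\<Sum>k\<in>T. \<Prod>i\<in>I. cell_wt N \<lfloor>real N * a i k\<rfloor>)
    \<le> (real D * real p * (2 * real N * (2 + ln (real N)))) ^ card I"
proof -
  define c where "c k = restrict (\<lambda>i. \<lfloor>real N * a i k\<rfloor>) I" for k
  define S where "S = PiE I (\<lambda>i. {v i..<v i + int (N * p)})"
  have cS: "c ` T \<subseteq> S" using range by (auto simp: S_def c_def)
  have fS: "finite S" unfolding S_def using I by (intro finite_PiE) auto
  have fiber: "card {k \<in> T. c k = s} \<le> D ^ card I" for s
  proof -
    let ?m = "\<lambda>k. restrict (\<lambda>i. k i mod D) I"
    have lt: "\<bar>int (k i) - int (k' i)\<bar> < int D"
      if "k \<in> T" "k' \<in> T" "c k = c k'" "i \<in> I" for k k' i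
    proof (rule sep[OF that(1,2) _ that(4)])
      fix i assume "i \<in> I"
      then have "\<lfloor>real N * a i k\<rfloor> = \<lfloor>real N * a i k'\<rfloor>"
        using that(3) by (auto simp: c_def restrict_def fun_eq_iff split: if_splits)
      then have "\<bar>real N * a i k - real N * a i k'\<bar> < 1" by linarith
      also have "real N * a i k - real N * a i k' = real N * (a i k - a i k')"
        by (simp add: right_diff_distrib)
      finally show "\<bar>a i k - a i k'\<bar> < 1 / real N"
        using N by (simp add: abs_mult pos_less_divide_eq mult.commute)
    qed
    \<comment> \<open>Two points in the same cell differ by less than \<open>D\<close>, so residues modulo \<open>D\<close> tell them apart.\<close>
    have inj: "inj_on ?m {k \<in> T. c k = s}"
    proof (rule inj_onI)
      fix k k' assume k: "k \<in> {k \<in> T. c k = s}" "k' \<in> {k \<in> T. c k = s}" "?m k = ?m k'"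
      show "k = k'"
      proof
        fix i show "k i = k' i"
        proof (cases "i \<in> I")
          case True
          have "k i mod D = k' i mod D" using k(3) True by (auto simp: restrict_def fun_eq_iff split: if_splits)
          then have "int (k i) mod int D = int (k' i) mod int D" by (metis zmod_int)
          then have "int D dvd int (k i) - int (k' i)" by (simp add: mod_eq_dvd_iff)
          then show ?thesis using lt[of k k' i] k True dvd_imp_le_int[of "int (k i) - int (k' i)" "int D"] by auto
        qed (use k agree in auto)
      qed
    qed
    have "?m ` {k \<in> T. c k = s} \<subseteq> PiE I (\<lambda>_. {..<D})"
    proof (clarsimp simp: PiE_iff extensional_def)
      fix k i assume "k \<in> T" "i \<in> I"
      \<comment> \<open>Comparing \<open>k\<close> with itself yields \<open>0 < D\<close>.\<close>
      then show "k i mod D < D" using lt[of k k i] by (cases D) auto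
    qed
    then have "card {k \<in> T. c k = s} \<le> card (PiE I (\<lambda>_. {..<D}))"
      using I by (intro card_inj_on_le[OF inj]) (auto intro: finite_PiE)
    then show ?thesis using I by (simp add: card_PiE)
  qed
  have "(\<Sum>k\<in>T. \<Prod>i\<in>I. cell_wt N \<lfloor>real N * a i k\<rfloor>) = (\<Sum>k\<in>T. \<Prod>i\<in>I. cell_wt N (c k i))"
    by (intro sum.cong prod.cong) (auto simp: c_def)
  also have "\<dots> = (\<Sum>s\<in>S. \<Sum>k\<in>{k \<in> T. c k = s}. \<Prod>i\<in>I. cell_wt N (c k i))"
    by (rule sum.group[OF T fS cS, symmetric])
  also have "\<dots> = (\<Sum>s\<in>S. real (card {k \<in> T. c k = s}) * (\<Prod>i\<in>I. cell_wt N (s i)))"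
    by (intro sum.cong) auto
  also have "\<dots> \<le> (\<Sum>s\<in>S. real D ^ card I * (\<Prod>i\<in>I. cell_wt N (s i)))"
    using fiber by (intro sum_mono mult_right_mono prod_nonneg cell_wt_nonneg)
       (auto simp: of_nat_power[symmetric] simp del: of_nat_power)
  also have "\<dots> = real D ^ card I * (\<Prod>i\<in>I. \<Sum>c\<in>{v i..<v i + int (N * p)}. cell_wt N c)"
    unfolding S_def using I by (simp add: sum_distrib_left[symmetric] prod_sum_PiE)
  also have "\<dots> \<le> real D ^ card I * (\<Prod>i\<in>I. real p * (2 * real N * (2 + ln (real N))))"
    by (intro mult_left_mono prod_mono conjI sum_nonneg cell_wt_nonneg sum_cell_wt_le N) auto
  finally show ?thesis by (simp add: power_mult_distrib mult.assoc)
qed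

text \<open>Separation is available only for corners that agree outside \<open>I\<close>, so the sum
  is cut into slices by the coordinates outside \<open>I\<close>.\<close>

lemma sum_separated_slices_le:
  fixes a :: "'i::finite \<Rightarrow> ('i \<Rightarrow> nat) \<Rightarrow> real" and I :: "'i set"
  assumes N: "N \<ge> 1"
    and sep: "\<And>k k' i. k \<in> PiE UNIV (\<lambda>_. {..<K}) \<Longrightarrow> k' \<in> PiE UNIV (\<lambda>_. {..<K}) \<Longrightarrow>
      (\<And>i. i \<notin> I \<Longrightarrow> k i = k' i) \<Longrightarrow>
      (\<And>i. i \<in> I \<Longrightarrow> \<bar>a i k - a i k'\<bar> < 1 / real N) \<Longrightarrow>
      i \<in> I \<Longrightarrow> \<bar>int (k i) - int (k' i)\<bar> < int D"
    and range: "\<And>k i. k \<in> PiE UNIV (\<lambda>_. {..<K}) \<Longrightarrow> i \<in> I \<Longrightarrow>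
      \<lfloor>real N * a i k\<rfloor> \<in> {v i..<v i + int (N * p)}"
  shows "(\<Sum>k\<in>PiE UNIV (\<lambda>_. {..<K}). \<Prod>i\<in>I. cell_wt N \<lfloor>real N * a i k\<rfloor>)
    \<le> real K ^ card (- I) * (real D * real p * (2 * real N * (2 + ln (real N)))) ^ card I"
proof -
  let ?B = "PiE (UNIV :: 'i set) (\<lambda>_. {..<K})"
  let ?E = "PiE (- I) (\<lambda>_. {..<K})"
  let ?X = "(real D * real p * (2 * real N * (2 + ln (real N)))) ^ card I"
  have fB: "finite ?B" and fE: "finite ?E" by (auto intro: finite_PiE)
  have im: "(\<lambda>k. restrict k (- I)) ` ?B \<subseteq> ?E" by auto
  have "(\<Sum>k\<in>?B. \<Prod>i\<in>I. cell_wt N \<lfloor>real N * a i k\<rfloor>)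
     = (\<Sum>e\<in>?E. \<Sum>k\<in>{k \<in> ?B. restrict k (- I) = e}. \<Prod>i\<in>I. cell_wt N \<lfloor>real N * a i k\<rfloor>)"
    by (rule sum.group[OF fB fE im, symmetric])
  also have "\<dots> \<le> (\<Sum>e\<in>?E. ?X)"
  proof (rule sum_mono)
    fix e
    have ag: "k i = k' i" if "k \<in> {k \<in> ?B. restrict k (- I) = e}" "k' \<in> {k \<in> ?B. restrict k (- I) = e}" "i \<notin> I"
      for k k' i
      using that by (metis (mono_tags, lifting) ComplI mem_Collect_eq restrict_apply')
    show "(\<Sum>k\<in>{k \<in> ?B. restrict k (- I) = e}. \<Prod>i\<in>I. cell_wt N \<lfloor>real N * a i k\<rfloor>) \<le> ?X"
    proof (rule sum_separated_le[OF _ _ N])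
      fix k k' i
      assume *: "k \<in> {k \<in> ?B. restrict k (- I) = e}" "k' \<in> {k \<in> ?B. restrict k (- I) = e}"
        "\<And>i. i \<in> I \<Longrightarrow> \<bar>a i k - a i k'\<bar> < 1 / real N" "i \<in> I"
      show "\<bar>int (k i) - int (k' i)\<bar> < int D"
        using * ag[OF *(1,2)] by (intro sep) auto
    qed (use fB range ag in auto)
  qed
  also have "\<dots> = real K ^ card (- I) * ?X" by (simp add: card_PiE)
  finally show ?thesis .
qed

subsection \<open>Partial derivatives\<close>

text \<open>As in \<open>mixed_diff\<close>, the head of the list acts first. The matching
  recursions allow differences to be compared with derivatives by induction on the list.\<close>

fun partials :: "'n::finite list \<Rightarrow> (real ^ 'n \<Rightarrow> real) \<Rightarrow> real ^ 'n \<Rightarrow> real" where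
  "partials [] f = f"
| "partials (i # L) f = partials L (partial i f)"

lemma C_class_differentiable: "C_class (Suc k) f \<Longrightarrow> f differentiable (at x)"
  by (auto simp: differentiable_on_def)

lemma C_class_imp_continuous: "C_class k f \<Longrightarrow> continuous_on UNIV f"
  by (cases k) (auto intro: differentiable_imp_continuous_on)

lemma C_class_mono: "C_class k f \<Longrightarrow> k' \<le> k \<Longrightarrow> C_class k' f"
proof (induction k' arbitrary: k f)
  case 0
  then show ?case by (auto intro: C_class_imp_continuous)
next
  case (Suc k')
  then show ?case by (cases k) auto
qed

lemma C_class_partials: "C_class (k + length L) f \<Longrightarrow> C_class k (partials L f)"
  by (induction L arbitrary: f) auto

lemma has_derivative_partial:
  assumes "f differentiable (at x)"
  shows "(f has_derivative (\<lambda>v. \<Sum>k\<in>UNIV. partial k f x * v $ k)) (at x)"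
proof -
  let ?D = "frechet_derivative f (at x)"
  have D: "(f has_derivative ?D) (at x)" using assms by (simp add: frechet_derivative_works)
  then have lin: "linear ?D" by (rule has_derivative_linear)
  have "?D v = (\<Sum>k\<in>UNIV. partial k f x * v $ k)" for v
  proof -
    have "?D v = ?D (\<Sum>k\<in>UNIV. v $ k *\<^sub>R axis k 1)"
      by (simp add: basis_expansion[of v, unfolded scalar_mult_eq_scaleR])
    then show ?thesis
      by (simp add: linear_sum[OF lin] linear_scale[OF lin] partial_def mult.commute)
  qed
  then have "?D = (\<lambda>v. \<Sum>k\<in>UNIV. partial k f x * v $ k)" by blast
  with D show ?thesis by simp
qed

lemma partial_eqI:
  assumes "(f has_derivative D) (at x)"
  shows "partial i f x = D (axis i 1)"
  unfolding partial_def using frechet_derivative_at[OF assms] by simp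

lemma partial_mvt:
  assumes "\<And>x. f differentiable (at x)"
  obtains \<xi> where "\<xi> \<in> closed_segment x y" "f y - f x = (\<Sum>k\<in>UNIV. partial k f \<xi> * (y - x) $ k)"
proof -
  have d: "((\<lambda>t. f (x + t *\<^sub>R (y - x))) has_derivative
      (\<lambda>t. \<Sum>k\<in>UNIV. partial k f (x + u *\<^sub>R (y - x)) * (t *\<^sub>R (y - x)) $ k)) (at u within {0..1})" for u
    by (rule has_derivative_compose[OF _ has_derivative_partial[OF assms]])
       (auto intro!: derivative_eq_intros)
  from mvt_very_simple[of 0 1, OF _ d]
  obtain u where u: "u \<in> {0..1}"
    "f (x + 1 *\<^sub>R (y - x)) - f (x + 0 *\<^sub>R (y - x)) = (\<Sum>k\<in>UNIV. partial k f (x + u *\<^sub>R (y - x)) * ((1 - 0) *\<^sub>R (y - x)) $ k)"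
    by auto
  show ?thesis
    by (rule that[of "x + u *\<^sub>R (y - x)"]) (use u in \<open>auto simp: in_segment algebra_simps\<close>)
qed

lemma partial_mvt_axis:
  assumes "\<And>x. f differentiable (at x)" "0 \<le> s"
  obtains \<theta> where "0 \<le> \<theta>" "\<theta> \<le> s" "f (x + s *\<^sub>R axis i 1) - f x = s * partial i f (x + \<theta> *\<^sub>R axis i 1)"
proof -
  obtain \<xi> where \<xi>: "\<xi> \<in> closed_segment x (x + s *\<^sub>R axis i 1)"
    "f (x + s *\<^sub>R axis i 1) - f x = (\<Sum>k\<in>UNIV. partial k f \<xi> * (s *\<^sub>R axis i 1 :: real ^ 'a) $ k)"
    using partial_mvt[OF assms(1), of x "x + s *\<^sub>R axis i 1"] by auto
  then obtain u where u: "0 \<le> u" "u \<le> 1" "\<xi> = (1 - u) *\<^sub>R x + u *\<^sub>R (x + s *\<^sub>R axis i 1)"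
    by (auto simp: in_segment)
  then have x: "\<xi> = x + (u * s) *\<^sub>R axis i 1" by (simp add: algebra_simps)
  show ?thesis
  proof (rule that[of "u * s"])
    show "u * s \<le> s" using u assms(2) by (simp add: mult_left_le_one_le)
    have "(\<Sum>k\<in>UNIV. partial k f \<xi> * (s *\<^sub>R axis i 1 :: real ^ 'a) $ k)
        = (\<Sum>k\<in>UNIV. if k = i then s * partial i f \<xi> else 0)"
      by (intro sum.cong) (auto simp: axis_def)
    then show "f (x + s *\<^sub>R axis i 1) - f x = s * partial i f (x + (u * s) *\<^sub>R axis i 1)"
      using \<xi>(2) x by simp
  qed (use u assms(2) in auto)
qed

lemma has_derivative_shift_diff:
  assumes "\<And>x. f differentiable (at x)"
  shows "((\<lambda>x. f (x + c) - f x) has_derivative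
      (\<lambda>v. (\<Sum>k\<in>UNIV. partial k f (x + c) * v $ k) - (\<Sum>k\<in>UNIV. partial k f x * v $ k))) (at x)"
  by (intro has_derivative_diff has_derivative_partial[OF assms]
        has_derivative_compose[OF _ has_derivative_partial[OF assms], of "\<lambda>x. x + c"])
     (auto intro!: derivative_eq_intros)

lemma partial_shift_diff:
  assumes "\<And>x. f differentiable (at x)"
  shows "partial i (\<lambda>x. f (x + c) - f x) = (\<lambda>x. partial i f (x + c) - partial i f x)"
proof
  fix x
  have *: "(\<Sum>k\<in>UNIV. g k * axis i 1 $ k) = (g i :: real)" for g
  proof -
    have "(\<Sum>k\<in>UNIV. g k * axis i 1 $ k) = (\<Sum>k\<in>UNIV. if k = i then g i else 0)"
      by (intro sum.cong) (auto simp: axis_def)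
    then show ?thesis by simp
  qed
  show "partial i (\<lambda>x. f (x + c) - f x) x = partial i f (x + c) - partial i f x"
    by (simp add: partial_eqI[OF has_derivative_shift_diff[OF assms]] *)
qed

lemma C_class_shift_diff: "C_class k f \<Longrightarrow> C_class k (\<lambda>x. f (x + c) - f x)"
proof (induction k arbitrary: f)
  case 0
  then have "continuous_on UNIV f" by simp
  then have "continuous_on UNIV (\<lambda>x. f (x + c))"
    by (rule continuous_on_compose2[of UNIV f]) (auto intro!: continuous_intros)
  then show ?case using 0 by (auto intro!: continuous_intros)
next
  case (Suc k)
  have d: "f differentiable (at x)" for x using Suc.prems by (rule C_class_differentiable)
  show ?case
    using Suc has_derivative_shift_diff[OF d, of c] partial_shift_diff[OF d, of _ c]
    by (auto simp: differentiable_on_def differentiable_def intro: has_derivative_at_withinI)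
qed

lemma partials_shift_diff:
  "C_class (length L) f \<Longrightarrow> partials L (\<lambda>x. f (x + c) - f x) = (\<lambda>x. partials L f (x + c) - partials L f x)"
proof (induction L arbitrary: f)
  case (Cons i L)
  have d: "f differentiable (at x)" for x using Cons.prems C_class_differentiable by simp
  show ?case using Cons by (simp add: partial_shift_diff[OF d])
qed simp

lemma partials_append: "partials (L @ L') f = partials L' (partials L f)"
  by (induction L arbitrary: f) auto

lemma partial_sum:
  assumes "\<And>j x. f j differentiable (at x)"
  shows "partial i (\<lambda>x. \<Sum>j\<in>S. t j * f j x) = (\<lambda>x. \<Sum>j\<in>S. t j * partial i (f j) x)"
proof
  fix x
  have "((\<lambda>x. \<Sum>j\<in>S. t j * f j x) has_derivative
      (\<lambda>v. \<Sum>j\<in>S. t j * frechet_derivative (f j) (at x) v)) (at x)"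
    using assms by (intro has_derivative_sum has_derivative_mult_right) (simp add: frechet_derivative_works[symmetric])
  from partial_eqI[OF this, of i]
  show "partial i (\<lambda>x. \<Sum>j\<in>S. t j * f j x) x = (\<Sum>j\<in>S. t j * partial i (f j) x)"
    by (simp add: partial_def)
qed

lemma C_class_sum:
  assumes "\<And>j. C_class k (f j)"
  shows "C_class k (\<lambda>x. \<Sum>j\<in>S. t j * f j x)"
  using assms
proof (induction k arbitrary: f)
  case 0
  then show ?case by (auto intro!: continuous_intros)
next
  case (Suc k)
  have d: "f j differentiable (at x)" for j x using Suc.prems by (rule C_class_differentiable)
  have "(\<lambda>x. t j * f j x) differentiable (at x)" for j x
    using d by (intro differentiable_mult) auto
  then have "(\<lambda>x. \<Sum>j\<in>S. t j * f j x) differentiable (at x)" for x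
    by (cases "finite S") (auto intro!: differentiable_sum)
  then show ?case
    using Suc by (auto simp: partial_sum[OF d] intro: differentiable_at_imp_differentiable_on)
qed

lemma partials_sum:
  assumes "\<And>j. C_class (length L) (f j)"
  shows "partials L (\<lambda>x. \<Sum>j\<in>S. t j * f j x) = (\<lambda>x. \<Sum>j\<in>S. t j * partials L (f j) x)"
  using assms
proof (induction L arbitrary: f)
  case (Cons i L)
  have d: "f j differentiable (at x)" for j x using Cons.prems[of j] C_class_differentiable by simp
  show ?case using Cons by (simp add: partial_sum[OF d])
qed simp

section \<open>Mixed differences along a lattice, and lattice paths\<close>

definition grid :: "real ^ 'n::finite \<Rightarrow> real \<Rightarrow> ('n \<Rightarrow> nat) \<Rightarrow> real ^ 'n" where
  "grid x s h = (\<chi> k. x $ k + s * real (h k))"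

lemma grid_nth [simp]: "grid x s h $ k = x $ k + s * real (h k)"
  by (simp add: grid_def)

lemma grid_incr: "grid x s (incr i h) = grid x s h + s *\<^sub>R axis i 1"
  by (auto simp: vec_eq_iff incr_def axis_def algebra_simps)

text \<open>An iterated mean value theorem. The first difference \<open>G\<close> is treated as a
  new function: its derivatives of order \<open>length L\<close> are \<open>s\<close> times
  derivatives of \<open>f\<close> one order higher, so a bound on derivatives of the top order alone
  is carried through the induction.\<close>

lemma mixed_diff_grid_le:
  assumes "C_class (length L) f" "0 \<le> s"
    and "\<And>L' y. length L' = length L \<Longrightarrow> y \<in> cbox lo hi \<Longrightarrow> \<bar>partials L' f y\<bar> \<le> B"
    and "\<And>k. lo $ k \<le> x $ k + s * real (h k)" "\<And>k. x $ k + s * real (h k + length L) \<le> hi $ k"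
  shows "\<bar>mixed_diff L (\<lambda>h. f (grid x s h)) h\<bar> \<le> s ^ length L * B"
  using assms
proof (induction L arbitrary: f hi B)
  case Nil
  then show ?case by (auto simp: mem_box_cart)
next
  case (Cons i L)
  define G where "G = (\<lambda>y. f (y + s *\<^sub>R axis i 1) - f y)"
  \<comment> \<open>The upper corner gives up \<open>s\<close>, so that a point of the smaller box
    may still move by \<open>s\<close> along axis \<open>i\<close>.\<close>
  define hi' :: "real ^ 'a" where "hi' = (\<chi> k. hi $ k - s)"
  have "\<bar>mixed_diff L (\<lambda>h. G (grid x s h)) h\<bar> \<le> s ^ length L * (s * B)"
  proof (rule Cons.IH)
    show "C_class (length L) G" unfolding G_def
      using C_class_mono[OF Cons.prems(1)] by (intro C_class_shift_diff) auto
    show "x $ k + s * real (h k + length L) \<le> hi' $ k" for k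
      using Cons.prems(5)[of k] by (simp add: hi'_def algebra_simps)
    fix L' :: "'a list" and y assume L': "length L' = length L" and y: "y \<in> cbox lo hi'"
    have cl: "C_class (Suc (length L')) f" using Cons.prems(1) L' by simp
    have cl': "C_class 1 (partials L' f)" using C_class_partials[of 1 L' f] cl by simp
    obtain \<theta> where \<theta>: "0 \<le> \<theta>" "\<theta> \<le> s"
      "partials L' f (y + s *\<^sub>R axis i 1) - partials L' f y = s * partial i (partials L' f) (y + \<theta> *\<^sub>R axis i 1)"
      using partial_mvt_axis[of "partials L' f" s y i] C_class_differentiable[of 0] cl' Cons.prems(2)
      by (metis One_nat_def)
    have "y + \<theta> *\<^sub>R axis i 1 \<in> cbox lo hi"
      unfolding mem_box_cart
    proof
      fix k
      have "lo $ k \<le> y $ k" "y $ k \<le> hi $ k - s" using y by (auto simp: mem_box_cart hi'_def)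
      then show "lo $ k \<le> (y + \<theta> *\<^sub>R axis i 1) $ k \<and> (y + \<theta> *\<^sub>R axis i 1) $ k \<le> hi $ k"
        using \<theta>(1,2) by (cases "k = i") (auto simp: axis_def)
    qed
    \<comment> \<open>Here \<open>partial i\<close> acts last, hence \<open>i\<close> is appended to
      the list.\<close>
    then have "\<bar>partials (L' @ [i]) f (y + \<theta> *\<^sub>R axis i 1)\<bar> \<le> B"
      using L' by (intro Cons.prems(3)) auto
    then have "\<bar>partial i (partials L' f) (y + \<theta> *\<^sub>R axis i 1)\<bar> \<le> B"
      by (simp add: partials_append)
    moreover have "partials L' G = (\<lambda>x. partials L' f (x + s *\<^sub>R axis i 1) - partials L' f x)"
      unfolding G_def by (rule partials_shift_diff[OF C_class_mono[OF cl]]) simp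
    ultimately show "\<bar>partials L' G y\<bar> \<le> s * B"
      using \<theta>(3) Cons.prems(2) by (simp add: abs_mult mult_left_mono)
  qed (fact Cons.prems(2), fact Cons.prems(4))
  moreover have "mixed_diff (i # L) (\<lambda>h. f (grid x s h)) h = mixed_diff L (\<lambda>h. G (grid x s h)) h"
    by (simp add: grid_incr G_def)
  ultimately show ?case by (simp only: length_Cons power_Suc mult_ac)
qed

text \<open>Telescoping along a monotone lattice path from the origin to \<open>h\<close>; it stays
  in the cube and has at most \<open>CARD('n) * M\<close> unit steps.\<close>

lemma lattice_path_bound:
  fixes w :: "('n::finite \<Rightarrow> nat) \<Rightarrow> real"
  assumes "\<And>i h. (\<And>j. incr i h j \<le> M) \<Longrightarrow> \<bar>w (incr i h) - w h\<bar> \<le> c"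
    and "\<And>j. h j \<le> M" "0 \<le> c"
  shows "\<bar>w h - w (\<lambda>_. 0)\<bar> \<le> real (CARD('n) * M) * c"
proof -
  have "\<bar>w h - w (\<lambda>_. 0)\<bar> \<le> real m * c" if "(\<Sum>j\<in>UNIV. h j) = m" "\<And>j. h j \<le> M" for m h
    using that
  proof (induction m arbitrary: h)
    case 0
    then have "h = (\<lambda>_. 0)" by auto
    then show ?case by simp
  next
    case (Suc m)
    then have "\<exists>i. h i \<noteq> 0" by (metis (mono_tags) nat.distinct(1) sum.neutral)
    then obtain i where i: "h i > 0" by blast
    define g where "g = h(i := h i - 1)"
    have hg: "h = incr i g" using i by (auto simp: g_def incr_def)
    have "(\<Sum>j\<in>UNIV. h j) = h i + (\<Sum>j\<in>UNIV - {i}. h j)" "(\<Sum>j\<in>UNIV. g j) = g i + (\<Sum>j\<in>UNIV - {i}. g j)"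
      by (rule sum.remove; simp)+
    moreover have "(\<Sum>j\<in>UNIV - {i}. h j) = (\<Sum>j\<in>UNIV - {i}. g j)"
      by (intro sum.cong) (auto simp: g_def)
    moreover have "g i = h i - 1" by (simp add: g_def)
    ultimately have "(\<Sum>j\<in>UNIV. g j) = m" using Suc.prems(1) i by linarith
    moreover have "g j \<le> M" for j using Suc.prems(2)[of j] by (auto simp: g_def)
    ultimately have "\<bar>w g - w (\<lambda>_. 0)\<bar> \<le> real m * c" by (rule Suc.IH)
    moreover have "\<bar>w h - w g\<bar> \<le> c" using assms(1)[of i g] Suc.prems(2) hg by simp
    ultimately show ?case by (simp add: algebra_simps)
  qed
  then have "\<bar>w h - w (\<lambda>_. 0)\<bar> \<le> real (\<Sum>j\<in>UNIV. h j) * c" using assms(2) by blast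
  also have "\<dots> \<le> real (CARD('n) * M) * c"
  proof (rule mult_right_mono[OF _ assms(3)])
    have "(\<Sum>j\<in>UNIV. h j) \<le> CARD('n) * M"
      using sum_bounded_above[of UNIV h M] assms(2) by simp
    then show "real (\<Sum>j\<in>UNIV. h j) \<le> real (CARD('n) * M)" by (simp only: of_nat_le_iff)
  qed
  finally show ?thesis .
qed

subsection \<open>Exponential sums over small boxes\<close>

text \<open>From order 2 on the affine part drops out, and derivatives bound the differences
  directly. The affine coefficients are the first differences at the corner, so the residual phase
  vanishes there to first order; orders 1 and 0 follow by walking lattice paths from the corner.
  With \<open>n = CARD('n)\<close> each walk costs a factor \<open>n * (n + 1)\<close>, whence the
  square in the constant.\<close>

lemma slow_var_phase:
  fixes F :: "real ^ 'n::finite \<Rightarrow> real" and x :: "real ^ 'n"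
  defines "\<alpha> \<equiv> \<lambda>i q. real q * (F (x + (1 / real q) *\<^sub>R axis i 1) - F x)"
  assumes F: "C_class (max 2 CARD('n)) F" and N: "N \<ge> 1" "real N ^ 2 * J \<le> real q" and J: "J \<ge> 1"
    and B: "\<And>L y. length L \<le> max 2 CARD('n) \<Longrightarrow> y \<in> cbox x (x + (real (N + CARD('n) + 2) / real q) *\<^sub>R 1)
        \<Longrightarrow> \<bar>partials L F y\<bar> \<le> J * B"
  shows "slow_var N CARD('n) (N + CARD('n)) ((real (CARD('n) * (CARD('n) + 1)))\<^sup>2 * B)
      (\<lambda>h. real q * F (grid x (1 / real q) h) - real q * F x - (\<Sum>i\<in>UNIV. \<alpha> i q * real (h i)))"
proof -
  let ?n = "CARD('n)"
  let ?M = "N + ?n"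
  let ?G = "\<lambda>h. F (grid x (1 / real q) h)"
  define A where "A i = \<alpha> i q" for i
  let ?\<psi> = "\<lambda>h. real q * ?G h - real q * F x - (\<Sum>i\<in>UNIV. A i * real (h i))"
  have n1: "1 \<le> ?n" by simp
  have q1: "1 \<le> real q"
  proof -
    have "1 * 1 \<le> real N ^ 2 * J" using N(1) J by (intro mult_mono) auto
    then show ?thesis using N(2) by linarith
  qed
  then have q0: "real q > 0" by simp
  have Nq: "real N \<le> real q"
  proof -
    have "real N * 1 * 1 \<le> real N * real N * J" using N(1) J by (intro mult_mono) auto
    then show ?thesis using N(2) by (simp add: power2_eq_square)
  qed
  have B0: "0 \<le> B"
  proof -
    have "0 \<le> \<bar>partials [] F x\<bar>" by simp
    also have "\<dots> \<le> J * B" by (rule B) (auto simp: mem_box_cart)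
    finally show ?thesis using J by (simp add: zero_le_mult_iff)
  qed
  \<comment> \<open>Two units of room beyond \<open>M\<close>: the path arguments take second
    differences at points whose coordinates may equal \<open>M\<close>.\<close>
  have md: "\<bar>mixed_diff L ?G h\<bar> \<le> (1 / real q) ^ length L * (J * B)"
    if L: "length L \<le> max 2 ?n" and h: "\<And>j. h j + length L \<le> ?M + 2" for L h
  proof (rule mixed_diff_grid_le[where lo = x and hi = "x + (real (?M + 2) / real q) *\<^sub>R 1"])
    show "C_class (length L) F" by (rule C_class_mono[OF F L])
    show "x $ k + 1 / real q * real (h k + length L) \<le> (x + (real (?M + 2) / real q) *\<^sub>R 1) $ k" for k
      using h[of k] q0 by (simp add: divide_right_mono del: of_nat_add)
  qed (use B L in \<open>auto\<close>)
  \<comment> \<open>Of two factors \<open>1 / q\<close> one is cancelled by the outer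
    \<open>q\<close>, and the other gives \<open>J / q \<le> 1 / N ^ 2\<close>. Every further factor
    is at most \<open>1 / N\<close>.\<close>
  have mdq: "\<bar>real q * mixed_diff L ?G h\<bar> \<le> B / real N ^ length L"
    if L: "2 \<le> length L" "length L \<le> max 2 ?n" and h: "\<And>j. h j + length L \<le> ?M + 2" for L h
  proof -
    obtain m where m: "length L = m + 2" using L(1) by (metis add.commute le_Suc_ex)
    have "\<bar>real q * mixed_diff L ?G h\<bar> \<le> real q * ((1 / real q) ^ length L * (J * B))"
      using md[OF L(2) h] by (simp add: abs_mult mult_left_mono)
    also have "\<dots> = (J / real q) * (1 / real q) ^ m * B"
      using q0 unfolding m by (simp add: field_simps power2_eq_square)
    also have "\<dots> \<le> (1 / real N ^ 2) * (1 / real N) ^ m * B"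
    proof (intro mult_right_mono mult_mono power_mono B0)
      show "J / real q \<le> 1 / real N ^ 2" using N q0 by (simp add: field_simps)
      show "1 / real q \<le> 1 / real N" using Nq N(1) by (simp add: frac_le)
    qed (use J q0 in auto)
    also have "\<dots> = B / real N ^ length L" unfolding m by (simp add: power_add power_divide power2_eq_square)
    finally show ?thesis .
  qed
  have step: "?\<psi> (incr i h) - ?\<psi> h = real q * mixed_diff [i] ?G h - A i" for i h
  proof -
    have "(\<Sum>j\<in>UNIV. A j * real (incr i h j)) - (\<Sum>j\<in>UNIV. A j * real (h j)) = (\<Sum>j\<in>UNIV. if j = i then A i else 0)"
      unfolding sum_subtractf[symmetric] by (intro sum.cong) (auto simp: incr_def algebra_simps)
    then show ?thesis by (simp add: algebra_simps)
  qed
  have A0: "A i = real q * mixed_diff [i] ?G (\<lambda>_. 0)" for i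
  proof -
    have "grid x (1 / real q) (\<lambda>_. 0) = x" by (simp add: vec_eq_iff)
    then show ?thesis by (simp add: A_def \<alpha>_def grid_incr)
  qed
  have one: "\<bar>?\<psi> (incr i h) - ?\<psi> h\<bar> \<le> real (?n * (?n + 1)) * B / real N" if h: "\<And>j. h j \<le> ?M" for i h
  proof -
    define w where "w h = real q * mixed_diff [i] ?G h" for h
    have "\<bar>w h - w (\<lambda>_. 0)\<bar> \<le> real (?n * ?M) * (B / real N ^ 2)"
    proof (rule lattice_path_bound)
      fix k :: 'n and h assume kh: "\<And>j. incr k h j \<le> ?M"
      have "h j \<le> ?M" for j using kh[of j] by (auto simp: incr_def split: if_splits)
      then have "\<bar>real q * mixed_diff [k, i] ?G h\<bar> \<le> B / real N ^ length [k, i]"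
        by (intro mdq) auto
      moreover have "mixed_diff [k, i] ?G h = mixed_diff [i] ?G (incr k h) - mixed_diff [i] ?G h"
        by (simp add: incr_commute[of i k])
      ultimately show "\<bar>w (incr k h) - w h\<bar> \<le> B / real N ^ 2"
        by (simp add: w_def right_diff_distrib[symmetric] power2_eq_square del: mixed_diff.simps)
    qed (use h B0 in auto)
    \<comment> \<open>As \<open>N \<ge> 1\<close>, the side \<open>N + n\<close> is at most
      \<open>(n + 1) * N\<close>, which makes the path length comparable with
      \<open>N\<close>.\<close>
    also have "\<dots> \<le> real (?n * ((?n + 1) * N)) * (B / real N ^ 2)"
      using B0 N(1) by (intro mult_right_mono) (simp_all only: of_nat_le_iff, auto)
    also have "\<dots> = real (?n * (?n + 1)) * B / real N"
      using N(1) by (simp add: power2_eq_square field_simps)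
    finally show ?thesis unfolding step w_def A0[symmetric] .
  qed
  have zero: "\<bar>?\<psi> h\<bar> \<le> (real (?n * (?n + 1)))\<^sup>2 * B" if h: "\<And>j. h j \<le> ?M" for h
  proof -
    have "\<bar>?\<psi> h - ?\<psi> (\<lambda>_. 0)\<bar> \<le> real (?n * ?M) * (real (?n * (?n + 1)) * B / real N)"
    proof (rule lattice_path_bound[OF _ h])
      fix k :: 'n and h assume kh: "\<And>j. incr k h j \<le> ?M"
      have "h j \<le> ?M" for j using kh[of j] by (auto simp: incr_def split: if_splits)
      then show "\<bar>?\<psi> (incr k h) - ?\<psi> h\<bar> \<le> real (?n * (?n + 1)) * B / real N"
        by (rule one)
    qed (use B0 in auto)
    also have "\<dots> \<le> real (?n * ((?n + 1) * N)) * (real (?n * (?n + 1)) * B / real N)"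
      using B0 N(1) by (intro mult_right_mono) (simp_all only: of_nat_le_iff, auto)
    also have "\<dots> = (real (?n * (?n + 1)))\<^sup>2 * B"
      using N(1) by (simp add: power2_eq_square field_simps)
    finally have "\<bar>?\<psi> h - ?\<psi> (\<lambda>_. 0)\<bar> \<le> (real (?n * (?n + 1)))\<^sup>2 * B" .
    moreover have "?\<psi> (\<lambda>_. 0) = 0"
    proof -
      have "grid x (1 / real q) (\<lambda>_. 0) = x" by (simp add: vec_eq_iff)
      then show ?thesis by simp
    qed
    ultimately show ?thesis by (simp only: diff_0_right)
  qed
  have nn1: "1 \<le> real (?n * (?n + 1))"
    using n1 by (metis (no_types) le_add2 mult_le_mono nat_mult_1 of_nat_1 of_nat_mono)
  have le1: "real (?n * (?n + 1)) * B \<le> (real (?n * (?n + 1)))\<^sup>2 * B"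
    by (intro mult_right_mono self_le_power nn1 B0) simp
  have "slow_var N ?n ?M ((real (?n * (?n + 1)))\<^sup>2 * B) ?\<psi>"
    unfolding slow_var_def
  proof (intro allI impI)
    fix L :: "'n list" and h :: "'n \<Rightarrow> nat"
    assume L: "length L \<le> ?n" and h: "\<forall>i. h i + length L \<le> ?M"
    have hM: "h i \<le> ?M" for i using h[rule_format, of i] by simp
    consider "L = []" | i where "L = [i]" | i j L' where "L = i # j # L'"
      by (metis neq_Nil_conv)
    then show "norm (mixed_diff L ?\<psi> h) \<le> (real (?n * (?n + 1)))\<^sup>2 * B / real N ^ length L"
    proof cases
      case 1
      then show ?thesis using zero[OF hM] by simp
    next
      case (2 i)
      have "norm (mixed_diff L ?\<psi> h) = \<bar>?\<psi> (incr i h) - ?\<psi> h\<bar>" using 2 by simp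
      also have "\<dots> \<le> real (?n * (?n + 1)) * B / real N" by (rule one[OF hM])
      also have "\<dots> \<le> (real (?n * (?n + 1)))\<^sup>2 * B / real N"
        using le1 by (rule divide_right_mono) simp
      finally show ?thesis using 2 by simp
    next
      case (3 i j L')
      have lin: "linear (\<lambda>y::real. real q * y)" by (rule linearI) (auto simp: algebra_simps)
      have "mixed_diff L ?\<psi> h = mixed_diff (j # L') (\<lambda>h. ?\<psi> (incr i h) - ?\<psi> h) h"
        by (simp only: 3 mixed_diff.simps)
      also have "\<dots> = mixed_diff (j # L') (\<lambda>h. real q * mixed_diff [i] ?G h - A i) h"
        by (simp only: step)
      also have "\<dots> = mixed_diff (j # L') (\<lambda>h. real q * mixed_diff [i] ?G h) h"
        unfolding mixed_diff_diff by (subst mixed_diff_const) auto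
      also have "\<dots> = real q * mixed_diff (j # L') (mixed_diff [i] ?G) h"
        by (rule mixed_diff_linear[OF lin])
      also have "mixed_diff (j # L') (mixed_diff [i] ?G) h = mixed_diff L ?G h"
        by (simp add: 3)
      finally have "norm (mixed_diff L ?\<psi> h) \<le> B / real N ^ length L"
        using mdq[of L h] L h[rule_format, THEN le_trans[OF _ le_add1]] 3
        by (simp only: real_norm_def list.size)
      also have "\<dots> \<le> (real (?n * (?n + 1)))\<^sup>2 * B / real N ^ length L"
      proof (rule divide_right_mono)
        have "1 * B \<le> real (?n * (?n + 1)) * B"
          by (intro mult_right_mono nn1 B0)
        then show "B \<le> (real (?n * (?n + 1)))\<^sup>2 * B" using le1 by linarith
      qed simp
      finally show ?thesis .
    qed
  qed
  then show ?thesis by (simp only: A_def)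
qed

text \<open>The exponential splits into a constant of modulus one, powers of \<open>z i\<close> from
  the linear part, and a slowly varying factor from the residual phase. The summation by parts
  contributes \<open>2 ^ CARD('n)\<close>, and \<open>slow_var_exp\<close> the exponential
  constant.\<close>

lemma box_exp_sum_le:
  fixes F :: "real ^ 'n::finite \<Rightarrow> real" and x :: "real ^ 'n"
  assumes F: "C_class (max 2 CARD('n)) F" and N: "N \<ge> 1" "real N ^ 2 * J \<le> real q" and J: "J \<ge> 1"
    and B: "\<And>L y. length L \<le> max 2 CARD('n) \<Longrightarrow> y \<in> cbox x (x + (real (N + CARD('n) + 2) / real q) *\<^sub>R 1)
        \<Longrightarrow> \<bar>partials L F y\<bar> \<le> J * B"
  shows "norm (\<Sum>h\<in>PiE UNIV (\<lambda>_. {..<N}). cis (2 * pi * (real q * F (grid x (1 / real q) h))))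
    \<le> 2 ^ CARD('n) * exp (2 ^ CARD('n) * (2 * pi * ((real (CARD('n) * (CARD('n) + 1)))\<^sup>2 * B)))
        * (\<Prod>i\<in>UNIV. cell_wt N \<lfloor>real N * (real q * (F (x + (1 / real q) *\<^sub>R axis i 1) - F x))\<rfloor>)"
proof -
  define \<alpha> where "\<alpha> i = real q * (F (x + (1 / real q) *\<^sub>R axis i 1) - F x)" for i
  define \<psi> where "\<psi> h = real q * F (grid x (1 / real q) h) - real q * F x - (\<Sum>i\<in>UNIV. \<alpha> i * real (h i))" for h
  define K where "K = (real (CARD('n) * (CARD('n) + 1)))\<^sup>2 * B"
  define T :: "real \<Rightarrow> complex" where "T y = \<i> * of_real (2 * pi * y)" for y
  define u where "u h = exp (T (\<psi> h))" for h
  define z where "z i = cis (2 * pi * \<alpha> i)" for i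
  have sv: "slow_var N CARD('n) (N + CARD('n)) K \<psi>"
    unfolding K_def \<psi>_def \<alpha>_def by (rule slow_var_phase[OF assms])
  have K0: "0 \<le> K" using slow_varD[OF sv, of "[]" "\<lambda>_. 0"] by (simp add: order_trans[OF abs_ge_zero])
  have lin: "linear T" by (rule linearI) (auto simp: T_def algebra_simps scaleR_conv_of_real)
  have svT: "slow_var N CARD('n) (N + CARD('n)) (2 * pi * K) (\<lambda>h. T (\<psi> h))"
    unfolding slow_var_def mixed_diff_linear[OF lin]
  proof (intro allI impI)
    fix L :: "'n list" and h :: "'n \<Rightarrow> nat"
    assume L: "length L \<le> CARD('n)" and h: "\<forall>i. h i + length L \<le> N + CARD('n)"
    have "norm (T (mixed_diff L \<psi> h)) = 2 * pi * norm (mixed_diff L \<psi> h)"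
      by (simp add: T_def norm_mult)
    also have "\<dots> \<le> 2 * pi * (K / real N ^ length L)"
      using h by (intro mult_left_mono slow_varD[OF sv L]) auto
    finally show "norm (T (mixed_diff L \<psi> h)) \<le> 2 * pi * K / real N ^ length L" by simp
  qed
  have svu: "slow_var N CARD('n) (N + CARD('n)) (exp (2 ^ CARD('n) * (2 * pi * K))) u"
    unfolding u_def using K0 by (intro slow_var_exp svT) auto
  obtain I :: "'n list" where I: "set I = UNIV" "distinct I"
    using finite_distinct_list[OF finite[of UNIV]] by blast
  have lI: "length I = CARD('n)" using I distinct_card by fastforce
  have factor: "cis (2 * pi * (real q * F (grid x (1 / real q) h)))
      = cis (2 * pi * (real q * F x)) * ((\<Prod>i\<in>UNIV. z i ^ h i) * u h)" for h
  proof -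
    have "(\<Prod>i\<in>UNIV. z i ^ h i) = cis (2 * pi * (\<Sum>i\<in>UNIV. \<alpha> i * real (h i)))"
      by (simp add: z_def cis_conv_exp exp_sum[symmetric] exp_of_nat_mult[symmetric] sum_distrib_left mult_ac)
    moreover have "u h = cis (2 * pi * \<psi> h)" by (simp add: u_def T_def cis_conv_exp)
    ultimately show ?thesis
      by (simp add: cis_mult \<psi>_def algebra_simps)
  qed
  have "(\<Sum>h\<in>PiE UNIV (\<lambda>_. {..<N}). cis (2 * pi * (real q * F (grid x (1 / real q) h))))
      = cis (2 * pi * (real q * F x)) * box_sum N z I u (\<lambda>_. 0)"
    unfolding box_sum_eq_sum[OF I(2)] I(1) factor by (simp add: sum_distrib_left)
  also have "norm \<dots> = norm (box_sum N z I u (\<lambda>_. 0))" by (simp add: norm_mult)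
  also have "\<dots> \<le> 2 ^ length I * exp (2 ^ CARD('n) * (2 * pi * K)) * (\<Prod>i\<in>set I. cell_wt N \<lfloor>real N * \<alpha> i\<rfloor>)"
  proof (rule norm_box_sum_le[OF I(2) svu])
    show "norm (\<Sum>k<m. z i ^ k) \<le> cell_wt N \<lfloor>real N * \<alpha> i\<rfloor>" if "m \<le> N" for i m
      unfolding z_def by (rule norm_geometric_cis[OF that N(1)])
  qed (use lI N in auto)
  finally show ?thesis by (simp add: lI I(1) K_def \<alpha>_def)
qed

lemma cell_wt_le: "cell_wt N c \<le> 2 * real N"
proof -
  have "1 / max 1 y \<le> 1" for y :: real by simp
  from add_mono[OF this this] have "cell_wt N c \<le> real N * (1 + 1)"
    unfolding cell_wt_def by (intro mult_left_mono) auto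
  then show ?thesis by simp
qed

text \<open>Outside \<open>I\<close> the frequencies are not known to be separated, so these
  coordinates get the trivial bound.\<close>

lemma prod_cell_wt_le:
  fixes c :: "'n::finite \<Rightarrow> int"
  shows "(\<Prod>i\<in>UNIV. cell_wt N (c i)) \<le> (2 * real N) ^ card (- I) * (\<Prod>i\<in>I. cell_wt N (c i))"
proof -
  have "(\<Prod>i\<in>UNIV. cell_wt N (c i)) = (\<Prod>i\<in>- I. cell_wt N (c i)) * (\<Prod>i\<in>I. cell_wt N (c i))"
    by (subst prod.union_disjoint[symmetric]) (auto intro: prod.cong)
  also have "\<dots> \<le> (\<Prod>i\<in>- I. 2 * real N) * (\<Prod>i\<in>I. cell_wt N (c i))"
    by (intro mult_right_mono prod_mono prod_nonneg conjI cell_wt_nonneg cell_wt_le)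
  finally show ?thesis by simp
qed

subsection \<open>Separation of difference quotients\<close>

text \<open>A mixed second difference with step \<open>s\<close> is symmetric in the two axes and
  equals \<open>s ^ 2\<close> times either mixed derivative at a point within \<open>2 * s\<close>
  of \<open>x\<close>; continuity at \<open>x\<close> identifies the two.\<close>

lemma partial_commute:
  fixes f :: "real ^ 'n::finite \<Rightarrow> real"
  assumes "C_class 2 f"
  shows "partial i (partial j f) x = partial j (partial i f) x"
proof (rule ccontr)
  let ?a = "partial i (partial j f)" and ?b = "partial j (partial i f)"
  assume ne: "?a x \<noteq> ?b x"
  have C: "C_class (Suc (Suc 0)) f" using assms by (simp add: numeral_2_eq_2)
  have d1: "f differentiable (at y)" for y using C by (rule C_class_differentiable)
  have d2: "partial k f differentiable (at y)" for k y using C by (intro C_class_differentiable[of 0]) auto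
  have cont: "isCont (partial k (partial l f)) x" for k l
    using C by (auto simp: continuous_on_eq_continuous_at)
  have second: "\<exists>\<xi>. norm (\<xi> - x) \<le> 2 * s \<and>
      f (x + s *\<^sub>R axis l 1 + s *\<^sub>R axis k 1) - f (x + s *\<^sub>R axis l 1) - (f (x + s *\<^sub>R axis k 1) - f x)
        = s * (s * partial k (partial l f) \<xi>)" if s0: "0 < s" for s k l
  proof -
    define G where "G y = f (y + s *\<^sub>R axis k 1) - f y" for y
    have dG: "G differentiable (at y)" for y
      unfolding G_def using has_derivative_shift_diff[OF d1] by (auto simp: differentiable_def)
    obtain \<theta> where \<theta>: "0 \<le> \<theta>" "\<theta> \<le> s" "G (x + s *\<^sub>R axis l 1) - G x = s * partial l G (x + \<theta> *\<^sub>R axis l 1)"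
      by (rule partial_mvt_axis[OF dG less_imp_le[OF s0], of x l]) blast
    have "partial l G = (\<lambda>y. partial l f (y + s *\<^sub>R axis k 1) - partial l f y)"
      unfolding G_def by (rule partial_shift_diff[OF d1])
    moreover obtain \<theta>' where \<theta>': "0 \<le> \<theta>'" "\<theta>' \<le> s"
      "partial l f (x + \<theta> *\<^sub>R axis l 1 + s *\<^sub>R axis k 1) - partial l f (x + \<theta> *\<^sub>R axis l 1)
        = s * partial k (partial l f) (x + \<theta> *\<^sub>R axis l 1 + \<theta>' *\<^sub>R axis k 1)"
      by (rule partial_mvt_axis[OF d2 less_imp_le[OF s0], of l "x + \<theta> *\<^sub>R axis l 1" k]) blast
    moreover have "norm (x + \<theta> *\<^sub>R axis l 1 + \<theta>' *\<^sub>R axis k 1 - x) \<le> 2 * s"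
    proof -
      have "norm (\<theta> *\<^sub>R axis l 1 + \<theta>' *\<^sub>R axis k 1 :: real ^ 'n) \<le> \<theta> + \<theta>'"
        using \<theta> \<theta>' by (intro order_trans[OF norm_triangle_ineq]) simp
      also have "\<dots> \<le> 2 * s" using \<theta>(2) \<theta>'(2) by simp
      finally show ?thesis by (simp add: add.assoc)
    qed
    ultimately show ?thesis using \<theta>(3) unfolding G_def
      by (intro exI[of _ "x + \<theta> *\<^sub>R axis l 1 + \<theta>' *\<^sub>R axis k 1"]) simp
  qed
  define e where "e = \<bar>?a x - ?b x\<bar> / 2"
  have e: "e > 0" using ne by (simp add: e_def)
  obtain r1 where r1: "r1 > 0" "\<And>y. dist y x < r1 \<Longrightarrow> dist (?a y) (?a x) < e"
    using cont[of i j] e unfolding continuous_at_eps_delta by metis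
  obtain r2 where r2: "r2 > 0" "\<And>y. dist y x < r2 \<Longrightarrow> dist (?b y) (?b x) < e"
    using cont[of j i] e unfolding continuous_at_eps_delta by metis
  define s where "s = min r1 r2 / 3"
  have s: "s > 0" "2 * s < r1" "2 * s < r2" using r1(1) r2(1) by (auto simp: s_def min_def)
  obtain \<xi> where \<xi>: "norm (\<xi> - x) \<le> 2 * s"
    "f (x + s *\<^sub>R axis j 1 + s *\<^sub>R axis i 1) - f (x + s *\<^sub>R axis j 1) - (f (x + s *\<^sub>R axis i 1) - f x) = s * (s * ?a \<xi>)"
    using second[OF s(1)] by blast
  obtain \<eta> where \<eta>: "norm (\<eta> - x) \<le> 2 * s"
    "f (x + s *\<^sub>R axis i 1 + s *\<^sub>R axis j 1) - f (x + s *\<^sub>R axis i 1) - (f (x + s *\<^sub>R axis j 1) - f x) = s * (s * ?b \<eta>)"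
    using second[OF s(1)] by blast
  have comm: "x + s *\<^sub>R axis i 1 + s *\<^sub>R axis j 1 = x + s *\<^sub>R axis j 1 + s *\<^sub>R axis i 1"
    by (simp add: add.assoc add.commute)
  have "s * (s * ?a \<xi>) = s * (s * ?b \<eta>)"
    unfolding \<xi>(2)[symmetric] \<eta>(2)[symmetric] comm by simp
  then have "?a \<xi> = ?b \<eta>" using s by simp
  moreover have "dist (?a \<xi>) (?a x) < e" "dist (?b \<eta>) (?b x) < e"
    using r1(2)[of \<xi>] r2(2)[of \<eta>] \<xi>(1) \<eta>(1) s by (auto simp: dist_norm)
  ultimately show False by (simp add: e_def dist_real_def abs_if split: if_splits)
qed

text \<open>If \<open>v\<close> spans the kernel and \<open>v $ i \<noteq> 0\<close>, the index
  \<open>i\<close> can be omitted. By symmetry \<open>v\<close> is orthogonal to the image, so once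
  all entries of \<open>H *v w\<close> other than that at \<open>i\<close> vanish, this one vanishes
  as well; then \<open>w\<close> is a multiple of \<open>v\<close> with
  \<open>w $ i = 0\<close>.\<close>

lemma symmetric_corank_one_minor:
  fixes H :: "real ^ 'n::finite ^ 'n"
  assumes sym: "transpose H = H" and rk: "rank H \<ge> CARD('n) - 1"
  obtains I where "card (- I) \<le> 1"
    "\<And>v. (\<And>i. i \<notin> I \<Longrightarrow> v $ i = 0) \<Longrightarrow> (\<And>i. i \<in> I \<Longrightarrow> (H *v v) $ i = 0) \<Longrightarrow> v = 0"
proof (cases "\<forall>v. H *v v = 0 \<longrightarrow> v = 0")
  case True
  then show ?thesis by (intro that[of UNIV]) (auto simp: vec_eq_iff)
next
  case False
  then obtain v where v: "H *v v = 0" "v \<noteq> 0" by blast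
  then obtain i where i: "v $ i \<noteq> 0" by (auto simp: vec_eq_iff)
  have adj: "x \<bullet> (H *v y) = (H *v x) \<bullet> y" for x y
    using dot_lmul_matrix[of x H y] sym by (metis transpose_matrix_vector)
  define W where "W = {x. H *v x = 0}"
  have "dim {y \<in> UNIV. \<forall>x\<in>W. orthogonal x y} + dim W = dim (UNIV :: (real ^ 'n) set)"
    by (rule dim_subspace_orthogonal_to_vectors)
       (auto simp: W_def subspace_def matrix_vector_right_distrib linear_scale[OF matrix_vector_mul_linear])
  \<comment> \<open>By symmetry the image is orthogonal to the kernel, which turns the rank
    condition into a bound for the dimension of the kernel.\<close>
  moreover have "range ((*v) H) \<subseteq> {y \<in> UNIV. \<forall>x\<in>W. orthogonal x y}"
    by (auto simp: W_def orthogonal_def adj)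
  then have "rank H \<le> dim {y \<in> UNIV. \<forall>x\<in>W. orthogonal x y}"
    unfolding rank_dim_range by (rule dim_subset)
  ultimately have dimW: "dim W \<le> 1" using rk by simp
  \<comment> \<open>The kernel is spanned by \<open>v\<close>, so omitting an index in the support of \<open>v\<close> removes it.\<close>
  have ker: "w \<in> span {v}" if "w \<in> W" for w
  proof (rule ccontr)
    assume w: "w \<notin> span {v}"
    have "independent {w, v}" using v w by (simp add: independent_insert)
    then have "card {w, v} \<le> dim W"
      using that v by (intro independent_card_le_dim) (auto simp: W_def)
    moreover have "w \<noteq> v" using w span_base[of v "{v}"] by auto
    ultimately show False using dimW by simp
  qed
  show ?thesis
  proof (rule that[of "- {i}"])
    fix w assume w: "\<And>k. k \<notin> - {i} \<Longrightarrow> w $ k = 0" "\<And>k. k \<in> - {i} \<Longrightarrow> (H *v w) $ k = 0"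
    have "0 = v \<bullet> (H *v w)" by (simp add: adj v)
    also have "\<dots> = (\<Sum>k\<in>UNIV. v $ k * (H *v w) $ k)" by (simp add: inner_vec_def)
    also have "\<dots> = (\<Sum>k\<in>UNIV. if k = i then v $ i * (H *v w) $ i else 0)"
      using w(2) by (intro sum.cong) auto
    finally have "(H *v w) $ i = 0" using i by simp
    then have "(H *v w) $ k = 0" for k using w(2)[of k] by (cases "k = i") auto
    then have "w \<in> W" by (simp add: W_def vec_eq_iff)
    from ker[OF this] obtain c where "w = c *\<^sub>R v" by (auto simp: span_singleton)
    then show "w = 0" using w(1)[of i] i by simp
  qed simp
qed

section \<open>Nondegeneracy uniform in the coefficients \<open>t\<close>\<close>

lemma hessian_sum:
  fixes f :: "'r::finite \<Rightarrow> real ^ 'n::finite \<Rightarrow> real"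
  assumes "\<And>j. C_class 2 (f j)"
  shows "hessian (\<lambda>x. \<Sum>j\<in>UNIV. t $ j * f j x) x $ i $ k = (\<Sum>j\<in>UNIV. t $ j * hessian (f j) x $ i $ k)"
proof -
  have d1: "f j differentiable (at y)" for j y
    using assms[of j] by (intro C_class_differentiable[of 1]) (simp add: numeral_2_eq_2)
  have d2: "partial k (f j) differentiable (at y)" for k j y
    using assms[of j] by (intro C_class_differentiable[of 0]) (simp add: numeral_2_eq_2)
  show ?thesis by (simp add: hessian_def partial_sum[OF d1] partial_sum[OF d2])
qed

text \<open>Compactness, where \<open>I\<close> may depend on \<open>t\<close> but
  \<open>\<kappa>\<close> may not. A sequence of failures is normalised, both sides being
  homogeneous of degree 1 in \<open>t\<close> and in \<open>v\<close>. The index set is read off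
  from the limit of the coefficients and then kept fixed for the vectors, whose limit contradicts
  the nonsingular minor.\<close>

lemma uniform_nondegeneracy:
  fixes f :: "'r::finite \<Rightarrow> real ^ 'n::finite \<Rightarrow> real" and x0 :: "real ^ 'n"
  assumes C: "\<And>j. C_class 2 (f j)"
    and rk: "\<And>t :: real ^ 'r. t \<noteq> 0 \<Longrightarrow> rank (hessian (\<lambda>x. \<Sum>j\<in>UNIV. t $ j * f j x) x0) \<ge> CARD('n) - 1"
  obtains \<kappa> where "\<kappa> > 0" "\<And>t :: real ^ 'r. \<exists>I. card (- I) \<le> 1 \<and> (\<forall>v. (\<forall>i. i \<notin> I \<longrightarrow> v $ i = 0) \<longrightarrow>
      \<kappa> * norm t * norm v \<le> (\<Sum>i\<in>I. \<bar>\<Sum>k\<in>UNIV. (\<Sum>j\<in>UNIV. t $ j * hessian (f j) x0 $ i $ k) * v $ k\<bar>))"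
proof -
  define h where "h t v i = (\<Sum>k\<in>UNIV. (\<Sum>j\<in>UNIV. t $ j * hessian (f j) x0 $ i $ k) * v $ k)"
    for t :: "real ^ 'r" and v :: "real ^ 'n" and i
  have hscale: "h (a *\<^sub>R t) (b *\<^sub>R v) i = a * b * h t v i" for a b t v i
    by (simp add: h_def sum_distrib_left sum_distrib_right mult_ac)
  have hH: "h t v i = (hessian (\<lambda>x. \<Sum>j\<in>UNIV. t $ j * f j x) x0 *v v) $ i" for t v i
    by (simp add: h_def matrix_vector_mult_def hessian_sum[OF C])
  have "\<exists>\<kappa>>0. \<forall>t. \<exists>I. card (- I) \<le> 1 \<and>
    (\<forall>v. (\<forall>i. i \<notin> I \<longrightarrow> v $ i = 0) \<longrightarrow> \<kappa> * norm t * norm v \<le> (\<Sum>i\<in>I. \<bar>h t v i\<bar>))"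
  proof (rule ccontr)
    define P where "P \<kappa> t I \<longleftrightarrow> card (- I) \<le> 1 \<and>
      (\<forall>v. (\<forall>i. i \<notin> I \<longrightarrow> v $ i = 0) \<longrightarrow> \<kappa> * norm t * norm v \<le> (\<Sum>i\<in>I. \<bar>h t v i\<bar>))" for \<kappa> t I
    assume "\<not> ?thesis"
    then have neg: "\<exists>t. \<forall>I. \<not> P \<kappa> t I" if "\<kappa> > 0" for \<kappa>
      using that unfolding P_def by blast
    have "\<exists>t. \<forall>I. \<not> P (1 / real (Suc m)) t I" for m by (rule neg) simp
    \<comment> \<open>\<open>T m\<close> fails for every \<open>I\<close> at once, because the right
      \<open>I\<close> is known only after the limit has been taken.\<close>
    then obtain T where nP: "\<And>m I. \<not> P (1 / real (Suc m)) (T m) I" by metis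
    have T: "\<exists>v. (\<forall>i. i \<notin> I \<longrightarrow> v $ i = 0) \<and> (\<Sum>i\<in>I. \<bar>h (T m) v i\<bar>) < 1 / real (Suc m) * norm (T m) * norm v"
      if "card (- I) \<le> 1" for m I
      using nP[of m I] that unfolding P_def not_le[symmetric] by blast
    have lt: "norm (T m) > 0 \<and> norm v > 0" if "(\<Sum>i\<in>I. \<bar>h (T m) v i\<bar>) < 1 / real (Suc m) * norm (T m) * norm v" for m v I
    proof -
      have "0 \<le> (\<Sum>i\<in>I. \<bar>h (T m) v i\<bar>)" by (intro sum_nonneg) auto
      then have "0 < 1 / real (Suc m) * norm (T m) * norm v" using that by linarith
      then show ?thesis by (auto simp: zero_less_mult_iff zero_less_divide_iff)
    qed
    define U where "U m = T m /\<^sub>R norm (T m)" for m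
    have T0: "norm (T m) > 0" for m using T[of UNIV m] lt by auto
    have U: "\<exists>v. norm v = 1 \<and> (\<forall>i. i \<notin> I \<longrightarrow> v $ i = 0) \<and> (\<Sum>i\<in>I. \<bar>h (U m) v i\<bar>) < 1 / real (Suc m)"
      if I: "card (- I) \<le> 1" for m I
    proof -
      obtain v where v: "\<forall>i. i \<notin> I \<longrightarrow> v $ i = 0" "(\<Sum>i\<in>I. \<bar>h (T m) v i\<bar>) < 1 / real (Suc m) * norm (T m) * norm v"
        using T[OF I] by blast
      have v0: "norm v > 0" using lt[OF v(2)] by simp
      have "h (U m) (v /\<^sub>R norm v) i = h (T m) v i / (norm (T m) * norm v)" for i
        unfolding U_def hscale by (simp add: field_simps)
      then have "(\<Sum>i\<in>I. \<bar>h (U m) (v /\<^sub>R norm v) i\<bar>) = (\<Sum>i\<in>I. \<bar>h (T m) v i\<bar>) / (norm (T m) * norm v)"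
        by (simp add: sum_divide_distrib)
      also have "\<dots> < 1 / real (Suc m)"
        using v(2) v0 T0[of m] by (simp add: pos_divide_less_eq)
      finally show ?thesis using v(1) v0 by (intro exI[of _ "v /\<^sub>R norm v"]) auto
    qed
    have "\<forall>m. U m \<in> sphere 0 1" using T0 by (simp add: U_def)
    then obtain t r where t: "t \<in> sphere 0 1" "strict_mono r" "(U \<circ> r) \<longlonglongrightarrow> t"
      using compact_sphere[of "0 :: real ^ 'r" 1] unfolding compact_def by metis
    have "t \<noteq> 0" using t(1) by auto
    have sym: "transpose (hessian (\<lambda>x. \<Sum>j\<in>UNIV. t $ j * f j x) x0) = hessian (\<lambda>x. \<Sum>j\<in>UNIV. t $ j * f j x) x0"
      by (simp add: vec_eq_iff transpose_def hessian_sum[OF C]) (simp add: hessian_def partial_commute[OF C])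
    obtain I where I: "card (- I) \<le> 1"
      "\<And>v. (\<And>i. i \<notin> I \<Longrightarrow> v $ i = 0) \<Longrightarrow> (\<And>i. i \<in> I \<Longrightarrow> h t v i = 0) \<Longrightarrow> v = 0"
      unfolding hH by (rule symmetric_corank_one_minor[OF sym rk[OF \<open>t \<noteq> 0\<close>]]) blast
    obtain V where V: "\<And>m. norm (V m) = 1" "\<And>m i. i \<notin> I \<Longrightarrow> V m $ i = 0"
      "\<And>m. (\<Sum>i\<in>I. \<bar>h (U m) (V m) i\<bar>) < 1 / real (Suc m)"
      using U[OF I(1)] by metis
    have "\<forall>m. (V \<circ> r) m \<in> sphere 0 1" using V(1) by simp
    then obtain v r' where v: "v \<in> sphere 0 1" "strict_mono r'" "((V \<circ> r) \<circ> r') \<longlonglongrightarrow> v"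
      using compact_sphere[of "0 :: real ^ 'n" 1] unfolding compact_def by metis
    define g where "g m = r (r' m)" for m
    have g: "strict_mono g" using strict_mono_o[OF t(2) v(2)] by (simp add: g_def[abs_def] o_def)
    have limV: "(\<lambda>m. V (g m)) \<longlonglongrightarrow> v" using v(3) by (simp add: g_def o_def)
    have limU: "(\<lambda>m. U (g m)) \<longlonglongrightarrow> t"
      using LIMSEQ_subseq_LIMSEQ[OF t(3) v(2)] by (simp add: g_def o_def)
    have "(\<lambda>m. \<Sum>i\<in>I. \<bar>h (U (g m)) (V (g m)) i\<bar>) \<longlonglongrightarrow> (\<Sum>i\<in>I. \<bar>h t v i\<bar>)"
      unfolding h_def by (intro tendsto_intros tendsto_vec_nth limU limV)
    moreover have "(\<lambda>m. \<Sum>i\<in>I. \<bar>h (U (g m)) (V (g m)) i\<bar>) \<longlonglongrightarrow> 0"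
    proof (rule tendsto_sandwich[OF _ _ tendsto_const])
      show "\<forall>\<^sub>F m in sequentially. 0 \<le> (\<Sum>i\<in>I. \<bar>h (U (g m)) (V (g m)) i\<bar>)"
        by (intro always_eventually allI sum_nonneg) auto
      show "\<forall>\<^sub>F m in sequentially. (\<Sum>i\<in>I. \<bar>h (U (g m)) (V (g m)) i\<bar>) \<le> 1 / real (Suc m)"
      proof (intro always_eventually allI)
        fix m
        have "(\<Sum>i\<in>I. \<bar>h (U (g m)) (V (g m)) i\<bar>) \<le> 1 / real (Suc (g m))" using V(3) by (rule less_imp_le)
        also have "\<dots> \<le> 1 / real (Suc m)" using seq_suble[OF g, of m] by (intro divide_left_mono) auto
        finally show "(\<Sum>i\<in>I. \<bar>h (U (g m)) (V (g m)) i\<bar>) \<le> 1 / real (Suc m)" .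
      qed
      show "(\<lambda>m. 1 / real (Suc m)) \<longlonglongrightarrow> 0" by (rule LIMSEQ_Suc[OF lim_1_over_n])
    qed
    ultimately have "(\<Sum>i\<in>I. \<bar>h t v i\<bar>) = 0" by (rule LIMSEQ_unique)
    then have "h t v i = 0" if "i \<in> I" for i using that by (simp add: sum_nonneg_eq_0_iff)
    moreover have "v $ i = 0" if "i \<notin> I" for i
      using tendsto_vec_nth[OF limV, of i] V(2)[OF that] by (simp add: LIMSEQ_const_iff)
    ultimately have "v = 0" using I(2) by blast
    then show False using v(1) by simp
  qed
  then show ?thesis using that unfolding h_def by blast
qed

text \<open>By the mean value theorem a difference of two quotients is a row of second derivatives
  applied to \<open>x - y\<close>, at intermediate points that vary with row and column. Since no
  single Hessian represents it, every entry is compared with the one at \<open>x0\<close>, at a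
  total cost of half the main term. Lowering the upper corner by \<open>s\<close> keeps the shifted
  points in the box.\<close>

lemma difference_quotient_separation:
  fixes f :: "'r::finite \<Rightarrow> real ^ 'n::finite \<Rightarrow> real" and x0 :: "real ^ 'n"
  assumes C: "\<And>j. C_class 2 (f j)"
    and rk: "\<And>t :: real ^ 'r. t \<noteq> 0 \<Longrightarrow> rank (hessian (\<lambda>x. \<Sum>j\<in>UNIV. t $ j * f j x) x0) \<ge> CARD('n) - 1"
  obtains \<kappa> \<rho> where "\<kappa> > 0" "\<rho> > 0"
    "\<And>t :: real ^ 'r. \<exists>I. card (- I) \<le> 1 \<and> (\<forall>x y s. 0 < s \<longrightarrow>
      x \<in> cbox (x0 - \<rho> *\<^sub>R 1) (x0 + (\<rho> - s) *\<^sub>R 1) \<longrightarrow> y \<in> cbox (x0 - \<rho> *\<^sub>R 1) (x0 + (\<rho> - s) *\<^sub>R 1) \<longrightarrow>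
      (\<forall>i. i \<notin> I \<longrightarrow> x $ i = y $ i) \<longrightarrow>
      \<kappa> * norm t * norm (x - y) \<le> (\<Sum>i\<in>I. \<bar>((\<Sum>j\<in>UNIV. t $ j * f j (x + s *\<^sub>R axis i 1)) - (\<Sum>j\<in>UNIV. t $ j * f j x)) / s
        - ((\<Sum>j\<in>UNIV. t $ j * f j (y + s *\<^sub>R axis i 1)) - (\<Sum>j\<in>UNIV. t $ j * f j y)) / s\<bar>))"
proof -
  obtain \<kappa> where \<kappa>: "\<kappa> > 0" "\<And>t :: real ^ 'r. \<exists>I. card (- I) \<le> 1 \<and> (\<forall>v. (\<forall>i. i \<notin> I \<longrightarrow> v $ i = 0) \<longrightarrow>
      \<kappa> * norm t * norm v \<le> (\<Sum>i\<in>I. \<bar>\<Sum>k\<in>UNIV. (\<Sum>j\<in>UNIV. t $ j * hessian (f j) x0 $ i $ k) * v $ k\<bar>))"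
    using uniform_nondegeneracy[OF C rk] by blast
  \<comment> \<open>At most \<open>n\<close> rows of \<open>n\<close> entries, each off by
    \<open>CARD('r) * \<omega> * norm t\<close>: the total error is half of
    \<open>\<kappa> * norm t * norm (x - y)\<close>.\<close>
  define \<omega> where "\<omega> = \<kappa> / (2 * (real CARD('n) * real CARD('n) * real CARD('r)))"
  have \<omega>: "\<omega> > 0" using \<kappa>(1) by (simp add: \<omega>_def)
  have C2: "C_class (Suc (Suc 0)) (f j)" for j using C[of j] by (simp add: numeral_2_eq_2)
  have "isCont (partial i (partial k (f j))) x0" for i k j
    using C2[of j] by (auto simp: continuous_on_eq_continuous_at)
  then have "\<forall>i k j. \<exists>d>0. \<forall>y. dist y x0 < d \<longrightarrow> dist (partial i (partial k (f j)) y) (partial i (partial k (f j)) x0) < \<omega>"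
    using \<omega> unfolding continuous_at_eps_delta by blast
  then obtain d where d: "\<And>i k j. d i k j > 0"
    "\<And>i k j y. dist y x0 < d i k j \<Longrightarrow> dist (partial i (partial k (f j)) y) (partial i (partial k (f j)) x0) < \<omega>"
    by metis
  define d0 where "d0 = Min (range (\<lambda>(i, k, j). d i k j))"
  have d0: "d0 > 0" unfolding d0_def using d(1) by (subst Min_gr_iff) auto
  have d0le: "d0 \<le> d i k j" for i k j unfolding d0_def by (intro Min_le) (auto intro!: image_eqI[of _ _ "(i, k, j)"])
  \<comment> \<open>The Euclidean norm is at most the sum of the \<open>n\<close> absolute
    coordinates, so the box of radius \<open>\<rho>\<close> stays within \<open>d0 / 2\<close> of
    \<open>x0\<close>.\<close>
  define \<rho> where "\<rho> = d0 / (2 * real CARD('n))"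
  have \<rho>: "\<rho> > 0" using d0 by (simp add: \<rho>_def)
  have near: "\<bar>partial i (partial k (f j)) y - hessian (f j) x0 $ i $ k\<bar> \<le> \<omega>"
    if y: "y \<in> cbox (x0 - \<rho> *\<^sub>R 1) (x0 + \<rho> *\<^sub>R 1)" for y i k j
  proof -
    have "norm (y - x0) \<le> (\<Sum>i\<in>UNIV. \<bar>(y - x0) $ i\<bar>)" by (rule norm_le_l1_cart)
    also have "\<dots> \<le> (\<Sum>i\<in>(UNIV::'n set). \<rho>)"
      using y by (intro sum_mono) (auto simp: mem_box_cart abs_le_iff algebra_simps)
    also have "\<dots> = d0 / 2" by (simp add: \<rho>_def)
    finally have "dist y x0 < d i k j" using d0 d0le[of i k j] by (simp add: dist_norm)
    from d(2)[OF this] show ?thesis by (simp add: hessian_def dist_real_def)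
  qed
  have main: "\<kappa> / 2 * norm t * norm (x - y) \<le> (\<Sum>i\<in>I. \<bar>(F (x + s *\<^sub>R axis i 1) - F x) / s - (F (y + s *\<^sub>R axis i 1) - F y) / s\<bar>)"
    if F: "F = (\<lambda>x. \<Sum>j\<in>UNIV. t $ j * f j x)" and s: "0 < s"
      and x: "x \<in> cbox (x0 - \<rho> *\<^sub>R 1) (x0 + (\<rho> - s) *\<^sub>R 1)" and y: "y \<in> cbox (x0 - \<rho> *\<^sub>R 1) (x0 + (\<rho> - s) *\<^sub>R 1)"
      and low: "\<kappa> * norm t * norm (x - y) \<le> (\<Sum>i\<in>I. \<bar>\<Sum>k\<in>UNIV. (\<Sum>j\<in>UNIV. t $ j * hessian (f j) x0 $ i $ k) * (x - y) $ k\<bar>)"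
    for t :: "real ^ 'r" and F x y s and I :: "'n set"
  proof -
    have CF: "C_class (Suc (Suc 0)) F" unfolding F by (intro C_class_sum C2)
    have dF: "F differentiable (at z)" for z using CF by (rule C_class_differentiable)
    have dpF: "partial k F differentiable (at z)" for k z using CF by (intro C_class_differentiable[of 0]) auto
    have df: "f j differentiable (at z)" for j z using C2 by (rule C_class_differentiable)
    have dpf: "partial k (f j) differentiable (at z)" for j k z using C2[of j] by (intro C_class_differentiable[of 0]) auto
    define H where "H i k = (\<Sum>j\<in>UNIV. t $ j * hessian (f j) x0 $ i $ k)" for i k
    have nearF: "\<bar>partial i (partial k F) z - H i k\<bar> \<le> real CARD('r) * \<omega> * norm t"
      if z: "z \<in> cbox (x0 - \<rho> *\<^sub>R 1) (x0 + \<rho> *\<^sub>R 1)" for i k z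
    proof -
      have "partial i (partial k F) z - H i k
          = (\<Sum>j\<in>UNIV. t $ j * (partial i (partial k (f j)) z - hessian (f j) x0 $ i $ k))"
        unfolding F H_def partial_sum[OF df] partial_sum[OF dpf] by (simp add: sum_subtractf right_diff_distrib)
      also have "\<bar>\<dots>\<bar> \<le> (\<Sum>j\<in>(UNIV :: 'r set). norm t * \<omega>)"
        unfolding abs_mult by (intro order_trans[OF sum_abs] sum_mono)
          (auto simp: abs_mult intro!: mult_mono near z component_le_norm_cart)
      finally show ?thesis by (simp add: mult_ac)
    qed
    have each: "\<bar>\<Sum>k\<in>UNIV. H i k * (x - y) $ k\<bar> \<le> \<bar>(F (x + s *\<^sub>R axis i 1) - F x) / s - (F (y + s *\<^sub>R axis i 1) - F y) / s\<bar>
        + real CARD('n) * (real CARD('r) * \<omega> * norm t * norm (x - y))" for i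
    proof -
      define G where "G z = F (z + s *\<^sub>R axis i 1) - F z" for z
      have dG: "G differentiable (at z)" for z
        unfolding G_def using has_derivative_shift_diff[OF dF] by (auto simp: differentiable_def)
      obtain \<xi> where \<xi>: "\<xi> \<in> closed_segment y x" "G x - G y = (\<Sum>k\<in>UNIV. partial k G \<xi> * (x - y) $ k)"
        using partial_mvt[OF dG] by blast
      have \<xi>box: "\<xi> \<in> cbox (x0 - \<rho> *\<^sub>R 1) (x0 + (\<rho> - s) *\<^sub>R 1)"
        using \<xi>(1) x y closed_segment_subset[OF y x convex_box(1)] by blast
      have "\<exists>z. partial k G \<xi> = s * partial i (partial k F) z \<and> z \<in> cbox (x0 - \<rho> *\<^sub>R 1) (x0 + \<rho> *\<^sub>R 1)" for k
      proof -
        have pG: "partial k G \<xi> = partial k F (\<xi> + s *\<^sub>R axis i 1) - partial k F \<xi>"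
          unfolding G_def partial_shift_diff[OF dF] by simp
        obtain \<theta> where \<theta>: "0 \<le> \<theta>" "\<theta> \<le> s"
          "partial k F (\<xi> + s *\<^sub>R axis i 1) - partial k F \<xi> = s * partial i (partial k F) (\<xi> + \<theta> *\<^sub>R axis i 1)"
          by (rule partial_mvt_axis[OF dpF less_imp_le[OF s], of k \<xi> i]) blast
        have "\<xi> + \<theta> *\<^sub>R axis i 1 \<in> cbox (x0 - \<rho> *\<^sub>R 1) (x0 + \<rho> *\<^sub>R 1)"
          unfolding mem_box_cart
        proof
          fix l
          have "(x0 - \<rho> *\<^sub>R 1) $ l \<le> \<xi> $ l" "\<xi> $ l \<le> x0 $ l + (\<rho> - s)"
            using \<xi>box by (auto simp: mem_box_cart)
          then show "(x0 - \<rho> *\<^sub>R 1) $ l \<le> (\<xi> + \<theta> *\<^sub>R axis i 1) $ l \<and> (\<xi> + \<theta> *\<^sub>R axis i 1) $ l \<le> (x0 + \<rho> *\<^sub>R 1) $ l"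
            using \<theta>(1,2) s by (cases "l = i") (auto simp: axis_def)
        qed
        then show ?thesis using pG \<theta>(3) by auto
      qed
      then obtain z where z: "\<And>k. partial k G \<xi> = s * partial i (partial k F) (z k)"
        "\<And>k. z k \<in> cbox (x0 - \<rho> *\<^sub>R 1) (x0 + \<rho> *\<^sub>R 1)" by metis
      have "(F (x + s *\<^sub>R axis i 1) - F x) / s - (F (y + s *\<^sub>R axis i 1) - F y) / s = (G x - G y) / s"
        by (simp add: G_def diff_divide_distrib)
      also have "\<dots> = (\<Sum>k\<in>UNIV. partial i (partial k F) (z k) * (x - y) $ k)"
        unfolding \<xi>(2) z(1) sum_divide_distrib using s by simp
      finally have eq: "(F (x + s *\<^sub>R axis i 1) - F x) / s - (F (y + s *\<^sub>R axis i 1) - F y) / s = \<dots>" .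
      have "(\<Sum>k\<in>UNIV. H i k * (x - y) $ k) - (\<Sum>k\<in>UNIV. partial i (partial k F) (z k) * (x - y) $ k)
          = (\<Sum>k\<in>UNIV. (H i k - partial i (partial k F) (z k)) * (x - y) $ k)"
        by (simp add: sum_subtractf left_diff_distrib)
      also have "\<bar>\<dots>\<bar> \<le> (\<Sum>k\<in>(UNIV :: 'n set). (real CARD('r) * \<omega> * norm t) * norm (x - y))"
      proof (intro order_trans[OF sum_abs] sum_mono)
        fix k
        have "\<bar>H i k - partial i (partial k F) (z k)\<bar> \<le> real CARD('r) * \<omega> * norm t"
          using nearF[OF z(2), of i k] by (simp add: abs_minus_commute)
        then show "\<bar>(H i k - partial i (partial k F) (z k)) * (x - y) $ k\<bar> \<le> (real CARD('r) * \<omega> * norm t) * norm (x - y)"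
          unfolding abs_mult by (intro mult_mono component_le_norm_cart) (use \<omega> in auto)
      qed
      finally show ?thesis unfolding eq by simp
    qed
    have cI: "real (card I) \<le> real CARD('n)" by (simp add: card_mono)
    have "\<kappa> * norm t * norm (x - y) \<le> (\<Sum>i\<in>I. \<bar>\<Sum>k\<in>UNIV. H i k * (x - y) $ k\<bar>)"
      using low by (simp add: H_def)
    also have "\<dots> \<le> (\<Sum>i\<in>I. \<bar>(F (x + s *\<^sub>R axis i 1) - F x) / s - (F (y + s *\<^sub>R axis i 1) - F y) / s\<bar>
        + real CARD('n) * (real CARD('r) * \<omega> * norm t * norm (x - y)))"
      by (intro sum_mono each)
    also have "\<dots> = (\<Sum>i\<in>I. \<bar>(F (x + s *\<^sub>R axis i 1) - F x) / s - (F (y + s *\<^sub>R axis i 1) - F y) / s\<bar>)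
        + real (card I) * (real CARD('n) * (real CARD('r) * \<omega> * norm t * norm (x - y)))"
      by (simp add: sum.distrib)
    also have "real (card I) * (real CARD('n) * (real CARD('r) * \<omega> * norm t * norm (x - y)))
        \<le> real CARD('n) * (real CARD('n) * (real CARD('r) * \<omega> * norm t * norm (x - y)))"
      using \<omega> by (intro mult_right_mono cI) auto
    also have "\<dots> = \<kappa> / 2 * norm t * norm (x - y)" by (simp add: \<omega>_def)
    finally show ?thesis by simp
  qed
  show ?thesis
  proof (rule that[of "\<kappa> / 2" \<rho>])
    fix t :: "real ^ 'r"
    obtain I where I: "card (- I) \<le> 1" "\<And>v. (\<forall>i. i \<notin> I \<longrightarrow> v $ i = 0) \<Longrightarrow>
      \<kappa> * norm t * norm v \<le> (\<Sum>i\<in>I. \<bar>\<Sum>k\<in>UNIV. (\<Sum>j\<in>UNIV. t $ j * hessian (f j) x0 $ i $ k) * v $ k\<bar>)"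
      using \<kappa>(2) by blast
    show "\<exists>I. card (- I) \<le> 1 \<and> (\<forall>x y s. 0 < s \<longrightarrow>
      x \<in> cbox (x0 - \<rho> *\<^sub>R 1) (x0 + (\<rho> - s) *\<^sub>R 1) \<longrightarrow> y \<in> cbox (x0 - \<rho> *\<^sub>R 1) (x0 + (\<rho> - s) *\<^sub>R 1) \<longrightarrow>
      (\<forall>i. i \<notin> I \<longrightarrow> x $ i = y $ i) \<longrightarrow>
      \<kappa> / 2 * norm t * norm (x - y) \<le> (\<Sum>i\<in>I. \<bar>((\<Sum>j\<in>UNIV. t $ j * f j (x + s *\<^sub>R axis i 1)) - (\<Sum>j\<in>UNIV. t $ j * f j x)) / s
        - ((\<Sum>j\<in>UNIV. t $ j * f j (y + s *\<^sub>R axis i 1)) - (\<Sum>j\<in>UNIV. t $ j * f j y)) / s\<bar>))"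
      using I(1) by (intro exI[of _ I] conjI allI impI main[OF refl] I(2)) auto
  qed (use \<kappa>(1) \<rho> in auto)
qed

subsection \<open>The exponential sum bound\<close>

lemma partials_bounded:
  fixes f :: "'r::finite \<Rightarrow> real ^ 'n::finite \<Rightarrow> real"
  assumes "\<And>j. C_class m (f j)"
  obtains B where "B \<ge> 0" "\<And>L j y. length L \<le> m \<Longrightarrow> y \<in> cbox a b \<Longrightarrow> \<bar>partials L (f j) y\<bar> \<le> B"
proof -
  let ?S = "\<Union>L\<in>{L. length L \<le> m}. \<Union>j. partials L (f j) ` cbox a b"
  have "finite {L :: 'n list. length L \<le> m}"
    using finite_lists_length_le[OF finite[of "UNIV :: 'n set"], of m] by simp
  moreover have "bounded (partials L (f j) ` cbox a b)" if "length L \<le> m" for L j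
  proof -
    have "C_class (0 + length L) (f j)" using assms that by (auto intro: C_class_mono)
    then have "C_class 0 (partials L (f j))" by (rule C_class_partials)
    then have "continuous_on (cbox a b) (partials L (f j))" by (auto intro: continuous_on_subset)
    then show ?thesis by (intro compact_imp_bounded compact_continuous_image compact_cbox)
  qed
  ultimately have "bounded ?S" by (auto intro!: bounded_UN)
  then obtain B where "\<forall>y\<in>?S. norm y \<le> B" unfolding bounded_iff by (rule exE)
  then have B: "\<And>y. y \<in> ?S \<Longrightarrow> norm y \<le> B" by (rule bspec)
  show ?thesis
  proof (rule that[of "max B 0"])
    fix L :: "'n list" and j y assume "length L \<le> m" "y \<in> cbox a b"
    then have "norm (partials L (f j) y) \<le> B" by (intro B) auto
    then show "\<bar>partials L (f j) y\<bar> \<le> max B 0" by simp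
  qed simp
qed

lemma sum_box_decompose:
  fixes g :: "('n::finite \<Rightarrow> nat) \<Rightarrow> 'a::comm_monoid_add"
  assumes "N \<ge> 1"
  shows "(\<Sum>c\<in>PiE UNIV (\<lambda>_. {..<K * N}). g c)
    = (\<Sum>k\<in>PiE UNIV (\<lambda>_. {..<K}). \<Sum>h\<in>PiE UNIV (\<lambda>_. {..<N}). g (\<lambda>i. N * k i + h i))"
  unfolding sum.cartesian_product
proof (rule sum.reindex_bij_witness[of _ "\<lambda>(k, h) i. N * k i + h i" "\<lambda>c. (\<lambda>i. c i div N, \<lambda>i. c i mod N)"])
  fix c :: "'n \<Rightarrow> nat" assume "c \<in> PiE UNIV (\<lambda>_. {..<K * N})"
  then have "c i < K * N" for i by auto
  then show "(\<lambda>i. c i div N, \<lambda>i. c i mod N) \<in> PiE UNIV (\<lambda>_. {..<K}) \<times> PiE UNIV (\<lambda>_. {..<N})"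
    using assms by (auto simp: PiE_iff less_mult_imp_div_less)
next
  fix p :: "('n \<Rightarrow> nat) \<times> ('n \<Rightarrow> nat)"
  assume "p \<in> PiE UNIV (\<lambda>_. {..<K}) \<times> PiE UNIV (\<lambda>_. {..<N})"
  then obtain k h where p: "p = (k, h)" "\<And>i. k i < K" "\<And>i. h i < N" by (cases p) auto
  have "N * k i + h i < K * N" for i
  proof -
    have "N * k i + h i < N * Suc (k i)" using p(3)[of i] by simp
    also have "\<dots> \<le> N * K" using p(2)[of i] by (intro mult_le_mono2) simp
    finally show ?thesis by (simp add: mult.commute)
  qed
  then show "(case p of (k, h) \<Rightarrow> \<lambda>i. N * k i + h i) \<in> PiE UNIV (\<lambda>_. {..<K * N})"
    by (simp add: p(1) PiE_iff)
  show "(\<lambda>i. (case p of (k, h) \<Rightarrow> \<lambda>i. N * k i + h i) i div N, \<lambda>i. (case p of (k, h) \<Rightarrow> \<lambda>i. N * k i + h i) i mod N) = p"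
    using p assms by auto
qed (auto simp: fun_eq_iff)

text \<open>Each index of \<open>I\<close> contributes \<open>J * N\<close> and a logarithm, where
  \<open>J * N \<le> sqrt (q * J)\<close> by the choice of \<open>N\<close>; an omitted index
  contributes \<open>K * N\<close>, of order at most \<open>q\<close>. The margin
  \<open>CARD('n) + 3\<close> leaves room for the differences that reach beyond the last
  box.\<close>

lemma exp_sum_bound:
  fixes f :: "'r::finite \<Rightarrow> real ^ 'n::finite \<Rightarrow> real" and x0 :: "real ^ 'n"
  assumes C: "\<And>j. C_class (max 2 CARD('n)) (f j)"
    and rk: "\<And>t :: real ^ 'r. t \<noteq> 0 \<Longrightarrow> rank (hessian (\<lambda>x. \<Sum>j\<in>UNIV. t $ j * f j x) x0) \<ge> CARD('n) - 1"
  obtains \<rho> A where "\<rho> > 0" "A > 0"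
    "\<And>(t :: real ^ 'r) q N K J x. 1 \<le> J \<Longrightarrow> J \<le> real q \<Longrightarrow> 1 \<le> N \<Longrightarrow> real N ^ 2 * J \<le> real q \<Longrightarrow>
      real q \<le> 4 * (real N ^ 2 * J) \<Longrightarrow> (\<And>j. \<bar>t $ j\<bar> \<le> J) \<Longrightarrow> 1 \<le> norm t \<Longrightarrow>
      (\<And>i. x0 $ i - \<rho> \<le> x $ i) \<Longrightarrow> (\<And>i. x $ i + (real (K * N) + real CARD('n) + 3) / real q \<le> x0 $ i + \<rho>) \<Longrightarrow>
      norm (\<Sum>c\<in>PiE UNIV (\<lambda>_. {..<K * N}). cis (2 * pi * (real q * (\<Sum>j\<in>UNIV. t $ j * f j (grid x (1 / real q) c)))))
        \<le> A * (2 + ln (real q)) ^ CARD('n) * (real q * sqrt (real q * J) ^ (CARD('n) - 1))"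
proof -
  let ?n = "CARD('n)" and ?R = "real CARD('r)"
  have C2: "C_class 2 (f j)" for j using C by (rule C_class_mono) simp
  obtain \<kappa> \<rho> where \<kappa>: "\<kappa> > 0" and \<rho>: "\<rho> > 0" and sep:
    "\<And>t :: real ^ 'r. \<exists>I. card (- I) \<le> 1 \<and> (\<forall>x y s. 0 < s \<longrightarrow>
      x \<in> cbox (x0 - \<rho> *\<^sub>R 1) (x0 + (\<rho> - s) *\<^sub>R 1) \<longrightarrow> y \<in> cbox (x0 - \<rho> *\<^sub>R 1) (x0 + (\<rho> - s) *\<^sub>R 1) \<longrightarrow>
      (\<forall>i. i \<notin> I \<longrightarrow> x $ i = y $ i) \<longrightarrow>
      \<kappa> * norm t * norm (x - y) \<le> (\<Sum>i\<in>I. \<bar>((\<Sum>j\<in>UNIV. t $ j * f j (x + s *\<^sub>R axis i 1)) - (\<Sum>j\<in>UNIV. t $ j * f j x)) / s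
        - ((\<Sum>j\<in>UNIV. t $ j * f j (y + s *\<^sub>R axis i 1)) - (\<Sum>j\<in>UNIV. t $ j * f j y)) / s\<bar>))"
    by (rule difference_quotient_separation[OF C2 rk], assumption) (rule that)
  define Box where "Box = cbox (x0 - \<rho> *\<^sub>R 1) (x0 + \<rho> *\<^sub>R 1)"
  obtain B where B: "B \<ge> 0" "\<And>L j y. length L \<le> max 2 ?n \<Longrightarrow> y \<in> Box \<Longrightarrow> \<bar>partials L (f j) y\<bar> \<le> B"
    by (rule partials_bounded[of "max 2 ?n" f "x0 - \<rho> *\<^sub>R 1" "x0 + \<rho> *\<^sub>R 1", OF C, folded Box_def]) (rule that)
  \<comment> \<open>\<open>A1\<close> is the constant of \<open>box_exp_sum_le\<close> for the
    derivative bound \<open>CARD('r) * B\<close>; \<open>A2 * J\<close> will bound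
    \<open>2 * D * p\<close>.\<close>
  define A1 where "A1 = 2 ^ ?n * exp (2 ^ ?n * (2 * pi * ((real (?n * (?n + 1)))\<^sup>2 * (?R * B))))"
  define A2 where "A2 = 2 * ((2 * (?R * B) + 3) * (4 * real ?n / \<kappa> + ?R))"
  have A1: "A1 > 0" by (simp add: A1_def)
  have R1: "1 \<le> ?R" by simp
  have RB: "0 \<le> ?R * B" using B(1) by simp
  have A2: "A2 \<ge> 1"
  proof -
    have "1 * 1 \<le> (2 * (?R * B) + 3) * (4 * real ?n / \<kappa> + ?R)"
      using RB R1 \<kappa> by (intro mult_mono add_increasing) auto
    then show ?thesis by (simp add: A2_def)
  qed
  show ?thesis
  proof (rule that[of \<rho> "A1 * (4 * \<rho> + 1) * A2 ^ ?n"])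
    show "0 < A1 * (4 * \<rho> + 1) * A2 ^ ?n" using A1 A2 \<rho> by simp
  next
    fix t :: "real ^ 'r" and q N K :: nat and J :: real and x :: "real ^ 'n"
    assume J: "1 \<le> J" "J \<le> real q" and N: "1 \<le> N" and NJ: "real N ^ 2 * J \<le> real q" "real q \<le> 4 * (real N ^ 2 * J)"
      and t: "\<And>j. \<bar>t $ j\<bar> \<le> J" "1 \<le> norm t"
      and lo: "\<And>i. x0 $ i - \<rho> \<le> x $ i" and hi: "\<And>i. x $ i + (real (K * N) + real ?n + 3) / real q \<le> x0 $ i + \<rho>"
    define F where "F = (\<lambda>x. \<Sum>j\<in>UNIV. t $ j * f j x)"
    define s where "s = 1 / real q"
    have q0: "real q > 0" using J by linarith
    have s0: "s > 0" using q0 by (simp add: s_def)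
    have CF: "C_class (max 2 ?n) F" unfolding F_def by (rule C_class_sum[OF C])
    have dF: "F differentiable (at z)" for z
      using C_class_mono[OF CF, of 1] C_class_differentiable[of 0 F] by simp
    have pF: "\<bar>partials L F y\<bar> \<le> a * (?R * B)"
      if L: "length L \<le> max 2 ?n" and y: "y \<in> Box" and a: "\<And>j. \<bar>t $ j\<bar> \<le> a" for L y a
    proof -
      have "partials L F = (\<lambda>x. \<Sum>j\<in>UNIV. t $ j * partials L (f j) x)"
        unfolding F_def by (rule partials_sum) (rule C_class_mono[OF C L])
      then have "\<bar>partials L F y\<bar> \<le> (\<Sum>j\<in>UNIV. \<bar>t $ j\<bar> * \<bar>partials L (f j) y\<bar>)"
        using sum_abs[of "\<lambda>j. t $ j * partials L (f j) y" UNIV] by (simp add: abs_mult)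
      also have "\<dots> \<le> (\<Sum>j\<in>(UNIV :: 'r set). a * B)"
      proof (intro sum_mono mult_mono a B(2)[OF L y])
        show "0 \<le> a" using a[of undefined] by linarith
      qed auto
      finally show ?thesis by (simp add: mult_ac)
    qed
    obtain I where I: "card (- I) \<le> 1" and sepI: "\<And>x y s. 0 < s \<Longrightarrow>
        x \<in> cbox (x0 - \<rho> *\<^sub>R 1) (x0 + (\<rho> - s) *\<^sub>R 1) \<Longrightarrow> y \<in> cbox (x0 - \<rho> *\<^sub>R 1) (x0 + (\<rho> - s) *\<^sub>R 1) \<Longrightarrow>
        (\<And>i. i \<notin> I \<Longrightarrow> x $ i = y $ i) \<Longrightarrow>
        \<kappa> * norm t * norm (x - y) \<le> (\<Sum>i\<in>I. \<bar>(F (x + s *\<^sub>R axis i 1) - F x) / s - (F (y + s *\<^sub>R axis i 1) - F y) / s\<bar>)"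
      using sep[of t] unfolding F_def by blast
    define X where "X k = grid x (real N * s) k" for k :: "'n \<Rightarrow> nat"
    define \<alpha> where "\<alpha> i k = real q * (F (X k + s *\<^sub>R axis i 1) - F (X k))" for i k
    have Xnth: "X k $ i = x $ i + real N * s * real (k i)" for k i by (simp add: X_def)
    have Xhi: "X k $ i + (real N + real ?n + 3) * s \<le> x0 $ i + \<rho>" if "k i < K" for k i
    proof -
      have "real (k i) + 1 \<le> real K" using that by linarith
      then have "real N * (real (k i) + 1) \<le> real (K * N)"
        using mult_left_mono[of "real (k i) + 1" "real K" "real N"] by (simp add: mult.commute)
      then have "real N * real (k i) + (real N + real ?n + 3) \<le> real (K * N) + real ?n + 3" by (simp add: algebra_simps)
      then have "(real N * real (k i) + (real N + real ?n + 3)) * s \<le> (real (K * N) + real ?n + 3) * s"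
        using s0 by (intro mult_right_mono) auto
      then show ?thesis using hi[of i] unfolding Xnth s_def by (simp add: algebra_simps add_divide_distrib)
    qed
    have Xlo: "x0 $ i - \<rho> \<le> X k $ i" for k i
      using lo[of i] s0 by (simp add: Xnth add_increasing2)
    let ?BK = "PiE (UNIV :: 'n set) (\<lambda>_. {..<K})"
    have BK: "k i < K" if "k \<in> ?BK" for k and i :: 'n using that by auto
    have Xs: "X k \<in> cbox (x0 - \<rho> *\<^sub>R 1) (x0 + (\<rho> - s) *\<^sub>R 1)" if "k \<in> ?BK" for k
      unfolding mem_box_cart
    proof
      fix i
      have "1 * s \<le> (real N + real ?n + 3) * s" using s0 by (intro mult_right_mono) auto
      then show "(x0 - \<rho> *\<^sub>R 1) $ i \<le> X k $ i \<and> X k $ i \<le> (x0 + (\<rho> - s) *\<^sub>R 1) $ i"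
        using Xlo[of i k] Xhi[of k i] BK[OF that] by simp
    qed
    have inner: "norm (\<Sum>h\<in>PiE UNIV (\<lambda>_. {..<N}). cis (2 * pi * (real q * F (grid (X k) s h))))
        \<le> A1 * ((2 * real N) ^ card (- I) * (\<Prod>i\<in>I. cell_wt N \<lfloor>real N * \<alpha> i k\<rfloor>))" if k: "k \<in> ?BK" for k
    proof -
      have "norm (\<Sum>h\<in>PiE UNIV (\<lambda>_. {..<N}). cis (2 * pi * (real q * F (grid (X k) (1 / real q) h))))
        \<le> A1 * (\<Prod>i\<in>UNIV. cell_wt N \<lfloor>real N * (real q * (F (X k + (1 / real q) *\<^sub>R axis i 1) - F (X k)))\<rfloor>)"
        unfolding A1_def
      proof (rule box_exp_sum_le[OF CF N NJ(1) J(1)])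
        fix L :: "'n list" and y :: "real ^ 'n" assume L: "length L \<le> max 2 ?n"
          and y: "y \<in> cbox (X k) (X k + (real (N + ?n + 2) / real q) *\<^sub>R 1)"
        have "y \<in> Box"
          unfolding Box_def mem_box_cart
        proof
          fix i
          have yi: "X k $ i \<le> y $ i" "y $ i \<le> X k $ i + real (N + ?n + 2) * s"
            using y by (auto simp: mem_box_cart s_def)
          moreover have "real (N + ?n + 2) * s \<le> (real N + real ?n + 3) * s" using s0 by (intro mult_right_mono) auto
          ultimately show "(x0 - \<rho> *\<^sub>R 1) $ i \<le> y $ i \<and> y $ i \<le> (x0 + \<rho> *\<^sub>R 1) $ i"
            using Xlo[of i k] Xhi[of k i] BK[OF k] by simp
        qed
        show "\<bar>partials L F y\<bar> \<le> J * (?R * B)" by (rule pF[OF L \<open>y \<in> Box\<close>]) (rule t(1))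
      qed
      also have "\<dots> \<le> A1 * ((2 * real N) ^ card (- I) * (\<Prod>i\<in>I. cell_wt N \<lfloor>real N * \<alpha> i k\<rfloor>))"
        unfolding \<alpha>_def s_def using A1 by (intro mult_left_mono prod_cell_wt_le) auto
      finally show ?thesis by (simp add: s_def)
    qed
    \<comment> \<open>\<open>w\<close> solves
      \<open>\<kappa> * norm t * (N * w / q) = n / N\<close>: for two corners in one cell, each of
      the at most \<open>n\<close> frequencies differs by less than \<open>1 / N\<close>.\<close>
    define w where "w = real ?n * real q / (\<kappa> * real N ^ 2 * norm t)"
    define D where "D = Suc (nat \<lfloor>w\<rfloor>)"
    have w0: "0 \<le> w" using \<kappa> by (simp add: w_def)
    have wD: "w < real D" using w0 unfolding D_def by linarith
    \<comment> \<open>The frequencies are at most \<open>p0\<close> in absolute value. Their cells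
      fill \<open>2 * p0\<close> periods of length \<open>N\<close>, and one more period takes in
      the endpoint \<open>N * p0\<close>.\<close>
    define p0 where "p0 = nat \<lceil>norm t * (?R * B)\<rceil>"
    define p where "p = Suc (2 * p0)"
    have range: "\<lfloor>real N * \<alpha> i k\<rfloor> \<in> {- int (N * p0)..<- int (N * p0) + int (N * p)}" if k: "k \<in> ?BK" for k i
    proof -
      obtain \<theta> where \<theta>: "0 \<le> \<theta>" "\<theta> \<le> s" "F (X k + s *\<^sub>R axis i 1) - F (X k) = s * partial i F (X k + \<theta> *\<^sub>R axis i 1)"
        by (rule partial_mvt_axis[OF dF less_imp_le[OF s0], of "X k" i]) blast
      have "X k + \<theta> *\<^sub>R axis i 1 \<in> Box"
        unfolding Box_def mem_box_cart
      proof
        fix l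
        have "(x0 - \<rho> *\<^sub>R 1) $ l \<le> X k $ l" "X k $ l \<le> x0 $ l + (\<rho> - s)"
          using Xs[OF k] by (auto simp: mem_box_cart)
        then show "(x0 - \<rho> *\<^sub>R 1) $ l \<le> (X k + \<theta> *\<^sub>R axis i 1) $ l \<and> (X k + \<theta> *\<^sub>R axis i 1) $ l \<le> (x0 + \<rho> *\<^sub>R 1) $ l"
          using \<theta>(1,2) s0 by (cases "l = i") (auto simp: axis_def)
      qed
      then have "\<bar>partials [i] F (X k + \<theta> *\<^sub>R axis i 1)\<bar> \<le> norm t * (?R * B)"
        by (intro pF component_le_norm_cart) auto
      moreover have "\<alpha> i k = partials [i] F (X k + \<theta> *\<^sub>R axis i 1)"
        using \<theta>(3) q0 by (simp add: \<alpha>_def s_def)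
      ultimately have "\<bar>\<alpha> i k\<bar> \<le> real p0" unfolding p0_def by linarith
      then have "\<bar>real N * \<alpha> i k\<bar> \<le> real (N * p0)" by (simp add: abs_mult mult_left_mono)
      then have "- real (N * p0) \<le> real N * \<alpha> i k" "real N * \<alpha> i k \<le> real (N * p0)" by (simp_all add: abs_le_iff)
      then have "- int (N * p0) \<le> \<lfloor>real N * \<alpha> i k\<rfloor>" "\<lfloor>real N * \<alpha> i k\<rfloor> \<le> int (N * p0)"
        by linarith+
      moreover have "int (N * p) = 2 * int (N * p0) + int N" by (simp add: p_def algebra_simps)
      ultimately show ?thesis using N unfolding atLeastLessThan_iff by linarith
    qed
    have sepk: "\<bar>int (k i) - int (k' i)\<bar> < int D"
      if k: "k \<in> ?BK" "k' \<in> ?BK" "\<And>i. i \<notin> I \<Longrightarrow> k i = k' i"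
        "\<And>i. i \<in> I \<Longrightarrow> \<bar>\<alpha> i k - \<alpha> i k'\<bar> < 1 / real N" for k k' i
    proof -
      have "\<kappa> * norm t * norm (X k - X k') \<le> (\<Sum>i\<in>I. \<bar>(F (X k + s *\<^sub>R axis i 1) - F (X k)) / s - (F (X k' + s *\<^sub>R axis i 1) - F (X k')) / s\<bar>)"
        by (rule sepI[OF s0 Xs[OF k(1)] Xs[OF k(2)]]) (simp add: Xnth k(3))
      also have "\<dots> = (\<Sum>i\<in>I. \<bar>\<alpha> i k - \<alpha> i k'\<bar>)"
        by (simp add: \<alpha>_def s_def mult.commute)
      also have "\<dots> \<le> (\<Sum>i\<in>I. 1 / real N)" using k(4) by (intro sum_mono less_imp_le)
      also have "\<dots> \<le> real ?n * (1 / real N)" by (simp add: card_mono divide_right_mono)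
      finally have 1: "\<kappa> * norm t * norm (X k - X k') \<le> real ?n / real N" by simp
      have "real N * s * \<bar>real (k i) - real (k' i)\<bar> = \<bar>(X k - X k') $ i\<bar>"
        using s0 by (simp add: Xnth right_diff_distrib[symmetric] abs_mult)
      also have "\<dots> \<le> norm (X k - X k')" by (rule component_le_norm_cart)
      finally have "\<kappa> * norm t * (real N * s * \<bar>real (k i) - real (k' i)\<bar>) \<le> \<kappa> * norm t * norm (X k - X k')"
        using \<kappa> by (intro mult_left_mono) auto
      with 1 have "\<kappa> * norm t * (real N * s * \<bar>real (k i) - real (k' i)\<bar>) \<le> real ?n / real N" by linarith
      then have "\<kappa> * norm t * (real N * s * \<bar>real (k i) - real (k' i)\<bar>) * (real N * real q) \<le> real ?n / real N * (real N * real q)"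
        by (intro mult_right_mono) auto
      then have "\<bar>real (k i) - real (k' i)\<bar> * (\<kappa> * real N ^ 2 * norm t) \<le> real ?n * real q"
        using N q0 by (simp add: s_def power2_eq_square mult_ac)
      moreover have "\<kappa> * real N ^ 2 * norm t > 0" using \<kappa> N t(2) by (intro mult_pos_pos) auto
      ultimately have "\<bar>real (k i) - real (k' i)\<bar> \<le> w" unfolding w_def by (simp add: pos_le_divide_eq)
      with wD show ?thesis by linarith
    qed
    have tJ: "norm t \<le> ?R * J"
    proof -
      have "norm t \<le> (\<Sum>j\<in>UNIV. \<bar>t $ j\<bar>)" by (rule norm_le_l1_cart)
      also have "\<dots> \<le> (\<Sum>j\<in>(UNIV :: 'r set). J)" by (intro sum_mono t(1))
      finally show ?thesis by simp
    qed
    \<comment> \<open>The balance for short \<open>t\<close>: \<open>D\<close> is at most of order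
      \<open>q / (N ^ 2 * norm t) + 1\<close> and \<open>p\<close> of order \<open>norm t\<close>,
      so the product is of order \<open>q / N ^ 2 + norm t\<close>, and both terms are O(J).\<close>
    have Dp: "real D * real p * 2 \<le> A2 * J"
    proof -
      have "real D \<le> w + 1" using w0 unfolding D_def by linarith
      moreover have "real p0 \<le> norm t * (?R * B) + 1"
        using RB mult_nonneg_nonneg[OF norm_ge_zero RB, of t] unfolding p0_def by linarith
      then have "real p \<le> 2 * (norm t * (?R * B)) + 3" by (simp add: p_def)
      then have "real p \<le> norm t * (2 * (?R * B) + 3)" using t(2) by (simp add: algebra_simps)
      ultimately have "real D * real p \<le> (w + 1) * (norm t * (2 * (?R * B) + 3))"
        using w0 by (intro mult_mono) auto
      also have "\<dots> = (2 * (?R * B) + 3) * (real ?n * real q / (\<kappa> * real N ^ 2) + norm t)"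
      proof -
        have "norm t \<noteq> 0" using t(2) by linarith
        then have w: "real ?n * real q / (\<kappa> * real N ^ 2) = w * norm t" by (simp add: w_def)
        show ?thesis unfolding w by (simp add: algebra_simps)
      qed
      also have "\<dots> \<le> (2 * (?R * B) + 3) * (4 * real ?n / \<kappa> * J + ?R * J)"
      proof (intro mult_left_mono add_mono tJ)
        have "real ?n * real q \<le> real ?n * (4 * (real N ^ 2 * J))" by (intro mult_left_mono NJ) simp
        then show "real ?n * real q / (\<kappa> * real N ^ 2) \<le> 4 * real ?n / \<kappa> * J"
          using \<kappa> N by (simp add: field_simps)
      qed (use RB in auto)
      also have "\<dots> = A2 * J / 2" unfolding A2_def distrib_right[symmetric] by simp
      finally show ?thesis by linarith
    qed
    have ln0: "0 \<le> ln (real q)" using J by simp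
    have lnN: "0 \<le> ln (real N)" "ln (real N) \<le> ln (real q)"
    proof -
      have "real N * 1 * 1 \<le> real N * real N * J" using N J by (intro mult_mono) auto
      then have "real N \<le> real q" using NJ by (simp add: power2_eq_square)
      then show "ln (real N) \<le> ln (real q)" using N by simp
    qed (use N in simp)
    let ?S = "sqrt (real q * J)" and ?l = "2 + ln (real q)"
    have JN: "J * real N \<le> ?S"
    proof (rule real_le_rsqrt)
      have "(J * real N)\<^sup>2 = J * (real N ^ 2 * J)" by (simp add: power2_eq_square)
      also have "\<dots> \<le> J * real q" using J NJ by (intro mult_left_mono) auto
      finally show "(J * real N)\<^sup>2 \<le> real q * J" by (simp add: mult.commute)
    qed
    have Sq: "?S \<le> real q"
    proof (rule real_le_lsqrt)
      have "real q * J \<le> real q * real q" using J by (intro mult_left_mono) auto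
      then show "real q * J \<le> (real q)\<^sup>2" by (simp add: power2_eq_square)
    qed simp
    have S0: "0 \<le> ?S" using J by simp
    have Al: "1 \<le> A2 * ?l" using mult_mono[of 1 A2 1 ?l] A2 ln0 by simp
    have DpN: "real D * real p * (2 * real N * (2 + ln (real N))) \<le> A2 * ?l * ?S"
    proof -
      have "real D * real p * (2 * real N * (2 + ln (real N))) = (real D * real p * 2) * real N * (2 + ln (real N))" by simp
      also have "\<dots> \<le> (A2 * J) * real N * ?l"
        using lnN A2 J by (intro mult_mono[OF mult_right_mono[OF Dp]]) auto
      also have "\<dots> = A2 * ?l * (J * real N)" by simp
      also have "\<dots> \<le> A2 * ?l * ?S" using JN Al by (intro mult_left_mono) auto
      finally show ?thesis .
    qed
    have KN: "real K * (2 * real N) \<le> 4 * \<rho> * real q"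
    proof -
      have "real (K * N) * s \<le> (real (K * N) + real ?n + 3) * s" using s0 by (intro mult_right_mono) auto
      also have "\<dots> \<le> 2 * \<rho>" using lo[of undefined] hi[of undefined] by (simp add: s_def)
      finally show ?thesis using q0 by (simp add: s_def field_simps)
    qed
    have cI: "card I = ?n - card (- I)" "card (- I) \<le> ?n"
      using card_Un_disjoint[of I "- I"] by simp_all
    have "norm (\<Sum>c\<in>PiE UNIV (\<lambda>_. {..<K * N}). cis (2 * pi * (real q * F (grid x s c))))
        = norm (\<Sum>k\<in>?BK. \<Sum>h\<in>PiE UNIV (\<lambda>_. {..<N}). cis (2 * pi * (real q * F (grid (X k) s h))))"
      unfolding sum_box_decompose[OF N]
      by (intro arg_cong[where f = norm] sum.cong arg_cong[where f = cis] arg_cong[where f = F]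
            arg_cong2[where f = "(*)"] refl)
         (simp add: vec_eq_iff X_def algebra_simps)
    also have "\<dots> \<le> (\<Sum>k\<in>?BK. A1 * ((2 * real N) ^ card (- I) * (\<Prod>i\<in>I. cell_wt N \<lfloor>real N * \<alpha> i k\<rfloor>)))"
      by (rule order_trans[OF norm_sum sum_mono[OF inner]])
    also have "\<dots> = A1 * (2 * real N) ^ card (- I) * (\<Sum>k\<in>?BK. \<Prod>i\<in>I. cell_wt N \<lfloor>real N * \<alpha> i k\<rfloor>)"
      by (simp add: sum_distrib_left mult.assoc)
    also have "\<dots> \<le> A1 * (2 * real N) ^ card (- I) * (real K ^ card (- I) * (real D * real p * (2 * real N * (2 + ln (real N)))) ^ card I)"
    proof (rule mult_left_mono)
      show "(\<Sum>k\<in>?BK. \<Prod>i\<in>I. cell_wt N \<lfloor>real N * \<alpha> i k\<rfloor>)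
          \<le> real K ^ card (- I) * (real D * real p * (2 * real N * (2 + ln (real N)))) ^ card I"
      proof (rule sum_separated_slices_le[where v = "\<lambda>_. - int (N * p0)", OF N])
        fix k k' i
        assume k: "k \<in> ?BK" "k' \<in> ?BK" "\<And>i. i \<notin> I \<Longrightarrow> k i = k' i"
          "\<And>i. i \<in> I \<Longrightarrow> \<bar>\<alpha> i k - \<alpha> i k'\<bar> < 1 / real N"
        show "\<bar>int (k i) - int (k' i)\<bar> < int D" by (rule sepk[OF k])
      qed (rule range)
    qed (use A1 in auto)
    also have "\<dots> = A1 * (real K * (2 * real N)) ^ card (- I) * (real D * real p * (2 * real N * (2 + ln (real N)))) ^ card I"
      by (simp add: power_mult_distrib)
    also have "\<dots> \<le> A1 * (4 * \<rho> * real q) ^ card (- I) * (A2 * ?l * ?S) ^ card I"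
      using A1 lnN \<rho> by (intro mult_mono[OF mult_left_mono[OF power_mono[OF KN]] power_mono[OF DpN]]) auto
    also have "\<dots> \<le> A1 * ((4 * \<rho> + 1) * (A2 * ?l) ^ ?n * (real q * ?S ^ (?n - 1)))"
    proof -
      have "(4 * \<rho> * real q) ^ card (- I) * (A2 * ?l * ?S) ^ card I \<le> (4 * \<rho> + 1) * (A2 * ?l) ^ ?n * (real q * ?S ^ (?n - 1))"
      \<comment> \<open>With no index omitted, one of the \<open>n\<close> factors
        \<open>sqrt (q * J)\<close> is raised to \<open>q\<close>, so that both cases share one
        bound.\<close>
      proof (cases "card (- I) = 0")
        case True
        then have "(4 * \<rho> * real q) ^ card (- I) * (A2 * ?l * ?S) ^ card I = 1 * (A2 * ?l) ^ ?n * (?S * ?S ^ (?n - 1))"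
          using cI by (simp add: power_mult_distrib power_eq_if[of _ ?n])
        also have "\<dots> \<le> (4 * \<rho> + 1) * (A2 * ?l) ^ ?n * (real q * ?S ^ (?n - 1))"
          using \<rho> Sq S0 Al by (intro mult_mono[OF mult_right_mono mult_right_mono]) auto
        finally show ?thesis .
      next
        case False
        then have c1: "card (- I) = 1" using I by linarith
        then have "(4 * \<rho> * real q) ^ card (- I) * (A2 * ?l * ?S) ^ card I = 4 * \<rho> * (A2 * ?l) ^ (?n - 1) * (real q * ?S ^ (?n - 1))"
          using cI by (simp add: power_mult_distrib)
        also have "\<dots> \<le> (4 * \<rho> + 1) * (A2 * ?l) ^ ?n * (real q * ?S ^ (?n - 1))"
          using \<rho> S0 Al by (intro mult_right_mono mult_mono[OF _ power_increasing]) auto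
        finally show ?thesis .
      qed
      then show ?thesis using A1 by (simp add: mult.assoc)
    qed
    also have "\<dots> = A1 * (4 * \<rho> + 1) * A2 ^ ?n * ?l ^ ?n * (real q * ?S ^ (?n - 1))"
      by (simp add: power_mult_distrib)
    finally show "norm (\<Sum>c\<in>PiE UNIV (\<lambda>_. {..<K * N}). cis (2 * pi * (real q * (\<Sum>j\<in>UNIV. t $ j * f j (grid x (1 / real q) c)))))
        \<le> A1 * (4 * \<rho> + 1) * A2 ^ ?n * ?l ^ ?n * (real q * ?S ^ (?n - 1))"
      by (simp add: F_def s_def)
  qed (use \<rho> in auto)
qed

subsection \<open>Counting rational points\<close>

text \<open>Each point with integral values contributes \<open>J ^ (2 * CARD('r))\<close> to the sum
  of squares, and the other points contribute nonnegatively. After division the diagonal pairs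
  \<open>j = j'\<close> give the first term, all other pairs at most \<open>X\<close>.\<close>

lemma weyl_count:
  fixes y :: "'c \<Rightarrow> 'r::finite \<Rightarrow> real"
  assumes \<Omega>: "finite \<Omega>" and J: "J \<ge> 1" and X: "0 \<le> X"
    and bound: "\<And>j j' :: 'r \<Rightarrow> nat. j \<in> PiE UNIV (\<lambda>_. {..<J}) \<Longrightarrow> j' \<in> PiE UNIV (\<lambda>_. {..<J}) \<Longrightarrow> j \<noteq> j' \<Longrightarrow>
      norm (\<Sum>c\<in>\<Omega>. cis (2 * pi * (\<Sum>r\<in>UNIV. (real (j r) - real (j' r)) * y c r))) \<le> X"
  shows "real (card {c \<in> \<Omega>. \<forall>r. y c r \<in> \<int>}) \<le> real (card \<Omega>) / real J ^ CARD('r) + X"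
proof -
  let ?B = "PiE (UNIV :: 'r set) (\<lambda>_. {..<J})"
  define e where "e j c = cis (2 * pi * (\<Sum>r\<in>UNIV. real (j r) * y c r))" for j c
  let ?JR = "real J ^ CARD('r)"
  have fB: "finite ?B" by (intro finite_PiE) auto
  have cB: "real (card ?B) = ?JR" by (simp add: card_PiE)
  have J0: "?JR > 0" using J by simp
  have prod: "e j c * cnj (e j' c) = cis (2 * pi * (\<Sum>r\<in>UNIV. (real (j r) - real (j' r)) * y c r))" for j j' c
    by (simp add: e_def cis_cnj cis_mult sum_subtractf left_diff_distrib algebra_simps)
  have full: "(\<Sum>j\<in>?B. e j c) = of_real ?JR" if "\<forall>r. y c r \<in> \<int>" for c
  proof -
    have "e j c = 1" for j
    proof -
      have "(\<Sum>r\<in>UNIV. real (j r) * y c r) \<in> \<int>" using that by (intro Ints_sum Ints_mult) auto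
      then show ?thesis unfolding e_def by (rule cis_multiple_2pi)
    qed
    then have "(\<Sum>j\<in>?B. e j c) = of_nat (card ?B)" by simp
    then show ?thesis by (metis cB of_real_of_nat_eq)
  qed
  have sq: "of_real ((norm (\<Sum>j\<in>?B. e j c))\<^sup>2) = (\<Sum>j\<in>?B. \<Sum>j'\<in>?B. e j c * cnj (e j' c))" for c
    by (simp only: complex_norm_square cnj_sum sum_product)
  have "real (card {c \<in> \<Omega>. \<forall>r. y c r \<in> \<int>}) * ?JR ^ 2 = (\<Sum>c\<in>{c \<in> \<Omega>. \<forall>r. y c r \<in> \<int>}. (norm (\<Sum>j\<in>?B. e j c))\<^sup>2)"
    using full by (simp add: norm_power)
  also have "\<dots> \<le> (\<Sum>c\<in>\<Omega>. (norm (\<Sum>j\<in>?B. e j c))\<^sup>2)"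
    using \<Omega> by (intro sum_mono2) auto
  also have "\<dots> = norm (of_real (\<Sum>c\<in>\<Omega>. (norm (\<Sum>j\<in>?B. e j c))\<^sup>2) :: complex)"
    unfolding norm_of_real by (rule abs_of_nonneg[symmetric]) (intro sum_nonneg zero_le_power2)
  also have "(of_real (\<Sum>c\<in>\<Omega>. (norm (\<Sum>j\<in>?B. e j c))\<^sup>2) :: complex) = (\<Sum>c\<in>\<Omega>. \<Sum>j\<in>?B. \<Sum>j'\<in>?B. e j c * cnj (e j' c))"
    unfolding of_real_sum sq ..
  also have "\<dots> = (\<Sum>j\<in>?B. \<Sum>j'\<in>?B. \<Sum>c\<in>\<Omega>. e j c * cnj (e j' c))"
    by (subst sum.swap, rule sum.cong[OF refl], rule sum.swap)
  also have "norm \<dots> \<le> (\<Sum>j\<in>?B. \<Sum>j'\<in>?B. norm (\<Sum>c\<in>\<Omega>. e j c * cnj (e j' c)))"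
    by (intro order_trans[OF norm_sum] sum_mono norm_sum)
  also have "\<dots> \<le> (\<Sum>j\<in>?B. \<Sum>j'\<in>?B. X + (if j' = j then real (card \<Omega>) else 0))"
  proof (intro sum_mono)
    fix j j' assume j: "j \<in> ?B" "j' \<in> ?B"
    show "norm (\<Sum>c\<in>\<Omega>. e j c * cnj (e j' c)) \<le> X + (if j' = j then real (card \<Omega>) else 0)"
    proof (cases "j' = j")
      case True
      then show ?thesis using X by (simp add: prod)
    next
      case False
      then show ?thesis using bound[OF j] unfolding prod by auto
    qed
  qed
  also have "\<dots> = ?JR * (?JR * X) + ?JR * real (card \<Omega>)"
  proof -
    have "(\<Sum>j'\<in>?B. X + (if j' = j then real (card \<Omega>) else 0)) = ?JR * X + real (card \<Omega>)" if "j \<in> ?B" for j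
      using that fB by (simp add: sum.distrib card_PiE)
    then have "(\<Sum>j\<in>?B. \<Sum>j'\<in>?B. X + (if j' = j then real (card \<Omega>) else 0)) = real (card ?B) * (?JR * X + real (card \<Omega>))"
      by simp
    then show ?thesis unfolding cB by (simp add: algebra_simps)
  qed
  finally have "real (card {c \<in> \<Omega>. \<forall>r. y c r \<in> \<int>}) \<le> (?JR * (?JR * X) + ?JR * real (card \<Omega>)) / ?JR ^ 2"
    using J0 by (simp add: pos_le_divide_eq)
  also have "\<dots> = real (card \<Omega>) / ?JR + X"
    using J0 by (simp add: field_simps power2_eq_square)
  finally show ?thesis .
qed

text \<open>For a fixed denominator the last \<open>CARD('r)\<close> numerators of a rational point
  on the graph are the values \<open>q * f j\<close>, so the first ones alone encode the
  point.\<close>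

definition slice_points :: "(real ^ 'n::finite) set \<Rightarrow> ('r::finite \<Rightarrow> real ^ 'n \<Rightarrow> real) \<Rightarrow> nat \<Rightarrow> (int ^ 'n) set" where
  "slice_points S f q = {a. (\<chi> i. real_of_int (a $ i) / real q) \<in> S \<and>
     (\<forall>j. real q * f j (\<chi> i. real_of_int (a $ i) / real q) \<in> \<int>)}"

text \<open>Moves the points to a grid whose corner \<open>x\<close> is, in each coordinate, the
  first multiple of \<open>1 / q\<close> from \<open>x0 $ i - \<epsilon>\<close> upwards; it
  overshoots by at most \<open>1 / q\<close>.\<close>

lemma slice_points_count:
  fixes x0 :: "real ^ 'n::finite" and f :: "'r::finite \<Rightarrow> real ^ 'n \<Rightarrow> real"
  assumes q: "q \<ge> 1" and M: "real M > 2 * \<epsilon> * real q"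
    and S: "\<And>x i. x \<in> S \<Longrightarrow> \<bar>x $ i - x0 $ i\<bar> \<le> \<epsilon>"
  obtains x where "\<And>i. x0 $ i - \<epsilon> \<le> x $ i" "\<And>i. x $ i \<le> x0 $ i - \<epsilon> + 1 / real q"
    "finite (slice_points S f q)"
    "card (slice_points S f q) \<le> card {c \<in> PiE UNIV (\<lambda>_. {..<M}). \<forall>j. real q * f j (grid x (1 / real q) c) \<in> \<int>}"
proof -
  define A where "A i = \<lceil>real q * (x0 $ i - \<epsilon>)\<rceil>" for i
  define x :: "real ^ 'n" where "x = (\<chi> i. real_of_int (A i) / real q)"
  have q0: "real q > 0" using q by simp
  let ?T = "{c \<in> PiE (UNIV :: 'n set) (\<lambda>_. {..<M}). \<forall>j. real q * f j (grid x (1 / real q) c) \<in> \<int>}"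
  let ?g = "\<lambda>(a :: int ^ 'n) i. nat (a $ i - A i)"
  have range: "A i \<le> a $ i \<and> a $ i - A i < int M" if "a \<in> slice_points S f q" for a i
  proof -
    have "\<bar>real_of_int (a $ i) / real q - x0 $ i\<bar> \<le> \<epsilon>"
      using S[of "\<chi> i. real_of_int (a $ i) / real q" i] that by (simp add: slice_points_def)
    then have 1: "real q * (x0 $ i - \<epsilon>) \<le> real_of_int (a $ i)" "real_of_int (a $ i) \<le> real q * (x0 $ i + \<epsilon>)"
      using q0 by (auto simp: abs_le_iff field_simps)
    then have "A i \<le> a $ i" unfolding A_def by (simp add: ceiling_le)
    moreover have "real_of_int (a $ i) - real_of_int (A i) \<le> real q * (x0 $ i + \<epsilon>) - real q * (x0 $ i - \<epsilon>)"
      using 1 le_of_int_ceiling[of "real q * (x0 $ i - \<epsilon>)"] unfolding A_def by linarith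
    then have "real_of_int (a $ i) - real_of_int (A i) < real M" using M by (simp add: algebra_simps)
    ultimately show ?thesis by linarith
  qed
  have grid: "grid x (1 / real q) (?g a) = (\<chi> i. real_of_int (a $ i) / real q)" if "a \<in> slice_points S f q" for a
    using range[OF that] by (simp add: vec_eq_iff x_def add_divide_distrib[symmetric])
  have inj: "inj_on ?g (slice_points S f q)"
  proof (rule inj_onI)
    fix a b assume ab: "a \<in> slice_points S f q" "b \<in> slice_points S f q" "?g a = ?g b"
    have "a $ i = b $ i" for i
      using fun_cong[OF ab(3), of i] range[OF ab(1), of i] range[OF ab(2), of i] by linarith
    then show "a = b" by (simp add: vec_eq_iff)
  qed
  have im: "?g ` slice_points S f q \<subseteq> ?T"
  proof clarify
    fix a assume a: "a \<in> slice_points S f q"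
    have "nat (a $ i - A i) < M" for i using range[OF a, of i] by linarith
    moreover have "real q * f j (grid x (1 / real q) (?g a)) \<in> \<int>" for j
      using a unfolding grid[OF a] by (simp add: slice_points_def)
    ultimately show "?g a \<in> PiE UNIV (\<lambda>_. {..<M}) \<and> (\<forall>j. real q * f j (grid x (1 / real q) (?g a)) \<in> \<int>)"
      by (auto simp: PiE_iff)
  qed
  have fT: "finite ?T" by (intro finite_subset[OF _ finite_PiE[of UNIV "\<lambda>_. {..<M}"]]) auto
  show ?thesis
  proof (rule that[of x])
    show "finite (slice_points S f q)" using finite_subset[OF im fT] inj by (rule finite_imageD)
    show "card (slice_points S f q) \<le> card ?T" by (rule card_inj_on_le[OF inj im fT])
    fix i
    have "real q * (x0 $ i - \<epsilon>) \<le> real_of_int (A i)" "real_of_int (A i) \<le> real q * (x0 $ i - \<epsilon>) + 1"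
      unfolding A_def by linarith+
    then show "x0 $ i - \<epsilon> \<le> x $ i" "x $ i \<le> x0 $ i - \<epsilon> + 1 / real q"
      using q0 by (auto simp: x_def field_simps)
  qed
qed

text \<open>Up to logarithms \<open>weyl_count\<close> gives \<open>q ^ n / J ^ R\<close> plus
  \<open>q * (q * J) powr ((n - 1) / 2)\<close>. For \<open>J = q powr \<theta>\<close> the
  exponents are \<open>n - R * \<theta>\<close> and \<open>1 + (1 + \<theta>) / 2 * (n - 1)\<close>,
  and \<open>\<theta>\<close> is the solution of their equality.\<close>

lemma slice_points_bound:
  fixes f :: "'r::finite \<Rightarrow> real ^ 'n::finite \<Rightarrow> real" and x0 :: "real ^ 'n"
  defines "\<theta> \<equiv> (real CARD('n) - 1) / (real CARD('n) + 2 * real CARD('r) - 1)"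
  assumes C: "\<And>j. C_class (max 2 CARD('n)) (f j)"
    and rk: "\<And>t :: real ^ 'r. t \<noteq> 0 \<Longrightarrow> rank (hessian (\<lambda>x. \<Sum>j\<in>UNIV. t $ j * f j x) x0) \<ge> CARD('n) - 1"
  shows "\<exists>\<epsilon>>0. \<exists>A>0. \<forall>S q. (\<forall>x\<in>S. \<forall>i. \<bar>x $ i - x0 $ i\<bar> \<le> \<epsilon>) \<longrightarrow> q \<ge> 1 \<longrightarrow> finite (slice_points S f q) \<and>
      real (card (slice_points S f q)) \<le> A * (2 + ln (real q)) ^ CARD('n) * real q powr (real CARD('n) - real CARD('r) * \<theta>)"
proof -
  let ?n = "CARD('n)" and ?R = "CARD('r)"
  show ?thesis
  proof (rule exp_sum_bound[OF C rk])
    fix \<rho> A0 :: real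
    assume \<rho>: "\<rho> > 0" and A0: "A0 > 0" and exps:
      "\<And>(t :: real ^ 'r) q N K J x. 1 \<le> J \<Longrightarrow> J \<le> real q \<Longrightarrow> 1 \<le> N \<Longrightarrow> real N ^ 2 * J \<le> real q \<Longrightarrow>
      real q \<le> 4 * (real N ^ 2 * J) \<Longrightarrow> (\<And>j. \<bar>t $ j\<bar> \<le> J) \<Longrightarrow> 1 \<le> norm t \<Longrightarrow>
      (\<And>i. x0 $ i - \<rho> \<le> x $ i) \<Longrightarrow> (\<And>i. x $ i + (real (K * N) + real ?n + 3) / real q \<le> x0 $ i + \<rho>) \<Longrightarrow>
      norm (\<Sum>c\<in>PiE UNIV (\<lambda>_. {..<K * N}). cis (2 * pi * (real q * (\<Sum>j\<in>UNIV. t $ j * f j (grid x (1 / real q) c)))))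
        \<le> A0 * (2 + ln (real q)) ^ ?n * (real q * sqrt (real q * J) ^ (?n - 1))"
    \<comment> \<open>The sums run over slightly more than the box of radius
      \<open>\<epsilon>\<close>; the other half of \<open>\<rho>\<close> absorbs the excess.\<close>
    define \<epsilon> where "\<epsilon> = \<rho> / 2"
    have \<epsilon>: "\<epsilon> > 0" using \<rho> by (simp add: \<epsilon>_def)
    \<comment> \<open>From \<open>q0\<close> on
      \<open>(n + 5) * sqrt q \<le> \<epsilon> * q\<close>, which controls the excess
      \<open>(N + n + 4) / q\<close> because \<open>N \<le> sqrt q\<close>. Smaller \<open>q\<close>
      are counted trivially.\<close>
    define q0 where "q0 = max 1 ((real ?n + 5) / \<epsilon>) ^ 2"
    have n1: "1 \<le> real ?n" and R1: "1 \<le> real ?R" by simp_all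
    have \<theta>0: "0 \<le> \<theta>" unfolding \<theta>_def using n1 R1 by (intro divide_nonneg_nonneg) linarith+
    have \<theta>1: "\<theta> \<le> 1" unfolding \<theta>_def using n1 R1 by (subst divide_le_eq_1_pos) linarith+
    have nz: "real ?n + 2 * real ?R - 1 \<noteq> 0" using n1 R1 by linarith
    have \<theta>eq: "\<theta> * (real ?n + 2 * real ?R - 1) = real ?n - 1"
    by (simp only: nonzero_eq_divide_eq[OF nz, symmetric] \<theta>_def)
    define E where "E = real ?n - real ?R * \<theta>"
    have E2: "1 + (1 + \<theta>) / 2 * (real ?n - 1) = E"
      using \<theta>eq by (simp add: E_def field_simps)
    have E0: "0 \<le> E"
    proof -
      have "0 \<le> (1 + \<theta>) / 2 * (real ?n - 1)" using \<theta>0 n1 by (intro mult_nonneg_nonneg) auto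
      then show ?thesis unfolding E2[symmetric] by linarith
    qed
    \<comment> \<open>The summands serve the diagonal terms, the off-diagonal terms and the small
      \<open>q\<close>. The factor \<open>2 ^ ?R\<close> pays for rounding \<open>J\<close>
      down.\<close>
    define A where "A = (2 * \<epsilon> + 1) ^ ?n * 2 ^ ?R + A0 + ((2 * \<epsilon> + 1) * q0) ^ ?n"
    have q01: "1 \<le> q0" by (simp add: q0_def)
    have A_pos: "A > 0" unfolding A_def using \<epsilon> A0 q01 by (intro add_pos_pos) auto
    show ?thesis
    proof (rule exI, rule conjI[OF \<epsilon>], rule exI, rule conjI[OF A_pos], intro allI impI conjI)
      fix S :: "(real ^ 'n) set" and q :: nat
      assume "\<forall>x\<in>S. \<forall>i. \<bar>x $ i - x0 $ i\<bar> \<le> \<epsilon>" and q: "q \<ge> 1"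
      then have S: "\<bar>x $ i - x0 $ i\<bar> \<le> \<epsilon>" if "x \<in> S" for x i using that by blast
      let ?l = "(2 + ln (real q)) ^ ?n"
      have qr: "1 \<le> real q" using q by simp
      have l1: "1 \<le> ?l" using qr by (intro one_le_power) simp
      have qE: "1 \<le> real q powr E" using qr E0 by (rule ge_one_powr_ge_zero)
      have "finite (slice_points S f q) \<and> real (card (slice_points S f q)) \<le> A * ?l * real q powr E"
      proof (cases "real q < q0")
        case True
        define M where "M = Suc (nat \<lfloor>2 * \<epsilon> * real q\<rfloor>)"
        have Mq: "real M > 2 * \<epsilon> * real q" "real M \<le> 2 * \<epsilon> * real q + 1"
          using mult_nonneg_nonneg[of "2 * \<epsilon>" "real q"] \<epsilon> unfolding M_def by linarith+
        obtain x where x: "finite (slice_points S f q)"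
          "card (slice_points S f q) \<le> card {c \<in> PiE (UNIV :: 'n set) (\<lambda>_. {..<M}). \<forall>j. real q * f j (grid x (1 / real q) c) \<in> \<int>}"
          by (rule slice_points_count[where f = f, OF q Mq(1) S], assumption) (rule that)
        have "card {c \<in> PiE (UNIV :: 'n set) (\<lambda>_. {..<M}). \<forall>j. real q * f j (grid x (1 / real q) c) \<in> \<int>} \<le> card (PiE (UNIV :: 'n set) (\<lambda>_. {..<M}))"
          by (intro card_mono finite_PiE) auto
        then have "card (slice_points S f q) \<le> M ^ ?n" using x(2) by (simp add: card_PiE)
        then have "real (card (slice_points S f q)) \<le> real (M ^ ?n)" by (rule of_nat_mono)
        also have "\<dots> = real M ^ ?n" by simp
        also have "\<dots> \<le> ((2 * \<epsilon> + 1) * q0) ^ ?n"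
        proof (rule power_mono)
          have "real M \<le> (2 * \<epsilon> + 1) * real q" using Mq(2) qr by (simp add: algebra_simps)
          also have "\<dots> \<le> (2 * \<epsilon> + 1) * q0" using True \<epsilon> by (intro mult_left_mono) auto
          finally show "real M \<le> (2 * \<epsilon> + 1) * q0" .
        qed simp
        also have "\<dots> \<le> A" unfolding A_def using \<epsilon> A0 by simp
        also have "\<dots> \<le> A * (?l * real q powr E)"
          using A_pos mult_mono[OF l1 qE] l1 by (simp add: mult_le_cancel_left1)
        finally show ?thesis using x(1) by (simp add: mult.assoc)
      next
        case False
        then have qq0: "q0 \<le> real q" by simp
        define J where "J = nat \<lfloor>real q powr \<theta>\<rfloor>"
        have pw1: "1 \<le> real q powr \<theta>" using qr \<theta>0 by (rule ge_one_powr_ge_zero)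
        have J: "1 \<le> J" "real J \<le> real q powr \<theta>" "real q powr \<theta> \<le> 2 * real J"
        proof -
          show "1 \<le> J" using pw1 unfolding J_def by (simp add: le_nat_iff le_floor_iff)
          show "real J \<le> real q powr \<theta>" using pw1 unfolding J_def by linarith
          have "real q powr \<theta> < real J + 1" using pw1 unfolding J_def by linarith
          then show "real q powr \<theta> \<le> 2 * real J" using \<open>1 \<le> J\<close> by linarith
        qed
        have pwq: "real q powr \<theta> \<le> real q" using powr_mono[OF \<theta>1 qr] q by simp
        \<comment> \<open>\<open>J \<le> q\<close> is what makes a box side \<open>N \<ge> 1\<close>
          possible.\<close>
        have Jq: "real J \<le> real q" using J(2) pwq by linarith
        have J0: "real J > 0" using J(1) by simp
        define N where "N = nat \<lfloor>sqrt (real q / real J)\<rfloor>"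
        have r1: "1 \<le> sqrt (real q / real J)" using Jq J0 by simp
        have N: "1 \<le> N" "real N \<le> sqrt (real q / real J)" "sqrt (real q / real J) \<le> 2 * real N"
        proof -
          show "1 \<le> N" using r1 unfolding N_def by (simp add: le_nat_iff le_floor_iff)
          show "real N \<le> sqrt (real q / real J)" using r1 unfolding N_def by linarith
          have "sqrt (real q / real J) < real N + 1" using r1 unfolding N_def by linarith
          then show "sqrt (real q / real J) \<le> 2 * real N" using \<open>1 \<le> N\<close> by linarith
        qed
        have sqr: "(sqrt (real q / real J))\<^sup>2 = real q / real J" by simp
        have NJ1: "real N ^ 2 * real J \<le> real q"
          using power_mono[OF N(2), of 2] J0 by (simp add: sqr pos_le_divide_eq)
        have NJ2: "real q \<le> 4 * (real N ^ 2 * real J)"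
          using power_mono[OF N(3), of 2] J0 by (simp add: sqr pos_divide_le_eq power_mult_distrib)
        have Nsq: "real N ^ 2 \<le> real q"
        proof -
          have "real N ^ 2 * 1 \<le> real N ^ 2 * real J" using J(1) by (intro mult_left_mono) auto
          then show ?thesis using NJ1 by linarith
        qed
        have small: "(real N + real ?n + 4) / real q \<le> \<epsilon>"
        proof -
          let ?s = "sqrt (real q)"
          have s: "max 1 ((real ?n + 5) / \<epsilon>) \<le> ?s" using qq0 unfolding q0_def by (intro real_le_rsqrt)
          have s1: "1 \<le> ?s" using s by simp
          have "real N \<le> ?s" using Nsq by (rule real_le_rsqrt)
          moreover have "real ?n + 4 \<le> (real ?n + 4) * ?s"
            using mult_left_mono[OF s1, of "real ?n + 4"] by (simp only: mult_1_right of_nat_0_le_iff add_nonneg_nonneg zero_le_numeral)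
          ultimately have "real N + (real ?n + 4) \<le> ?s + (real ?n + 4) * ?s" by (rule add_mono)
          then have "real N + real ?n + 4 \<le> ?s + (real ?n + 4) * ?s" by (simp only: add.assoc)
          also have "\<dots> = (real ?n + 5) * ?s" by (simp add: algebra_simps)
          also have "\<dots> \<le> (\<epsilon> * ?s) * ?s" using s \<epsilon> s1 by (intro mult_right_mono) (auto simp: pos_divide_le_eq mult.commute)
          also have "\<dots> = \<epsilon> * real q" by (simp add: mult.assoc)
          finally show ?thesis using qr by (simp add: pos_divide_le_eq)
        qed
        define K where "K = Suc (nat \<lfloor>2 * \<epsilon> * real q / real N\<rfloor>)"
        have KN: "real (K * N) > 2 * \<epsilon> * real q" "real (K * N) \<le> 2 * \<epsilon> * real q + real N"
        proof -
          have "0 \<le> 2 * \<epsilon> * real q / real N" using \<epsilon> by simp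
          then have "2 * \<epsilon> * real q / real N < real K" "real K \<le> 2 * \<epsilon> * real q / real N + 1"
            unfolding K_def by linarith+
          then show "real (K * N) > 2 * \<epsilon> * real q" "real (K * N) \<le> 2 * \<epsilon> * real q + real N"
            using N(1) by (simp_all add: field_simps)
        qed
        obtain x where x: "\<And>i. x0 $ i - \<epsilon> \<le> x $ i" "\<And>i. x $ i \<le> x0 $ i - \<epsilon> + 1 / real q"
          "finite (slice_points S f q)"
          "card (slice_points S f q) \<le> card {c \<in> PiE UNIV (\<lambda>_. {..<K * N}). \<forall>j. real q * f j (grid x (1 / real q) c) \<in> \<int>}"
          by (rule slice_points_count[where f = f, OF q KN(1) S], assumption) (rule that)
        let ?\<Omega> = "PiE (UNIV :: 'n set) (\<lambda>_. {..<K * N})"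
        let ?X = "A0 * ?l * (real q * sqrt (real q * real J) ^ (?n - 1))"
        have l0: "0 \<le> ?l" using l1 by linarith
        have X0: "0 \<le> ?X" using A0 l0 by simp
        have "real (card {c \<in> ?\<Omega>. \<forall>j. real q * f j (grid x (1 / real q) c) \<in> \<int>}) \<le> real (card ?\<Omega>) / real J ^ ?R + ?X"
        proof (rule weyl_count[OF _ J(1) X0])
          show "finite ?\<Omega>" by (intro finite_PiE) auto
          fix j j' :: "'r \<Rightarrow> nat"
          assume j: "j \<in> PiE UNIV (\<lambda>_. {..<J})" "j' \<in> PiE UNIV (\<lambda>_. {..<J})" "j \<noteq> j'"
          define t :: "real ^ 'r" where "t = (\<chi> r. real (j r) - real (j' r))"
          have tJ: "\<bar>t $ r\<bar> \<le> real J" for r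
          proof -
            have "j r < J" "j' r < J" using j by auto
            then have "\<bar>real (j r) - real (j' r)\<bar> \<le> real J" by linarith
            then show ?thesis by (simp add: t_def)
          qed
          obtain r where r: "j r \<noteq> j' r" using j(3) by auto
          then have "1 \<le> \<bar>real (j r) - real (j' r)\<bar>" by linarith
          also have "\<dots> = \<bar>t $ r\<bar>" by (simp add: t_def)
          also have "\<dots> \<le> norm t" by (rule component_le_norm_cart)
          finally have t1: "1 \<le> norm t" .
          have "norm (\<Sum>c\<in>?\<Omega>. cis (2 * pi * (real q * (\<Sum>j\<in>UNIV. t $ j * f j (grid x (1 / real q) c))))) \<le> ?X"
          proof (rule exps[OF _ Jq N(1) NJ1 NJ2 tJ t1])
            show "1 \<le> real J" using J(1) by simp
            show "x0 $ i - \<rho> \<le> x $ i" for i using x(1)[of i] \<epsilon> by (simp add: \<epsilon>_def)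
            show "x $ i + (real (K * N) + real ?n + 3) / real q \<le> x0 $ i + \<rho>" for i
            proof -
              have "(real (K * N) + real ?n + 3) / real q \<le> (2 * \<epsilon> * real q + real N + real ?n + 3) / real q"
                using KN(2) by (intro divide_right_mono) auto
              also have "\<dots> = 2 * \<epsilon> + (real N + real ?n + 4) / real q - 1 / real q"
                using qr by (simp add: field_simps)
              also have "\<dots> \<le> 2 * \<epsilon> + \<epsilon> - 1 / real q" using small by simp
              finally show ?thesis using x(2)[of i] by (simp add: \<epsilon>_def)
            qed
          qed
          then show "norm (\<Sum>c\<in>?\<Omega>. cis (2 * pi * (\<Sum>r\<in>UNIV. (real (j r) - real (j' r)) * (real q * f r (grid x (1 / real q) c))))) \<le> ?X"
            by (simp add: t_def sum_distrib_left mult_ac)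
        qed
        then have "real (card (slice_points S f q)) \<le> real (card ?\<Omega>) / real J ^ ?R + ?X"
          using of_nat_mono[OF x(4), where 'a = real] by linarith
        also have "\<dots> \<le> (2 * \<epsilon> + 1) ^ ?n * 2 ^ ?R * real q powr E + A0 * ?l * real q powr E"
        proof (rule add_mono)
          have "real (card ?\<Omega>) = real (K * N) ^ ?n" by (simp add: card_PiE)
          also have "\<dots> \<le> ((2 * \<epsilon> + 1) * real q) ^ ?n"
          proof (rule power_mono)
            have "real N * 1 \<le> real N ^ 2" using N(1) unfolding power2_eq_square by (intro mult_left_mono) auto
            then show "real (K * N) \<le> (2 * \<epsilon> + 1) * real q" using KN(2) Nsq by (simp add: algebra_simps)
          qed simp
          finally have c: "real (card ?\<Omega>) \<le> (2 * \<epsilon> + 1) ^ ?n * real q ^ ?n" by (simp add: power_mult_distrib)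
          have Jp: "(real q powr \<theta>) ^ ?R \<le> 2 ^ ?R * real J ^ ?R"
            using power_mono[OF J(3), of ?R] by (simp add: power_mult_distrib)
          have qE': "real q powr E * (real q powr \<theta>) ^ ?R = real q ^ ?n"
          proof -
            have "(real q powr \<theta>) ^ ?R = real q powr (real ?R * \<theta>)"
              using qr by (simp add: powr_realpow[symmetric] powr_powr mult.commute)
            then have "real q powr E * (real q powr \<theta>) ^ ?R = real q powr real ?n"
              by (simp add: E_def powr_add[symmetric])
            then show ?thesis using qr by (simp add: powr_realpow)
          qed
          have "real (card ?\<Omega>) \<le> (2 * \<epsilon> + 1) ^ ?n * (real q powr E * (real q powr \<theta>) ^ ?R)"
            using c qE' by simp
          also have "\<dots> \<le> (2 * \<epsilon> + 1) ^ ?n * (real q powr E * (2 ^ ?R * real J ^ ?R))"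
            using \<epsilon> Jp by (intro mult_left_mono) auto
          finally show "real (card ?\<Omega>) / real J ^ ?R \<le> (2 * \<epsilon> + 1) ^ ?n * 2 ^ ?R * real q powr E"
            using J0 by (simp add: pos_divide_le_eq mult_ac)
          have "sqrt (real q * real J) \<le> real q powr ((1 + \<theta>) / 2)"
          proof (rule real_le_lsqrt)
            have "real q * real J \<le> real q * real q powr \<theta>" using J(2) by (intro mult_left_mono) auto
            also have "\<dots> = real q powr (1 + \<theta>)" using qr by (simp add: powr_add)
            also have "\<dots> = (real q powr ((1 + \<theta>) / 2))\<^sup>2"
              by (simp only: power2_eq_square powr_add[symmetric] field_sum_of_halves)
            finally show "real q * real J \<le> (real q powr ((1 + \<theta>) / 2))\<^sup>2" .
          qed simp
          then have "sqrt (real q * real J) ^ (?n - 1) \<le> (real q powr ((1 + \<theta>) / 2)) ^ (?n - 1)"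
            by (intro power_mono) auto
          also have "\<dots> = real q powr ((1 + \<theta>) / 2 * (real ?n - 1))"
            using qr by (simp add: powr_realpow[symmetric] powr_powr of_nat_diff)
          finally have "real q * sqrt (real q * real J) ^ (?n - 1) \<le> real q powr 1 * real q powr ((1 + \<theta>) / 2 * (real ?n - 1))"
            using qr by (simp add: mult_left_mono)
          also have "\<dots> = real q powr E" by (simp only: powr_add[symmetric] E2)
          finally show "?X \<le> A0 * ?l * real q powr E" using A0 l0 by (intro mult_left_mono) auto
        qed
        also have "\<dots> \<le> (2 * \<epsilon> + 1) ^ ?n * 2 ^ ?R * (?l * real q powr E) + A0 * ?l * real q powr E"
          using \<epsilon> l1 by (intro add_right_mono mult_left_mono) (auto simp: mult_le_cancel_right1)
        also have "\<dots> = ((2 * \<epsilon> + 1) ^ ?n * 2 ^ ?R + A0) * (?l * real q powr E)"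
          by (simp add: algebra_simps)
        also have "\<dots> \<le> A * (?l * real q powr E)"
          using \<epsilon> q01 l0 by (intro mult_right_mono) (auto simp: A_def)
        finally show ?thesis using x(3) by (simp add: mult.assoc)
      qed
      then show "finite (slice_points S f q)"
        "real (card (slice_points S f q)) \<le> A * ?l * real q powr (real ?n - real ?R * \<theta>)"
        by (simp_all add: E_def)
    qed
  qed
qed

text \<open>A point of the graph is determined by \<open>q\<close> and its first numerators, so
  forgetting the others is injective. Since \<open>card\<close> of an infinite set is
  \<open>0\<close>, the injection gives a bound only when the slices are finite.\<close>

lemma rational_count_graph_le:
  fixes f :: "'r::finite \<Rightarrow> real ^ 'n::finite \<Rightarrow> real"
  assumes "\<And>q. q \<ge> 1 \<Longrightarrow> finite (slice_points S f q)"
  shows "rational_count (graph_over S f) Q \<le> (\<Sum>q=1..Q. card (slice_points S f q))"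
proof -
  let ?T = "{(a :: int ^ ('n + 'r), q :: nat). 1 \<le> q \<and> q \<le> Q \<and> (\<chi> k. real_of_int (a $ k) / real q) \<in> graph_over S f}"
  let ?g = "\<lambda>(a :: int ^ ('n + 'r), q :: nat). (q, \<chi> i. a $ Inl i)"
  let ?D = "SIGMA q:{1..Q}. slice_points S f q"
  have mem: "(\<chi> i. real_of_int (a $ Inl i) / real q) \<in> S \<and>
      (\<forall>j. real_of_int (a $ Inr j) = real q * f j (\<chi> i. real_of_int (a $ Inl i) / real q))"
    if "(a, q) \<in> ?T" for a q
  proof -
    obtain x where x: "x \<in> S" "(\<chi> k. real_of_int (a $ k) / real q) = (\<chi> k. case k of Inl i \<Rightarrow> x $ i | Inr j \<Rightarrow> f j x)"
      using \<open>(a, q) \<in> ?T\<close> by (auto simp: graph_over_def)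
    have k: "real_of_int (a $ k) / real q = (case k of Inl i \<Rightarrow> x $ i | Inr j \<Rightarrow> f j x)" for k
      using arg_cong[OF x(2), of "\<lambda>v. v $ k"] by simp
    have "(\<chi> i. real_of_int (a $ Inl i) / real q) = x" using k[of "Inl _"] by (simp add: vec_eq_iff)
    moreover have "real_of_int (a $ Inr j) = real q * f j x" for j
      using k[of "Inr j"] \<open>(a, q) \<in> ?T\<close> by (auto simp: field_simps)
    ultimately show ?thesis using x(1) by simp
  qed
  have inj: "inj_on ?g ?T"
  proof (rule inj_onI)
    fix u v assume u: "u \<in> ?T" and v: "v \<in> ?T" and eq: "?g u = ?g v"
    obtain a q b q' where uv: "u = (a, q)" "v = (b, q')" by (cases u, cases v)
    have qq: "q' = q" and l: "a $ Inl i = b $ Inl i" for i using eq by (auto simp: uv vec_eq_iff)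
    have "real_of_int (a $ Inr j) = real_of_int (b $ Inr j)" for j
      using mem[OF u[unfolded uv]] mem[OF v[unfolded uv]] by (simp add: qq l)
    then have "a $ k = b $ k" for k using l by (cases k) auto
    then show "u = v" by (simp add: uv qq vec_eq_iff)
  qed
  have im: "?g ` ?T \<subseteq> ?D"
  proof clarify
    fix a :: "int ^ ('n + 'r)" and q :: nat
    assume *: "1 \<le> q" "q \<le> Q" "(\<chi> k. real_of_int (a $ k) / real q) \<in> graph_over S f"
    then have T: "(a, q) \<in> ?T" by simp
    have "real q * f j (\<chi> i. real_of_int (a $ Inl i) / real q) \<in> \<int>" for j
      using mem[OF T] by (metis Ints_of_int)
    then show "q \<in> {1..Q} \<and> (\<chi> i. a $ Inl i) \<in> slice_points S f q"
      using * mem[OF T] by (simp add: slice_points_def)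
  qed
  have fD: "finite ?D" using assms by auto
  have "card ?T \<le> card ?D" by (rule card_inj_on_le[OF inj im fD])
  also have "\<dots> = (\<Sum>q=1..Q. card (slice_points S f q))" using assms by (intro card_SigmaI) auto
  finally show ?thesis by (simp add: rational_count_def)
qed

theorem corollary1p7:
  fixes f :: "'r::finite \<Rightarrow> real ^ 'n::finite \<Rightarrow> real"
    and x0 :: "real ^ 'n"
    and l :: nat
  assumes "CARD('n) \<ge> 4"
    and "real l > max (real CARD('n) + 1) (real CARD('n) / 2 + 4)"
    and "\<And>j. C_class l (f j)"
    and "\<And>t :: real ^ 'r. t \<noteq> 0 \<Longrightarrow>
           rank (hessian (\<lambda>x. \<Sum>j\<in>UNIV. t $ j * f j x) x0) \<ge> CARD('n) - 1"
  shows "\<exists>\<epsilon>1>0. \<forall>\<epsilon>0. 0 < \<epsilon>0 \<and> \<epsilon>0 \<le> \<epsilon>1 \<longrightarrow>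
           (\<exists>c>0. \<exists>C>0. \<forall>Q::nat. Q \<ge> 2 \<longrightarrow>
              real (rational_count (graph_over (closure (sup_ball x0 \<epsilon>0)) f) Q)
                \<le> C * real Q powr (real CARD('n)
                      - ((real CARD('r) - 1) * real CARD('n) + 1 - 3 * real CARD('r))
                          / (real CARD('n) + 2 * real CARD('r) - 1))
                    * ln (real Q) powr c)"
proof -
  let ?n = "CARD('n)" and ?R = "CARD('r)"
  let ?\<theta> = "(real ?n - 1) / (real ?n + 2 * real ?R - 1)"
  define E where "E = real ?n - real ?R * ?\<theta>"
  have "max 2 ?n \<le> l" using assms(1,2) by simp
  then have C: "C_class (max 2 ?n) (f j)" for j using assms(3) by (rule C_class_mono[rotated])
  have "\<exists>\<epsilon>>0. \<exists>A>0. \<forall>S q. (\<forall>x\<in>S. \<forall>i. \<bar>x $ i - x0 $ i\<bar> \<le> \<epsilon>) \<longrightarrow> q \<ge> 1 \<longrightarrow> finite (slice_points S f q) \<and>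
      real (card (slice_points S f q)) \<le> A * (2 + ln (real q)) ^ ?n * real q powr (real ?n - real ?R * ?\<theta>)"
    by (rule slice_points_bound[OF C assms(4)])
  then obtain \<epsilon> A where \<epsilon>: "\<epsilon> > 0" and A: "A > 0" and bound:
    "\<forall>S q. (\<forall>x\<in>S. \<forall>i. \<bar>x $ i - x0 $ i\<bar> \<le> \<epsilon>) \<longrightarrow> q \<ge> 1 \<longrightarrow> finite (slice_points S f q) \<and>
      real (card (slice_points S f q)) \<le> A * (2 + ln (real q)) ^ ?n * real q powr (real ?n - real ?R * ?\<theta>)"
    by (elim exE conjE)
  have nR: "real ?n + 2 * real ?R - 1 > 0"
  proof -
    have "1 \<le> real ?n" "1 \<le> real ?R" by simp_all
    then show ?thesis by linarith
  qed
  \<comment> \<open>Nonnegativity will allow each \<open>q\<close> in the sum to be replaced by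
    \<open>Q\<close>.\<close>
  have E0: "0 \<le> E"
  proof -
    have "real ?R * (real ?n - 1) \<le> real ?n * (real ?n + 2 * real ?R - 1)"
      using assms(1) by (simp add: algebra_simps add_increasing)
    then show ?thesis using nR by (simp add: E_def pos_divide_le_eq)
  qed
  \<comment> \<open>Summing over \<open>Q\<close> denominators adds 1 to the exponent; this brings
    it to the required form.\<close>
  have E1: "E + 1 = real ?n - ((real ?R - 1) * real ?n + 1 - 3 * real ?R) / (real ?n + 2 * real ?R - 1)"
    using nR by (simp add: E_def field_simps)
  show ?thesis
  proof (rule exI[of _ \<epsilon>], rule conjI[OF \<epsilon>], intro allI impI)
    fix \<epsilon>0 assume \<epsilon>0: "0 < \<epsilon>0 \<and> \<epsilon>0 \<le> \<epsilon>"
    let ?S = "closure (sup_ball x0 \<epsilon>0)"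
    \<comment> \<open>The slice bound holds for every \<open>S\<close> in this cube, so one
      \<open>\<epsilon>\<close> and one \<open>A\<close> serve all smaller radii.\<close>
    have "?S \<subseteq> cbox (x0 - \<epsilon> *\<^sub>R 1) (x0 + \<epsilon> *\<^sub>R 1)"
    proof (rule closure_minimal)
      show "sup_ball x0 \<epsilon>0 \<subseteq> cbox (x0 - \<epsilon> *\<^sub>R 1) (x0 + \<epsilon> *\<^sub>R 1)"
      proof
        fix x assume "x \<in> sup_ball x0 \<epsilon>0"
        then have "\<bar>(x - x0) $ i\<bar> < \<epsilon>" for i
          using component_le_infnorm_cart[of "x - x0" i] \<epsilon>0 by (simp add: sup_ball_def)
        then show "x \<in> cbox (x0 - \<epsilon> *\<^sub>R 1) (x0 + \<epsilon> *\<^sub>R 1)"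
          by (auto simp: mem_box_cart abs_less_iff algebra_simps intro: less_imp_le)
      qed
    qed (rule closed_cbox)
    then have S: "\<bar>x $ i - x0 $ i\<bar> \<le> \<epsilon>" if "x \<in> ?S" for x i
      using that by (force simp: mem_box_cart abs_le_iff algebra_simps)
    have fin: "finite (slice_points ?S f q)" if "q \<ge> 1" for q
      using bound[rule_format, of ?S q] S that by blast
    show "\<exists>c>0. \<exists>C>0. \<forall>Q::nat. Q \<ge> 2 \<longrightarrow>
              real (rational_count (graph_over ?S f) Q)
                \<le> C * real Q powr (real ?n - ((real ?R - 1) * real ?n + 1 - 3 * real ?R) / (real ?n + 2 * real ?R - 1))
                    * ln (real Q) powr c"
    \<comment> \<open>The \<open>n\<close> logarithms come from the box sums. For
      \<open>Q \<ge> 2\<close> one has \<open>ln Q \<ge> 2 / 3\<close>, hence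
      \<open>2 + ln Q \<le> 4 * ln Q\<close>, which explains \<open>4 ^ ?n\<close>.\<close>
    proof (rule exI[of _ "real ?n"], rule conjI, simp, rule exI[of _ "A * 4 ^ ?n"], intro conjI allI impI)
      fix Q :: nat assume Q: "Q \<ge> 2"
      have "ln (2 :: real) \<le> ln (real Q)" using Q by simp
      then have lnQ: "2 + ln (real Q) \<le> 4 * ln (real Q)" "0 < ln (real Q)"
        using ln2_ge_two_thirds by linarith+
      have "real (rational_count (graph_over ?S f) Q) \<le> (\<Sum>q=1..Q. real (card (slice_points ?S f q)))"
        using rational_count_graph_le[OF fin, of Q] by (simp only: of_nat_sum[symmetric] of_nat_le_iff)
      also have "\<dots> \<le> (\<Sum>q=1..Q. A * (2 + ln (real Q)) ^ ?n * real Q powr E)"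
      proof (rule sum_mono)
        fix q assume q: "q \<in> {1..Q}"
        have "real (card (slice_points ?S f q)) \<le> A * (2 + ln (real q)) ^ ?n * real q powr E"
          using bound[rule_format, of ?S q] S q unfolding E_def by simp
        also have "\<dots> \<le> A * (2 + ln (real Q)) ^ ?n * real Q powr E"
          using A q E0 by (intro mult_mono[OF mult_left_mono[OF power_mono] powr_mono2]) auto
        finally show "real (card (slice_points ?S f q)) \<le> A * (2 + ln (real Q)) ^ ?n * real Q powr E" .
      qed
      also have "\<dots> = A * (2 + ln (real Q)) ^ ?n * real Q powr (E + 1)"
        using Q by (simp add: powr_add)
      also have "\<dots> \<le> A * (4 * ln (real Q)) ^ ?n * real Q powr (E + 1)"
        using A lnQ by (intro mult_right_mono mult_left_mono power_mono) auto
      also have "\<dots> = A * 4 ^ ?n * real Q powr (E + 1) * ln (real Q) powr real ?n"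
        using lnQ(2) by (simp add: power_mult_distrib powr_realpow)
      finally show "real (rational_count (graph_over ?S f) Q)
                \<le> A * 4 ^ ?n * real Q powr (real ?n - ((real ?R - 1) * real ?n + 1 - 3 * real ?R) / (real ?n + 2 * real ?R - 1))
                    * ln (real Q) powr real ?n"
        unfolding E1 .
    qed (use A in auto)
  qed
qed

end
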